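(* Let $(\phi_t)$ be a semigroup of holomorphic self-maps of $\mathbb{D}$ which is not an elliptic group and let $A$ be a maximal contact arc for $(\phi_t)$. (1) If $A$ is exceptional, then $T(x)=\infty$ for all $x\in\overline{A}$. (2) If $A$ is not exceptional, then the function $\overline{A}\ni x\mapsto T(x)\in[0,+\infty]$ is continuous and strictly decreasing (with respect to the natural orientation of $A$ induced by $(\phi_t)$). Moreover, $T$ is bounded from above on $\overline{A}$ if and only if the initial point of $A$ is not a fixed point of $(\phi_t)$.
   Context: $\mathbb{D}$ is the open unit disc in $\mathbb{C}$. A semigroup $(\phi_t)_{t\ge0}$ of holomorphic self-maps of $\mathbb{D}$ is a continuous homomorphism $t\mapsto\phi_t$ from $([0,+\infty),+)$ to the holomorphic self-maps of $\mathbb{D}$ under composition, with the topology of uniform convergence on compacta. It is elliptic if there is a point of $\mathbb{D}$ fixed by all $\phi_t$; it is an elliptic group if moreover the $\phi_t$ are automorphisms of $\mathbb{D}$ (this includes the trivial semigroup). If it is not an elliptic group, its Denjoy--Wolff point is the unique $x\in\overline{\mathbb{D}}$ with $\lim_{t\to\infty}\phi_t(z)=x$ for all $z\in\mathbb{D}$. It is known that for each $\sigma\in\partial\mathbb{D}$ and $t\ge0$ the non-tangential limit $\phi_t(\sigma):=\angle\lim_{z\to\sigma}\phi_t(z)$ exists. The life-time of $\sigma\in\partial\mathbb{D}$ is $T(\sigma):=\sup\{t\ge 0:\phi_t(\sigma)\in\partial\mathbb{D}\}\in[0,+\infty]$. A point $\sigma\in\partial\mathbb{D}$ is a fixed point of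 $(\phi_t)$ if $\phi_t(\sigma)=\sigma$ for all $t>0$. The infinitesimal generator of $(\phi_t)$ is the holomorphic $G:\mathbb{D}\to\mathbb{C}$ with $\partial_t\phi_t(z)=G(\phi_t(z))$. A non-empty open arc $A\subset\partial\mathbb{D}$ is a contact arc for $(\phi_t)$ if $G$ extends holomorphically to $A$ with $\mathrm{Re}\{\overline z\,G(z)\}=0$ and $G(z)\ne0$ for all $z\in A$; it is maximal if it is not properly contained in another contact arc. A contact arc is endowed with the natural orientation induced by the unit vector field $G/|G|$, which determines its initial and final end-points. A maximal contact arc is exceptional if its final point is the Denjoy--Wolff point of $(\phi_t)$. *)

theory Defs
  imports "HOL-Complex_Analysis.Complex_Analysis"
begin

abbreviation disc :: "complex set"
  where "disc \<equiv> ball 0 1"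

text \<open>Only the values \<open>\<phi> t z\<close> with \<open>t \<ge> 0\<close> and \<open>z\<close> in the disc are meaningful.\<close>

definition holomorphic_semigroup :: "(real \<Rightarrow> complex \<Rightarrow> complex) \<Rightarrow> bool" where
  "holomorphic_semigroup \<phi> \<longleftrightarrow>
     (\<forall>t\<ge>0. \<phi> t holomorphic_on disc \<and> \<phi> t ` disc \<subseteq> disc) \<and>
     (\<forall>z\<in>disc. \<phi> 0 z = z) \<and>
     (\<forall>s\<ge>0. \<forall>t\<ge>0. \<forall>z\<in>disc. \<phi> (s + t) z = \<phi> s (\<phi> t z)) \<and>
     (\<forall>t\<ge>0. \<forall>K. compact K \<and> K \<subseteq> disc \<longrightarrow> uniform_limit K \<phi> (\<phi> t) (at t within {0..}))"

definition elliptic :: "(real \<Rightarrow> complex \<Rightarrow> complex) \<Rightarrow> bool" where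
  "elliptic \<phi> \<longleftrightarrow> (\<exists>z\<in>disc. \<forall>t\<ge>0. \<phi> t z = z)"

text \<open>A holomorphic bijection of the disc onto itself has a holomorphic inverse, so for
  holomorphic \<open>\<phi> t\<close> bijectivity says that \<open>\<phi> t\<close> is an automorphism.\<close>

definition elliptic_group :: "(real \<Rightarrow> complex \<Rightarrow> complex) \<Rightarrow> bool" where
  "elliptic_group \<phi> \<longleftrightarrow> elliptic \<phi> \<and> (\<forall>t\<ge>0. bij_betw (\<phi> t) disc disc)"

definition is_denjoy_wolff_point :: "(real \<Rightarrow> complex \<Rightarrow> complex) \<Rightarrow> complex \<Rightarrow> bool" where
  "is_denjoy_wolff_point \<phi> x \<longleftrightarrow>
     x \<in> cball 0 1 \<and> (\<forall>z\<in>disc. ((\<lambda>t. \<phi> t z) \<longlongrightarrow> x) at_top)"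

definition stolz_region :: "complex \<Rightarrow> real \<Rightarrow> complex set" where
  "stolz_region \<sigma> M = {z \<in> disc. norm (\<sigma> - z) < M * (1 - norm z)}"

definition has_nontangential_limit :: "(complex \<Rightarrow> complex) \<Rightarrow> complex \<Rightarrow> complex \<Rightarrow> bool" where
  "has_nontangential_limit f \<sigma> l \<longleftrightarrow> (\<forall>M>1. (f \<longlongrightarrow> l) (at \<sigma> within stolz_region \<sigma> M))"

definition nontangential_limit :: "(complex \<Rightarrow> complex) \<Rightarrow> complex \<Rightarrow> complex" where
  "nontangential_limit f \<sigma> = (THE l. has_nontangential_limit f \<sigma> l)"

definition life_time :: "(real \<Rightarrow> complex \<Rightarrow> complex) \<Rightarrow> complex \<Rightarrow> ereal" where
  "life_time \<phi> \<sigma> = Sup (ereal ` {t. t \<ge> 0 \<and> nontangential_limit (\<phi> t) \<sigma> \<in> sphere 0 1})"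

definition boundary_fixed_point :: "(real \<Rightarrow> complex \<Rightarrow> complex) \<Rightarrow> complex \<Rightarrow> bool" where
  "boundary_fixed_point \<phi> \<sigma> \<longleftrightarrow>
     \<sigma> \<in> sphere 0 1 \<and> (\<forall>t>0. nontangential_limit (\<phi> t) \<sigma> = \<sigma>)"

definition infinitesimal_generator ::
    "(real \<Rightarrow> complex \<Rightarrow> complex) \<Rightarrow> (complex \<Rightarrow> complex) \<Rightarrow> bool" where
  "infinitesimal_generator \<phi> G \<longleftrightarrow>
     G holomorphic_on disc \<and>
     (\<forall>z\<in>disc. \<forall>t\<ge>0. ((\<lambda>s. \<phi> s z) has_vector_derivative G (\<phi> t z)) (at t within {0..}))"

text \<open>\<open>F\<close> is a holomorphic extension to \<open>A\<close> of the infinitesimal generator.  The generator is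
  unique on the disc, so for \<open>A\<close> contained in the unit circle the values of \<open>F\<close> on \<open>A\<close> are
  determined by \<open>\<phi>\<close>.\<close>

definition generator_extension ::
    "(real \<Rightarrow> complex \<Rightarrow> complex) \<Rightarrow> complex set \<Rightarrow> (complex \<Rightarrow> complex) \<Rightarrow> bool" where
  "generator_extension \<phi> A F \<longleftrightarrow>
     (\<exists>G U. infinitesimal_generator \<phi> G \<and> open U \<and> A \<subseteq> U \<and>
            F holomorphic_on (disc \<union> U) \<and> (\<forall>z\<in>disc. F z = G z))"

text \<open>The circle minus one point is an open arc (its two end-points coincide); it does occur as a
  contact arc, for parabolic groups.  The whole circle has no end-points and is not an arc.\<close>

definition open_arc :: "complex set \<Rightarrow> bool" where
  "open_arc A \<longleftrightarrow> (\<exists>a b. a < b \<and> b \<le> a + 2 * pi \<and> A = cis ` {a<..<b})"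

definition contact_arc :: "(real \<Rightarrow> complex \<Rightarrow> complex) \<Rightarrow> complex set \<Rightarrow> bool" where
  "contact_arc \<phi> A \<longleftrightarrow>
     open_arc A \<and>
     (\<exists>F. generator_extension \<phi> A F \<and> (\<forall>z\<in>A. Re (cnj z * F z) = 0 \<and> F z \<noteq> 0))"

definition maximal_contact_arc :: "(real \<Rightarrow> complex \<Rightarrow> complex) \<Rightarrow> complex set \<Rightarrow> bool" where
  "maximal_contact_arc \<phi> A \<longleftrightarrow> contact_arc \<phi> A \<and> \<not> (\<exists>B. contact_arc \<phi> B \<and> A \<subset> B)"

text \<open>Arc-length parametrisations of the closure of a contact arc \<open>A\<close> by \<open>{a..b}\<close>, with velocity
  \<open>G / \<bar>G\<bar>\<close> on \<open>A\<close>.  For a contact arc they exist and are unique up to a translation of the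
  parameter interval.\<close>

definition natural_parametrisation ::
    "(real \<Rightarrow> complex \<Rightarrow> complex) \<Rightarrow> complex set \<Rightarrow> (real \<Rightarrow> complex) \<Rightarrow> real \<Rightarrow> real \<Rightarrow> bool" where
  "natural_parametrisation \<phi> A p a b \<longleftrightarrow>
     a < b \<and> continuous_on {a..b} p \<and> bij_betw p {a<..<b} A \<and>
     (\<exists>F. generator_extension \<phi> A F \<and>
          (\<forall>u\<in>{a<..<b}. (p has_vector_derivative F (p u) / of_real (norm (F (p u)))) (at u)))"

definition initial_point :: "(real \<Rightarrow> complex \<Rightarrow> complex) \<Rightarrow> complex set \<Rightarrow> complex" where
  "initial_point \<phi> A = (THE x. \<exists>p a b. natural_parametrisation \<phi> A p a b \<and> x = p a)"

definition final_point :: "(real \<Rightarrow> complex \<Rightarrow> complex) \<Rightarrow> complex set \<Rightarrow> complex" where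
  "final_point \<phi> A = (THE x. \<exists>p a b. natural_parametrisation \<phi> A p a b \<and> x = p b)"

definition arc_precedes ::
    "(real \<Rightarrow> complex \<Rightarrow> complex) \<Rightarrow> complex set \<Rightarrow> complex \<Rightarrow> complex \<Rightarrow> bool" where
  "arc_precedes \<phi> A x y \<longleftrightarrow>
     (\<exists>p a b u v. natural_parametrisation \<phi> A p a b \<and>
        a \<le> u \<and> u < v \<and> v \<le> b \<and> x = p u \<and> y = p v)"

definition exceptional :: "(real \<Rightarrow> complex \<Rightarrow> complex) \<Rightarrow> complex set \<Rightarrow> bool" where
  "exceptional \<phi> A \<longleftrightarrow>
     maximal_contact_arc \<phi> A \<and> is_denjoy_wolff_point \<phi> (final_point \<phi> A)"

end

(*
  Parametrise the maximal contact arc A by p in the direction of G, and let tau be a primitive of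
  1/|G| along A.  Near A the flow is the flow of the extended field, so phi_t extends to A by
  p u |-> p v with tau v = tau u + t as long as tau u + t stays below beta = sup tau.

  Since phi_t' = (G o phi_t) / G, at each point of A either phi_t converges to an interior point or
  |phi_t| -> 1.  If beta is finite, the first alternative holds as soon as tau u + t > beta:
  otherwise, phi_t with t = beta - tau u would extend by reflection to a biholomorphic map from a
  neighbourhood of p u to one of the final point, pushing G forward there; the arc would not be
  maximal, or the whole circle would consist of contact points and the semigroup would be periodic,
  hence an elliptic group.  So T(p u) = beta - tau u, and a one-sided Lindelof theorem gives the
  values of T at the end points as limits along A.

  If beta is infinite, then phi_t converges on an arc, and hence (two constants) on the disc, to the
  final point, which is the Denjoy-Wolff point.  If beta is finite, phi_t maps the final point into
  the disc, so it is not the Denjoy-Wolff point, by Wolff's lemma.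
*)
theory Submission
  imports Defs
begin

section \<open>The maximum principle and Schwarz-Pick estimates\<close>

text \<open>Maximality speaks only of where \<open>G\<close> extends, so the main difficulty is to
  show that \<open>\<phi> t\<close> cannot carry a point of the arc past its end and still have
  boundary values on the circle. No boundary differential equation helps there, because
  \<open>G\<close> need not extend at the end. What survives is the identity
  \<open>deriv (\<phi> t) z * G z = G (\<phi> t z)\<close> in the disc, with \<open>G\<close>
  bounded away from zero near the starting point. It yields the alternative between interior limits
  and modulus one, and it carries the field to the end once \<open>\<phi> t\<close> is known to be a
  chart across the circle. Reflection asks for a continuous extension, whereas only the modulus is
  known to converge: a barrier bounds \<open>1 - norm\<close> by a multiple of the distance to the
  boundary, Schwarz-Pick turns this into a Lipschitz bound, and a Hopf-type estimate makes the
  derivative nonzero. The end points are delicate for the same reason: limits are at hand along the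
  arc only, hence from one side, and both ends may be the same point of the circle. Harmonic measure
  of a subarc is the tool in all these places.\<close>

text \<open>Boundary behaviour enters only as a limsup, because the functions to which this is
  applied have no evident continuous extension to the whole boundary. The set \<open>K\<close> where
  the modulus is at least \<open>B + \<epsilon>\<close> is compact and stays away from the frontier
  of \<open>\<Omega>\<close>, so the ordinary maximum principle applies on \<open>K\<close>.\<close>

lemma maximum_modulus_limsup:
  fixes f :: "complex \<Rightarrow> complex"
  assumes holf: "f holomorphic_on \<Omega>" and op: "open \<Omega>" and bd: "bounded \<Omega>"
    and bdry: "\<And>\<zeta> \<epsilon>. \<zeta> \<in> frontier \<Omega> \<Longrightarrow> \<epsilon> > 0 \<Longrightarrow> \<forall>\<^sub>F z in at \<zeta> within \<Omega>. norm (f z) < B + \<epsilon>"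
    and z: "z \<in> \<Omega>"
  shows "norm (f z) \<le> B"
proof (rule field_le_epsilon)
  fix \<epsilon> :: real assume e: "\<epsilon> > 0"
  define K where "K = {z\<in>\<Omega>. norm (f z) \<ge> B + \<epsilon>}"
  have contf: "continuous_on \<Omega> f" using holf holomorphic_on_imp_continuous_on by blast
  have clK: "closed K"
    unfolding closed_sequential_limits
  proof (intro allI impI, elim conjE)
    fix x l assume x: "\<forall>n. x n \<in> K" and lim: "x \<longlonglongrightarrow> l"
    have inO: "x n \<in> \<Omega>" for n using x K_def by auto
    have "l \<in> closure \<Omega>" using inO lim closure_sequential by blast
    moreover have "l \<notin> frontier \<Omega>"
    proof
      assume l: "l \<in> frontier \<Omega>"
      then have "l \<notin> \<Omega>" using op by (simp add: frontier_def interior_open)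
      then have "x n \<noteq> l" for n using inO by metis
      then have "filterlim x (at l within \<Omega>) sequentially"
        using lim inO by (simp add: filterlim_at)
      then have "\<forall>\<^sub>F n in sequentially. norm (f (x n)) < B + \<epsilon>"
        using bdry[OF l e] unfolding filterlim_iff by blast
      moreover have "norm (f (x n)) \<ge> B + \<epsilon>" for n using x K_def by auto
      ultimately show False
        by (metis (no_types, lifting) eventually_False_sequentially eventually_mono not_le)
    qed
    ultimately have lO: "l \<in> \<Omega>"
      using op by (simp add: frontier_def interior_open)
    then have "isCont f l" using contf op continuous_on_eq_continuous_at by blast
    then have "(\<lambda>n. norm (f (x n))) \<longlonglongrightarrow> norm (f l)"
      using lim isCont_tendsto_compose tendsto_norm by blast
    then have "norm (f l) \<ge> B + \<epsilon>"
      by (rule LIMSEQ_le_const) (use x K_def in auto)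
    then show "l \<in> K" using lO K_def by auto
  qed
  have KO: "K \<subseteq> \<Omega>" using K_def by auto
  show "norm (f z) \<le> B + \<epsilon>"
  proof (cases "z \<in> K")
    case True
    show ?thesis
    proof (rule maximum_modulus_frontier[of f K])
      show "f holomorphic_on interior K"
        using holf KO interior_subset holomorphic_on_subset by blast
      show "continuous_on (closure K) f" using clK KO contf continuous_on_subset closure_closed by metis
      show "bounded K" using bd KO bounded_subset by blast
      fix w assume w: "w \<in> frontier K"
      then have wK: "w \<in> K" using clK frontier_subset_closed by blast
      show "norm (f w) \<le> B + \<epsilon>"
      proof (rule ccontr)
        assume "\<not> ?thesis"
        then have gt: "norm (f w) > B + \<epsilon>" by simp
        have "open (\<Omega> \<inter> (\<lambda>z. norm (f z)) -` {B + \<epsilon> <..})"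
          by (rule continuous_open_preimage) (use contf op in \<open>auto intro!: continuous_intros\<close>)
        moreover have "w \<in> \<Omega> \<inter> (\<lambda>z. norm (f z)) -` {B + \<epsilon> <..}" using gt wK KO by auto
        moreover have "\<Omega> \<inter> (\<lambda>z. norm (f z)) -` {B + \<epsilon> <..} \<subseteq> K" using K_def by auto
        ultimately have "w \<in> interior K" by (rule interiorI)
        then show False using w frontier_def by auto
      qed
    qed (use True in auto)
  qed (use z K_def in auto)
qed

text \<open>Moebius maps move \<open>w\<close> and \<open>f w\<close> to the origin, which reduces
  the claim to the Schwarz lemma.\<close>

lemma Schwarz_Pick:
  assumes holf: "f holomorphic_on ball 0 1" and f: "f ` ball 0 1 \<subseteq> ball 0 1"
    and z: "norm z < 1" and w: "norm w < 1"
  shows "norm ((f z - f w) / (1 - cnj (f w) * f z)) \<le> norm ((z - w) / (1 - cnj w * z))"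
proof -
  define m where "m = (\<lambda>w. Moebius_function 0 w)"
  define g where "g = (\<lambda>\<zeta>. m (f w) (f (m (-w) \<zeta>)))"
  have fw: "norm (f x) < 1" if "norm x < 1" for x using f that by force
  have mw: "norm (m (-w) \<zeta>) < 1" if "norm \<zeta> < 1" for \<zeta>
    unfolding m_def using Moebius_function_norm_lt_1[of "-w" \<zeta> 0] w that by auto
  have "f \<circ> m (-w) holomorphic_on ball 0 1"
    unfolding m_def
    by (rule holomorphic_on_compose_gen[OF Moebius_function_holomorphic holf])
       (use w mw[unfolded m_def] in auto)
  then have "m (f w) \<circ> (f \<circ> m (-w)) holomorphic_on ball 0 1"
    unfolding m_def
    by (rule holomorphic_on_compose_gen[OF _ Moebius_function_holomorphic])
       (use fw w mw[unfolded m_def] in auto)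
  then have "g holomorphic_on ball 0 1" by (simp add: g_def o_def)
  moreover have "g 0 = 0" by (simp add: g_def m_def Moebius_function_def)
  moreover have "norm (g x) < 1" if "norm x < 1" for x
    unfolding g_def m_def using fw[OF w] fw[OF mw[OF that]] Moebius_function_norm_lt_1
    by (simp add: m_def)
  ultimately have *: "norm (g x) \<le> norm x" if "norm x < 1" for x
    using Schwarz_Lemma[of g x] that by blast
  have "norm (m w z) < 1" unfolding m_def using Moebius_function_norm_lt_1 w z by blast
  then have "norm (g (m w z)) \<le> norm (m w z)" by (rule *)
  moreover have "m (-w) (m w z) = z"
    unfolding m_def using Moebius_function_compose[of "w" "-w" z] Moebius_function_compose[of "-w" "w" z] w z by simp
  ultimately show ?thesis by (simp add: g_def m_def Moebius_function_simple)
qed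

lemma one_minus_Moebius_norm:
  assumes "norm z < 1" "norm w < 1"
  shows "1 - (norm ((z - w) / (1 - cnj w * z)))\<^sup>2 = (1 - (norm z)\<^sup>2) * (1 - (norm w)\<^sup>2) / (norm (1 - cnj w * z))\<^sup>2"
proof -
  have "norm (cnj w * z) < 1" using assms
    by (simp add: norm_mult) (metis mult_strict_mono' norm_ge_zero mult.left_neutral)
  then have nz: "1 - cnj w * z \<noteq> 0" by auto
  have "(norm (1 - cnj w * z))\<^sup>2 - (norm (z - w))\<^sup>2 = (1 - (norm z)\<^sup>2) * (1 - (norm w)\<^sup>2)"
    by (simp only: cmod_power2) (simp add: algebra_simps power2_eq_square)
  then show ?thesis using nz by (simp add: norm_divide field_simps)
qed

text \<open>Schwarz-Pick solved for the quotient whose level sets become horocycles when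
  \<open>w\<close> tends to a boundary point. The factor that depends on \<open>w\<close> and
  \<open>f w\<close> alone is kept apart, so that one can pass to the limit along an orbit in
  Wolff's lemma; \<open>w = 0\<close> gives the growth estimate.\<close>

lemma Schwarz_Pick_power2:
  assumes holf: "f holomorphic_on ball 0 1" and f: "f ` ball 0 1 \<subseteq> ball 0 1"
    and z: "norm z < 1" and w: "norm w < 1"
  shows "(norm (1 - cnj (f w) * f z))\<^sup>2 / (1 - (norm (f z))\<^sup>2) \<le>
    (norm (1 - cnj w * z))\<^sup>2 / (1 - (norm z)\<^sup>2) * ((1 - (norm (f w))\<^sup>2) / (1 - (norm w)\<^sup>2))"
proof -
  have fw: "norm (f w) < 1" and fz: "norm (f z) < 1" using f z w by force+
  have nz: "norm (1 - cnj a * b) > 0" if "norm a < 1" "norm b < 1" for a b :: complex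
  proof -
    have "norm (cnj a * b) < 1" using that
      by (simp add: norm_mult) (metis mult_strict_mono' norm_ge_zero mult.left_neutral)
    then show ?thesis by auto
  qed
  have pos: "1 - (norm z)\<^sup>2 > 0" "1 - (norm w)\<^sup>2 > 0" "1 - (norm (f z))\<^sup>2 > 0" "1 - (norm (f w))\<^sup>2 > 0"
    using z w fz fw by (simp_all add: power_less_one_iff abs_square_less_1)
  have "(norm ((f z - f w) / (1 - cnj (f w) * f z)))\<^sup>2 \<le> (norm ((z - w) / (1 - cnj w * z)))\<^sup>2"
    using Schwarz_Pick[OF assms] by (simp add: power_mono)
  then have "(1 - (norm z)\<^sup>2) * (1 - (norm w)\<^sup>2) / (norm (1 - cnj w * z))\<^sup>2 \<le>
    (1 - (norm (f z))\<^sup>2) * (1 - (norm (f w))\<^sup>2) / (norm (1 - cnj (f w) * f z))\<^sup>2"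
    using one_minus_Moebius_norm[OF z w] one_minus_Moebius_norm[OF fz fw] by linarith
  moreover have "E / c \<le> D / a * (d / b)"
    if "a * b / D \<le> c * d / E" "a > 0" "b > 0" "c > 0" "d > 0" "D > 0" "E > 0" for a b c d D E :: real
  proof -
    have "a * b * E \<le> c * d * D" using that by (simp add: pos_divide_le_eq pos_le_divide_eq mult_ac)
    then show ?thesis using that by (simp add: pos_divide_le_eq pos_le_divide_eq field_simps)
  qed
  ultimately show ?thesis using nz[OF w z] nz[OF fw fz] pos by simp
qed

text \<open>The infinitesimal form of Schwarz-Pick: after rescaling the ball to the unit disc, one
  of the two points tends to the centre.\<close>

lemma Schwarz_Pick_deriv:
  assumes holf: "f holomorphic_on ball w r" and f: "f ` ball w r \<subseteq> ball 0 1" and r: "r > 0"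
  shows "norm (deriv f w) \<le> (1 - (norm (f w))\<^sup>2) / r"
proof -
  define g where "g = (\<lambda>z. f (w + of_real r * z))"
  have in_ball: "w + of_real r * z \<in> ball w r" if "norm z < 1" for z :: complex
    using that r by (simp add: dist_norm norm_mult)
  have "(f \<circ> (\<lambda>z. w + of_real r * z)) holomorphic_on ball 0 1"
    by (rule holomorphic_on_compose_gen[OF _ holf]) (use in_ball in \<open>auto intro!: holomorphic_intros\<close>)
  then have holg: "g holomorphic_on ball 0 1" by (simp add: g_def o_def)
  have g1: "g ` ball 0 1 \<subseteq> ball 0 1" using f in_ball unfolding g_def by force
  have "(f has_field_derivative deriv f w) (at w)"
    using holf r by (meson centre_in_ball holomorphic_derivI open_ball)
  then have dg: "(g has_field_derivative deriv f w * of_real r) (at 0)"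
    unfolding g_def
    by (intro DERIV_chain2[of f]) (auto intro!: derivative_eq_intros)
  have "((\<lambda>z. (g z - g 0) / z) \<longlongrightarrow> deriv f w * of_real r) (at 0)"
    using dg by (simp add: has_field_derivative_iff)
  then have 1: "((\<lambda>z. norm ((g z - g 0) / z)) \<longlongrightarrow> norm (deriv f w * of_real r)) (at 0)"
    by (rule tendsto_norm)
  have "g \<midarrow>0\<rightarrow> g 0" using dg DERIV_isCont isCont_def by blast
  then have "((\<lambda>z. norm (1 - cnj (g 0) * g z)) \<longlongrightarrow> norm (1 - cnj (g 0) * g 0)) (at 0)"
    by (intro tendsto_intros)
  moreover have "norm (1 - cnj (g 0) * g 0) = 1 - (norm (f w))\<^sup>2"
  proof -
    have "norm (f w) < 1" using f r by force
    then have "(norm (f w))\<^sup>2 \<le> 1" by (simp add: power_le_one)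
    moreover have "1 - cnj (g 0) * g 0 = of_real (1 - (norm (f w))\<^sup>2)"
      by (simp add: g_def complex_norm_square mult.commute flip: of_real_power)
    ultimately show ?thesis by (metis abs_of_nonneg diff_ge_0_iff_ge norm_of_real)
  qed
  ultimately have 2: "((\<lambda>z. norm (1 - cnj (g 0) * g z)) \<longlongrightarrow> 1 - (norm (f w))\<^sup>2) (at 0)" by simp
  have "\<forall>\<^sub>F z in at 0. norm ((g z - g 0) / z) \<le> norm (1 - cnj (g 0) * g z)"
    unfolding eventually_at
  proof (intro exI conjI ballI impI)
    fix z :: complex assume z: "z \<noteq> 0 \<and> dist z 0 < 1"
    have "norm ((g z - g 0) / (1 - cnj (g 0) * g z)) \<le> norm z"
      using Schwarz_Pick[OF holg g1, of z 0] z by simp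
    moreover have "1 - cnj (g 0) * g z \<noteq> 0"
    proof -
      have "norm (g 0) < 1" "norm (g z) < 1" using g1 z by (auto simp: image_subset_iff)
      then have "norm (cnj (g 0) * g z) < 1"
        by (simp add: norm_mult) (metis mult_strict_mono' norm_ge_zero mult.left_neutral)
      then show ?thesis by auto
    qed
    ultimately show "norm ((g z - g 0) / z) \<le> norm (1 - cnj (g 0) * g z)"
      using z by (simp add: norm_divide field_simps)
  qed simp
  then have "norm (deriv f w * of_real r) \<le> 1 - (norm (f w))\<^sup>2"
    by (rule tendsto_le[OF trivial_limit_at 2 1])
  then show ?thesis using r by (simp add: norm_mult field_simps)
qed

text \<open>A quantitative Hopf lemma: \<open>1 - norm (f z)\<close> decays at most linearly as
  \<open>z\<close> approaches the boundary of the ball, which will forbid a vanishing boundary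
  derivative. The factor 4 pays for the two estimates \<open>1 + A \<le> 2\<close> and
  \<open>1 - D\<^sup>2 \<le> 2 * (1 - D)\<close>.\<close>

lemma Schwarz_Pick_growth:
  assumes holf: "f holomorphic_on ball w r" and f: "f ` ball w r \<subseteq> ball 0 1" and z: "dist w z < r"
  shows "1 - norm (f z) \<ge> (1 - norm (f w)) * (1 - dist w z / r) / 4"
proof -
  define g where "g = (\<lambda>z. f (w + of_real r * z))"
  have r: "r > 0" using z by (meson le_less_trans zero_le_dist)
  have in_ball: "w + of_real r * z \<in> ball w r" if "norm z < 1" for z :: complex
    using that r by (simp add: dist_norm norm_mult)
  have "(f \<circ> (\<lambda>z. w + of_real r * z)) holomorphic_on ball 0 1"
    by (rule holomorphic_on_compose_gen[OF _ holf]) (use in_ball in \<open>auto intro!: holomorphic_intros\<close>)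
  then have holg: "g holomorphic_on ball 0 1" by (simp add: g_def o_def)
  have g1: "g ` ball 0 1 \<subseteq> ball 0 1" using f in_ball unfolding g_def by force
  define \<zeta> where "\<zeta> = (z - w) / of_real r"
  define x where "x = norm \<zeta>"
  have x: "x = dist w z / r" "x < 1" "x \<ge> 0"
    using z r by (simp_all add: x_def \<zeta>_def norm_divide dist_norm norm_minus_commute)
  define A where "A = norm (f w)"
  define D where "D = norm (f z)"
  have A: "A < 1" "A \<ge> 0" and D: "D < 1" "D \<ge> 0"
    using f r z by (auto simp: A_def D_def image_subset_iff)
  have gz: "g \<zeta> = f z" "g 0 = f w" using r by (simp_all add: g_def \<zeta>_def)
  have sp: "(norm (1 - cnj (f w) * f z))\<^sup>2 / (1 - D\<^sup>2) \<le> 1 / (1 - x\<^sup>2) * ((1 - A\<^sup>2))"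
    using Schwarz_Pick_power2[OF holg g1, of \<zeta> 0] x gz by (simp add: A_def D_def x_def)
  have sq: "x\<^sup>2 < 1" "A\<^sup>2 < 1" "D\<^sup>2 < 1" using A D x by (simp_all add: power_less_one_iff)
  have "1 - A \<le> norm (1 - cnj (f w) * f z)"
  proof -
    have "norm (cnj (f w) * f z) \<le> A"
      using A D by (simp add: norm_mult A_def D_def mult_left_le)
    then show ?thesis using norm_triangle_ineq2[of 1 "cnj (f w) * f z"] by simp
  qed
  then have "(1 - A)\<^sup>2 \<le> (norm (1 - cnj (f w) * f z))\<^sup>2" using A by (simp add: power_mono)
  then have "(1 - A)\<^sup>2 / (1 - D\<^sup>2) \<le> (norm (1 - cnj (f w) * f z))\<^sup>2 / (1 - D\<^sup>2)"
    using sq by (intro divide_right_mono) auto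
  with sp have "(1 - A)\<^sup>2 / (1 - D\<^sup>2) \<le> (1 - A\<^sup>2) / (1 - x\<^sup>2)" by simp
  then have "(1 - A)\<^sup>2 * (1 - x\<^sup>2) \<le> (1 - A\<^sup>2) * (1 - D\<^sup>2)" using sq
    by (simp add: pos_divide_le_eq pos_le_divide_eq field_simps)
  then have "(1 - A) * ((1 - A) * (1 - x\<^sup>2)) \<le> (1 - A) * ((1 + A) * (1 - D\<^sup>2))"
    by (simp add: power2_eq_square algebra_simps)
  then have *: "(1 - A) * (1 - x\<^sup>2) \<le> (1 + A) * (1 - D\<^sup>2)"
    using A by simp
  have fin: "a \<le> 4 * d" if "a \<le> b" "c \<le> 2 * e" "e \<le> 2 * d" "b \<le> c" for a b c d e :: real
    using that by linarith
  have "1 - x \<le> 1 - x\<^sup>2" using x(2,3) by (simp add: power2_eq_square mult_left_le)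
  then have "(1 - A) * (1 - x) \<le> (1 - A) * (1 - x\<^sup>2)" using A by (intro mult_left_mono) auto
  moreover have "(1 + A) * (1 - D\<^sup>2) \<le> 2 * (1 - D\<^sup>2)" using A sq by (intro mult_right_mono) auto
  moreover have "1 - D\<^sup>2 \<le> 2 * (1 - D)"
  proof -
    have "0 \<le> (1 - D)\<^sup>2" by simp
    then show ?thesis by (simp add: power2_eq_square algebra_simps)
  qed
  ultimately have "(1 - A) * (1 - x) \<le> 4 * (1 - D)" using * by (rule fin)
  then show ?thesis unfolding A_def D_def x(1) by simp
qed

text \<open>A continuity argument: the derivative is only controlled while the curve is within
  \<open>\<eta>\<close> of \<open>\<zeta>\<close>, but the length budget \<open>C * T\<close> is too
  small for leaving that ball. Both the stability of the boundary flow and the behaviour at contact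
  points come with bounds of this local kind.\<close>

lemma vector_derivative_trapped_bound:
  fixes \<gamma> :: "real \<Rightarrow> 'a :: euclidean_space"
  assumes der: "\<And>x. 0 \<le> x \<Longrightarrow> x \<le> T \<Longrightarrow> (\<gamma> has_vector_derivative \<gamma>' x) (at x within {0..T})"
    and bound: "\<And>x. 0 \<le> x \<Longrightarrow> x \<le> T \<Longrightarrow> norm (\<gamma> x - \<zeta>) \<le> \<eta> \<Longrightarrow> norm (\<gamma>' x) \<le> C"
    and start: "norm (\<gamma> 0 - \<zeta>) + C * T < \<eta>" and C: "C \<ge> 0" and T: "0 \<le> T"
  shows "norm (\<gamma> T - \<gamma> 0) \<le> C * T"
proof -
  have cont: "continuous_on {0..T} \<gamma>"
    unfolding continuous_on_eq_continuous_within
    by (intro ballI has_vector_derivative_continuous[OF der]) auto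
  have mv: "norm (\<gamma> y - \<gamma> 0) \<le> C * y"
    if y: "0 \<le> y" "y \<le> T" and small: "\<And>x. 0 < x \<Longrightarrow> x < y \<Longrightarrow> norm (\<gamma> x - \<zeta>) \<le> \<eta>" for y
  proof (cases "y = 0")
    case False
    with y have "y > 0" by simp
    have "norm (\<gamma> y - \<gamma> 0) \<le> C * y - C * 0"
    proof (rule differentiable_bound_general[OF \<open>y > 0\<close>, where f' = \<gamma>' and \<phi>' = "\<lambda>_. C"])
      show "continuous_on {0..y} \<gamma>" using cont y continuous_on_subset by fastforce
      fix x assume x: "0 < x" "x < y"
      have "at x within {0..T} = at x"
        by (rule at_within_interior) (use x y in auto)
      then show "(\<gamma> has_vector_derivative \<gamma>' x) (at x)" using der[of x] x y by simp
      show "norm (\<gamma>' x) \<le> C" using bound[of x] small x y by simp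
    qed (auto intro!: continuous_intros derivative_eq_intros simp flip: has_real_derivative_iff_has_vector_derivative)
    then show ?thesis by simp
  qed simp
  \<comment> \<open>The times at which the curve has left the open ball; at the first of them the
    mean value bound contradicts \<open>start\<close>.\<close>
  define S where "S = {x\<in>{0..T}. norm (\<gamma> x - \<zeta>) \<ge> \<eta>}"
  have "S = {}"
  proof (rule ccontr)
    assume ne: "S \<noteq> {}"
    have "closed S" unfolding S_def
      by (intro continuous_closed_preimage_constant continuous_on_closed_Collect_le continuous_intros cont closed_atLeastAtMost)
    moreover have bdd: "bdd_below S" unfolding S_def by (auto intro: bdd_belowI[of _ 0])
    ultimately have I: "Inf S \<in> S" using ne closed_contains_Inf by blast
    then have I2: "0 \<le> Inf S" "Inf S \<le> T" "norm (\<gamma> (Inf S) - \<zeta>) \<ge> \<eta>" unfolding S_def by auto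
    have "norm (\<gamma> (Inf S) - \<gamma> 0) \<le> C * Inf S"
    proof (rule mv)
      fix x assume x: "0 < x" "x < Inf S"
      then have "x \<notin> S" using cInf_lower[OF _ bdd] by fastforce
      then show "norm (\<gamma> x - \<zeta>) \<le> \<eta>" using x I2 unfolding S_def by auto
    qed (use I2 in auto)
    moreover have "C * Inf S \<le> C * T" using I2 C by (simp add: mult_left_mono)
    moreover have "norm (\<gamma> (Inf S) - \<zeta>) \<le> norm (\<gamma> (Inf S) - \<gamma> 0) + norm (\<gamma> 0 - \<zeta>)"
      by (metis diff_add_cancel norm_triangle_ineq add_diff_eq)
    ultimately show False using I2 start by linarith
  qed
  then have "norm (\<gamma> x - \<zeta>) \<le> \<eta>" if "0 < x" "x < T" for x
  proof -
    have "x \<notin> S" using \<open>S = {}\<close> by blast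
    then show ?thesis using that unfolding S_def by auto
  qed
  then show ?thesis using mv[of T] T by simp
qed

section \<open>Two constants and a one-sided Lindelof theorem\<close>

lemma stolz_region_accumulates:
  assumes "norm \<sigma> = 1"
  shows "at \<sigma> within stolz_region \<sigma> 2 \<noteq> bot"
proof -
  have "\<sigma> islimpt stolz_region \<sigma> 2"
    unfolding islimpt_approachable
  proof (intro allI impI)
    fix e :: real assume e: "e > 0"
    define r where "r = 1 - min (1/2) (e/2)"
    have r: "0 < r" "r < 1" "1 - r < e" using e by (auto simp: r_def min_def)
    have "\<sigma> - of_real r * \<sigma> = of_real (1 - r) * \<sigma>" by (simp add: algebra_simps)
    then have d: "norm (\<sigma> - of_real r * \<sigma>) = 1 - r" using assms r by (simp add: norm_mult del: of_real_diff)
    have nr: "norm (of_real r * \<sigma>) = r" using assms r by (simp add: norm_mult)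
    have "of_real r * \<sigma> \<in> stolz_region \<sigma> 2" using d nr r by (auto simp: stolz_region_def)
    moreover have "of_real r * \<sigma> \<noteq> \<sigma>" using d r by auto
    moreover have "dist (of_real r * \<sigma>) \<sigma> < e" using d r by (simp add: dist_norm norm_minus_commute)
    ultimately show "\<exists>x'\<in>stolz_region \<sigma> 2. x' \<noteq> \<sigma> \<and> dist x' \<sigma> < e" by blast
  qed
  then show ?thesis by (simp add: trivial_limit_within)
qed

lemma disc_accumulates:
  assumes "norm \<sigma> = 1"
  shows "at \<sigma> within disc \<noteq> bot"
proof -
  have "at \<sigma> within stolz_region \<sigma> 2 \<le> at \<sigma> within disc"
    by (rule at_le) (auto simp: stolz_region_def)
  then show ?thesis using stolz_region_accumulates[OF assms] by (metis bot.extremum_uniqueI)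
qed

lemma nontangential_limit_eqI:
  assumes "norm \<sigma> = 1" "has_nontangential_limit f \<sigma> l"
  shows "nontangential_limit f \<sigma> = l"
  unfolding nontangential_limit_def
proof (rule the_equality)
  fix l' assume "has_nontangential_limit f \<sigma> l'"
  then have "(f \<longlongrightarrow> l') (at \<sigma> within stolz_region \<sigma> 2)"
    by (simp add: has_nontangential_limit_def)
  moreover have "(f \<longlongrightarrow> l) (at \<sigma> within stolz_region \<sigma> 2)"
    using assms by (simp add: has_nontangential_limit_def)
  ultimately show "l' = l"
    using tendsto_unique[OF stolz_region_accumulates[OF assms(1)]] by blast
qed (rule assms)

lemma has_nontangential_limitI:
  assumes "(f \<longlongrightarrow> l) (at \<sigma> within disc)"
  shows "has_nontangential_limit f \<sigma> l"
  unfolding has_nontangential_limit_def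
  by (intro allI impI tendsto_within_subset[OF assms]) (auto simp: stolz_region_def)

text \<open>The Moebius map of the disc onto the right half plane with \<open>1\<close> going to
  infinity and \<open>cis \<delta>\<close> to \<open>0\<close>. The rotation factor puts the arc
  from \<open>1\<close> to \<open>cis \<delta>\<close> on the positive imaginary axis and the rest
  of the circle on the negative one, so that \<open>Arg\<close> separates the two arcs.\<close>

definition arc_angle :: "real \<Rightarrow> complex \<Rightarrow> complex" where
  "arc_angle \<delta> z = - \<i> * cis (- \<delta> / 2) * ((cis \<delta> - z) / (1 - z))"

lemma Im_divide_cnj: "Im (a / b) = Im (a * cnj b) / (norm b)\<^sup>2"
  by (simp add: Im_divide cmod_power2 Re_complex_div_gt_0)

lemma one_minus_cis: "1 - cis x = - 2 * \<i> * sin (x / 2) * cis (x / 2)"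
proof -
  have s: "sin x = 2 * sin (x/2) * cos (x/2)" using sin_double[of "x/2"] by simp
  have c: "cos x = 1 - 2 * (sin (x/2))\<^sup>2" using cos_double_sin[of "x/2"] by simp
  show ?thesis unfolding complex_eq_iff
    by (simp add: s c power2_eq_square algebra_simps)
qed

lemma arc_angle_cis:
  assumes "0 < x" "x < 2 * pi"
  shows "arc_angle \<delta> (cis x) = \<i> * complex_of_real (sin ((\<delta> - x) / 2) / sin (x / 2))"
proof -
  have sx: "sin (x/2) > 0" using assms by (intro sin_gt_zero) auto
  have "cis \<delta> - cis x = cis x * - (1 - cis (\<delta> - x))"
    by (simp add: algebra_simps cis_mult)
  also have "\<dots> = cis x * (2 * \<i> * sin ((\<delta> - x) / 2) * cis ((\<delta> - x) / 2))"
    using one_minus_cis[of "\<delta> - x"] by simp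
  finally have 1: "cis \<delta> - cis x = 2 * \<i> * sin ((\<delta> - x) / 2) * (cis x * cis ((\<delta> - x) / 2))" by simp
  have "cis (- \<delta> / 2) * (cis x * cis ((\<delta> - x) / 2)) = cis (x / 2)"
    by (simp add: cis_mult field_simps)
  then show ?thesis unfolding arc_angle_def 1 one_minus_cis[of x] using sx
    by (simp add: field_simps)
qed

lemma arc_angle_Re_pos:
  assumes d: "0 < \<delta>" "\<delta> < 2 * pi" and z: "norm z < 1"
  shows "Re (arc_angle \<delta> z) > 0"
proof -
  have nz: "1 - z \<noteq> 0" using z by auto
  have "Re (arc_angle \<delta> z) = Im (cis (- \<delta> / 2) * (cis \<delta> - z) / (1 - z))"
  proof -
    have "arc_angle \<delta> z = - \<i> * (cis (- \<delta> / 2) * (cis \<delta> - z) / (1 - z))"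
      by (simp add: arc_angle_def)
    then show ?thesis by (simp only: mult_minus_left uminus_complex.sel Re_i_times)
  qed
  also have "\<dots> = Im (cis (- \<delta> / 2) * (cis \<delta> - z) * cnj (1 - z)) / (norm (1 - z))\<^sup>2"
    by (rule Im_divide_cnj)
  also have "cis (- \<delta> / 2) * (cis \<delta> - z) = cis (\<delta> / 2) - cis (- \<delta> / 2) * z"
    by (simp add: algebra_simps cis_mult)
  also have "Im ((cis (\<delta> / 2) - cis (- \<delta> / 2) * z) * cnj (1 - z)) = sin (\<delta> / 2) * (1 - (norm z)\<^sup>2)"
    unfolding cmod_power2 by (simp add: algebra_simps power2_eq_square)
  finally show ?thesis
    using assms nz sin_gt_zero[of "\<delta>/2"] by (simp add: abs_square_less_1)
qed

text \<open>An imaginary power of a half-plane variable is a zero-free holomorphic function whose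
  modulus is constant on each half of the imaginary axis.\<close>

lemma norm_exp_Ln_weight:
  assumes "w \<noteq> 0"
  shows "norm (exp (- \<i> * of_real N * Ln w)) = exp (N * Arg w)"
  using assms by (simp add: Arg_eq_Im_Ln)

lemma Arg_Re_pos: "Re w > 0 \<Longrightarrow> \<bar>Arg w\<bar> < pi / 2"
  by (metis Arg_eq_Im_Ln Re_Ln_pos_lt less_irrefl zero_complex.sel(1))

text \<open>For a point of the disc, \<open>(Arg (arc_angle \<delta> z) + \<pi> / 2) / \<pi>\<close> is the harmonic measure of the
  arc from \<open>1\<close> to \<open>cis \<delta>\<close>, so this is the two-constants theorem.\<close>

lemma two_constants_arc_base:
  assumes holq: "q holomorphic_on disc" and qK: "\<And>z. z \<in> disc \<Longrightarrow> norm (q z) \<le> K"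
    and d: "0 < \<delta>" "\<delta> < 2 * pi" and N: "N \<ge> 0"
    and arc: "\<And>x \<epsilon>. 0 < x \<Longrightarrow> x < \<delta> \<Longrightarrow> \<epsilon> > 0 \<Longrightarrow>
      \<forall>\<^sub>F z in at (cis x) within disc. norm (q z) < K * exp (- N * pi) + \<epsilon>"
    and z: "z \<in> disc"
  shows "norm (q z) \<le> K * exp (- N * (pi / 2 + Arg (arc_angle \<delta> z)))"
proof -
  have K: "K \<ge> 0" using qK[of 0] by (meson centre_in_ball norm_ge_zero order_trans zero_less_one)
  define e2 where "e2 = cis \<delta>"
  have e2: "norm e2 = 1" "e2 \<noteq> 0" by (simp_all add: e2_def)
  define w where "w = arc_angle \<delta>"
  have wpos: "Re (w z) > 0" if "z \<in> disc" for z using arc_angle_Re_pos d that by (simp add: w_def)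
  have Re1: "Re (1 - z) > 0" if "norm z \<le> 1" "z \<noteq> 1" for z
  proof -
    have "Re z \<le> 1" using that complex_Re_le_cmod order_trans by blast
    moreover have "Re z \<noteq> 1"
    proof
      assume 1: "Re z = 1"
      have "(Re z)\<^sup>2 + (Im z)\<^sup>2 \<le> 1" using that(1) by (metis cmod_power2 norm_ge_zero power_le_one)
      then have "Im z = 0" using 1 by simp
      then show False using 1 that(2) by (simp add: complex_eq_iff)
    qed
    ultimately show ?thesis by simp
  qed
  have Re2: "Re (1 - z / e2) > 0" if "norm z \<le> 1" "z \<noteq> e2" for z
    using Re1[of "z / e2"] that e2 by (simp add: norm_divide)
  \<comment> \<open>A Phragmen-Lindelof factor: it vanishes at the two end points of the arc, where
    the modulus of \<open>W\<close> jumps, and it disappears as \<open>\<mu>\<close> tends to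
    \<open>0\<close>.\<close>
  define P where "P = (\<lambda>\<mu> z. exp (of_real \<mu> * Ln (1 - z)) * exp (of_real \<mu> * Ln (1 - z / e2)))"
  have normP: "norm (P \<mu> z) = norm (1 - z) powr \<mu> * norm (1 - z / e2) powr \<mu>"
    if "z \<noteq> 1" "z \<noteq> e2" for \<mu> z
    using that e2 by (simp add: P_def norm_mult powr_def)
  define W where "W = (\<lambda>z. exp (- \<i> * of_real N * Ln (w z)))"
  have normW: "norm (W z) = exp (N * Arg (w z))" if "z \<in> disc" for z
    unfolding W_def by (rule norm_exp_Ln_weight) (use wpos[OF that] in auto)
  have W_le: "norm (W z) \<le> exp (N * (pi / 2))" if "z \<in> disc" for z
  proof -
    have "Arg (w z) \<le> pi / 2" using Arg_Re_pos[OF wpos[OF that]] by linarith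
    then show ?thesis unfolding normW[OF that] exp_le_cancel_iff by (rule mult_left_mono[OF _ N])
  qed
  \<comment> \<open>\<open>W\<close> has modulus \<open>exp (N * (pi / 2))\<close> on the arc and
    the reciprocal of this on the rest of the circle, so this one constant bounds
    \<open>q * W\<close> on both.\<close>
  define C where "C = K * exp (- N * (pi / 2))"
  have C0: "C \<ge> 0" using K by (simp add: C_def)
  have bound: "norm (q z * W z * P \<mu> z) \<le> C * 4 powr \<mu>" if mu: "\<mu> > 0" and z: "z \<in> disc" for \<mu> z
  proof (rule maximum_modulus_limsup[of "\<lambda>z. q z * W z * P \<mu> z" disc])
    have "w holomorphic_on disc" unfolding w_def arc_angle_def
      by (auto intro!: holomorphic_intros)
    moreover have "w z \<notin> \<real>\<^sub>\<le>\<^sub>0" "1 - z \<notin> \<real>\<^sub>\<le>\<^sub>0" "1 - z / e2 \<notin> \<real>\<^sub>\<le>\<^sub>0" if "z \<in> disc" for z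
    proof -
      have "z \<noteq> 1" "z \<noteq> e2" "norm z \<le> 1" using that e2 by auto
      then show "w z \<notin> \<real>\<^sub>\<le>\<^sub>0" "1 - z \<notin> \<real>\<^sub>\<le>\<^sub>0" "1 - z / e2 \<notin> \<real>\<^sub>\<le>\<^sub>0"
        using wpos[OF that] Re1[of z] Re2[of z] by (simp_all only: complex_nonpos_Reals_iff not_le de_Morgan_conj simp_thms)
    qed
    ultimately show "(\<lambda>z. q z * W z * P \<mu> z) holomorphic_on disc"
      unfolding W_def P_def
      by (intro holomorphic_intros holq) (use e2 in auto)
    fix \<zeta> :: complex and \<epsilon> :: real
    assume "\<zeta> \<in> frontier disc" and eps: "\<epsilon> > 0"
    then have z1: "norm \<zeta> = 1" by simp
    have disc1: "\<forall>\<^sub>F z in at \<zeta> within disc. z \<in> disc" by (simp add: eventually_at_filter)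
    have disc2: "\<forall>\<^sub>F z in at \<zeta> within disc. norm (P \<mu> z) \<le> 4 powr \<mu>"
      using disc1
    proof eventually_elim
      case (elim z)
      then have ne: "z \<noteq> 1" "z \<noteq> e2" using e2 by auto
      have "norm (1 - z) \<le> 2" using elim norm_triangle_ineq4[of 1 z] by simp
      moreover have "norm (1 - z / e2) \<le> 2" using elim norm_triangle_ineq4[of 1 "z / e2"] e2 by (simp add: norm_divide)
      ultimately have "norm (P \<mu> z) \<le> 2 powr \<mu> * 2 powr \<mu>"
        unfolding normP[OF ne] using mu by (intro mult_mono powr_mono2) auto
      then show ?case by (simp flip: powr_mult)
    qed
    show "\<forall>\<^sub>F z in at \<zeta> within disc. norm (q z * W z * P \<mu> z) < C * 4 powr \<mu> + \<epsilon>"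
    proof (cases "\<zeta> = 1 \<or> \<zeta> = e2")
      case True
      have "((\<lambda>z. norm (1 - z) powr \<mu> * norm (1 - z / e2) powr \<mu>) \<longlongrightarrow> norm (1 - \<zeta>) powr \<mu> * norm (1 - \<zeta> / e2) powr \<mu>)
        (at \<zeta> within disc)"
        by (intro tendsto_intros tendsto_powr2) (use mu e2 in auto)
      moreover have "norm (1 - \<zeta>) powr \<mu> * norm (1 - \<zeta> / e2) powr \<mu> = 0" using True e2 by auto
      ultimately have "((\<lambda>z. norm (1 - z) powr \<mu> * norm (1 - z / e2) powr \<mu>) \<longlongrightarrow> 0) (at \<zeta> within disc)"
        by (simp only:)
      then have "((\<lambda>z. K * exp (N * (pi / 2)) * (norm (1 - z) powr \<mu> * norm (1 - z / e2) powr \<mu>)) \<longlongrightarrow>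
         K * exp (N * (pi / 2)) * 0) (at \<zeta> within disc)"
        by (rule tendsto_mult_left)
      then have "\<forall>\<^sub>F z in at \<zeta> within disc. K * exp (N * (pi / 2)) * (norm (1 - z) powr \<mu> * norm (1 - z / e2) powr \<mu>) < \<epsilon>"
        using eps by (simp add: order_tendstoD)
      then show ?thesis using disc1
      proof eventually_elim
        case (elim z)
        then have ne: "z \<noteq> 1" "z \<noteq> e2" using e2 by auto
        have "norm (q z * W z * P \<mu> z) \<le> K * exp (N * (pi / 2)) * norm (P \<mu> z)"
          unfolding norm_mult using qK[OF elim(2)] W_le[OF elim(2)] by (intro mult_mono) (auto simp: K)
        also have "\<dots> < \<epsilon>" using elim normP[OF ne] by simp
        finally show ?case using C0 by (simp add: add_strict_increasing2)
      qed
    next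
      case False
      obtain x where x: "0 \<le> x" "x < 2 * pi" "\<zeta> = cis x"
        using z1 by (metis Arg2pi_ge_0 Arg2pi_lt_2pi complex_norm_eq_1_exp exp_eq_polar mult.commute cis_conv_exp)
      have x0: "x \<noteq> 0" "x \<noteq> \<delta>" using False x e2_def by auto
      define k where "k = sin ((\<delta> - x) / 2) / sin (x / 2)"
      have wz: "w \<zeta> = \<i> * of_real k" unfolding w_def x(3) k_def by (rule arc_angle_cis) (use x x0 in auto)
      have sx: "sin (x/2) > 0" using x x0 by (intro sin_gt_zero) auto
      have ksgn: "if x < \<delta> then k > 0 else k < 0"
      proof (cases "x < \<delta>")
        case True
        then have "sin ((\<delta> - x) / 2) > 0" using d x by (intro sin_gt_zero) auto
        then show ?thesis using sx True by (simp add: k_def)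
      next
        case f: False
        then have "sin ((x - \<delta>) / 2) > 0" using d x x0 by (intro sin_gt_zero) auto
        then have "sin ((\<delta> - x) / 2) < 0" by (metis minus_diff_eq minus_divide_left neg_less_0_iff_less sin_minus)
        then show ?thesis using sx f by (simp add: k_def divide_neg_pos)
      qed
      then have wnz: "w \<zeta> \<notin> \<real>\<^sub>\<le>\<^sub>0" using wz by (auto simp: complex_nonpos_Reals_iff split: if_splits)
      have contw: "(w \<longlongrightarrow> w \<zeta>) (at \<zeta> within disc)"
        unfolding w_def arc_angle_def by (intro tendsto_intros) (use False in auto)
      have Wlim: "((\<lambda>z. norm (W z)) \<longlongrightarrow> norm (exp (- \<i> * of_real N * Ln (w \<zeta>)))) (at \<zeta> within disc)"
        unfolding W_def by (intro tendsto_intros contw) (use wnz in auto)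
      have "Arg (w \<zeta>) = (if x < \<delta> then pi / 2 else - pi / 2)"
      proof (cases "x < \<delta>")
        case True
        then have "w \<zeta> = of_real k * \<i>" "k > 0" using wz ksgn by auto
        then show ?thesis using True by (simp only: Arg_times_of_real Arg_ii if_True)
      next
        case False
        then have "w \<zeta> = of_real (- k) * (- \<i>)" "- k > 0" using wz ksgn by auto
        then show ?thesis using False by (simp only: Arg_times_of_real Arg_minus_ii if_False)
      qed
      then have "norm (exp (- \<i> * of_real N * Ln (w \<zeta>))) = exp (N * (if x < \<delta> then pi / 2 else - pi / 2))"
      proof -
        have "w \<zeta> \<noteq> 0" using wnz by auto
        then show ?thesis using norm_exp_Ln_weight \<open>Arg (w \<zeta>) = _\<close> by metis
      qed
      moreover define E where "E = exp (N * (if x < \<delta> then pi / 2 else - pi / 2))"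
      ultimately have Wlim: "((\<lambda>z. norm (W z)) \<longlongrightarrow> E) (at \<zeta> within disc)"
        using Wlim by (simp only:)
      define \<beta> where "\<beta> = (if x < \<delta> then K * exp (- N * pi) else K)"
      have "C = \<beta> * E"
        unfolding \<beta>_def C_def E_def by (simp add: field_simps flip: exp_add)
      \<comment> \<open>The bounds for \<open>q\<close> and \<open>W\<close> hold up to a slack
        only; a common slack \<open>\<epsilon>'\<close> is taken so small that the product still
        stays below the target.\<close>
      then have "((\<lambda>\<epsilon>'. (\<beta> + \<epsilon>') * (E + \<epsilon>') * 4 powr \<mu>) \<longlongrightarrow> C * 4 powr \<mu>) (at_right 0)"
        by (auto intro!: tendsto_eq_intros)
      then have "\<forall>\<^sub>F \<epsilon>' in at_right 0. (\<beta> + \<epsilon>') * (E + \<epsilon>') * 4 powr \<mu> < C * 4 powr \<mu> + \<epsilon>"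
        by (rule order_tendstoD) (use eps in simp)
      then obtain \<epsilon>' where e': "\<epsilon>' > 0"
        "(\<beta> + \<epsilon>') * (E + \<epsilon>') * 4 powr \<mu> < C * 4 powr \<mu> + \<epsilon>"
        by (metis (mono_tags, lifting) eventually_at_right_field dense)
      have "\<forall>\<^sub>F z in at \<zeta> within disc. norm (W z) < E + \<epsilon>'"
        using Wlim e'(1) by (simp add: order_tendstoD)
      moreover have "\<forall>\<^sub>F z in at \<zeta> within disc. norm (q z) < \<beta> + \<epsilon>'"
      proof (cases "x < \<delta>")
        case True
        then show ?thesis using arc[of x \<epsilon>'] x x0 e'(1) by (simp add: \<beta>_def)
      next
        case f: False
        show ?thesis using disc1 by eventually_elim (use qK e'(1) f in \<open>force simp: \<beta>_def\<close>)
      qed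
      ultimately show ?thesis using disc2
      proof eventually_elim
        case (elim z)
        have "norm (q z * W z * P \<mu> z) \<le> (\<beta> + \<epsilon>') * (E + \<epsilon>') * 4 powr \<mu>"
          unfolding norm_mult using elim e'(1) K by (intro mult_mono) (auto simp: \<beta>_def E_def intro!: add_nonneg_nonneg)
        then show ?case using e'(2) by linarith
      qed
    qed
  qed (use z in auto)
  have nez: "z \<noteq> 1" "z \<noteq> e2" using z e2 by auto
  \<comment> \<open>Let \<open>\<mu>\<close> tend to \<open>0\<close> at the fixed interior point
    \<open>z\<close>.\<close>
  have "((\<lambda>\<mu>. norm (q z * W z) * (norm (1 - z) powr \<mu> * norm (1 - z / e2) powr \<mu>)) \<longlongrightarrow> norm (q z * W z) * (norm (1 - z) powr 0 * norm (1 - z / e2) powr 0)) (at_right 0)"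
    by (intro tendsto_intros) (use nez e2 in auto)
  moreover have "norm (1 - z) powr 0 * norm (1 - z / e2) powr 0 = 1" using nez e2 by simp
  ultimately have l1: "((\<lambda>\<mu>. norm (q z * W z) * (norm (1 - z) powr \<mu> * norm (1 - z / e2) powr \<mu>)) \<longlongrightarrow> norm (q z * W z)) (at_right 0)"
    by (simp del: powr_zero_eq_one)
  have l2: "((\<lambda>\<mu>. C * 4 powr \<mu>) \<longlongrightarrow> C) (at_right 0)" by (auto intro!: tendsto_eq_intros)
  have "norm (q z * W z) \<le> C"
    by (rule tendsto_le[OF _ l2 l1])
       (use bound[OF _ z] nez in \<open>auto simp: normP norm_mult eventually_at_right_less intro!: eventually_at_rightI[of 0 1]\<close>)
  then have "norm (q z) * exp (N * Arg (w z)) \<le> K * exp (- N * (pi / 2))"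
    using normW[OF z] by (simp add: norm_mult C_def)
  then have "norm (q z) \<le> K * exp (- N * (pi / 2)) / exp (N * Arg (w z))"
    by (simp add: pos_le_divide_eq)
  also have "\<dots> = K * exp (- N * (pi / 2) - N * Arg (w z))" by (simp add: exp_diff)
  also have "- N * (pi / 2) - N * Arg (w z) = - N * (pi / 2 + Arg (w z))" by (simp add: algebra_simps)
  finally show ?thesis unfolding w_def .
qed

lemma ex_exp_neg_less:
  fixes c \<epsilon> :: real
  assumes c: "c > 0" and eps: "\<epsilon> > 0"
  obtains N where "N \<ge> 0" "2 * exp (- N * c) < \<epsilon>"
proof
  define N where "N = 2 / (\<epsilon> * c)"
  show "N \<ge> 0" using assms by (simp add: N_def)
  have "N * c = 2 / \<epsilon>" using c by (simp add: N_def)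
  moreover have "N * c < exp (N * c)" using exp_ge_add_one_self[of "N * c"] by linarith
  ultimately have "2 / \<epsilon> < exp (N * c)" by simp
  then have "2 / exp (N * c) < \<epsilon>" using eps by (simp add: field_simps)
  then show "2 * exp (- N * c) < \<epsilon>" by (simp add: exp_minus divide_inverse)
qed

lemma eventually_at_disc_rotate:
  assumes "\<forall>\<^sub>F z in at (cis \<theta> * \<sigma>) within disc. P z"
  shows "\<forall>\<^sub>F z in at \<sigma> within disc. P (cis \<theta> * z)"
proof -
  have "filterlim (\<lambda>z. cis \<theta> * z) (at (cis \<theta> * \<sigma>) within disc) (at \<sigma> within disc)"
    unfolding filterlim_at
    by (auto intro!: tendsto_intros simp: eventually_at_filter norm_mult)
  then show ?thesis using assms unfolding filterlim_iff by blast
qed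

lemma two_constants_arc:
  assumes holq: "q holomorphic_on disc" and qK: "\<And>z. z \<in> disc \<Longrightarrow> norm (q z) \<le> K"
    and d: "0 < \<delta>" "\<delta> < 2 * pi" and N: "N \<ge> 0"
    and arc: "\<And>x \<epsilon>. 0 < x \<Longrightarrow> x < \<delta> \<Longrightarrow> \<epsilon> > 0 \<Longrightarrow>
      \<forall>\<^sub>F z in at (cis (\<theta> + x)) within disc. norm (q z) < K * exp (- N * pi) + \<epsilon>"
    and z: "z \<in> disc"
  shows "norm (q z) \<le> K * exp (- N * (pi / 2 + Arg (arc_angle \<delta> (cis (- \<theta>) * z))))"
proof -
  have "q \<circ> (\<lambda>z. cis \<theta> * z) holomorphic_on disc"
    by (rule holomorphic_on_compose_gen[OF _ holq]) (auto intro!: holomorphic_intros simp: norm_mult)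
  then have hol: "(\<lambda>z. q (cis \<theta> * z)) holomorphic_on disc" by (simp add: o_def)
  have "norm (q (cis \<theta> * (cis (- \<theta>) * z))) \<le> K * exp (- N * (pi / 2 + Arg (arc_angle \<delta> (cis (- \<theta>) * z))))"
  proof (rule two_constants_arc_base[OF hol _ d N])
    fix x \<epsilon> :: real assume "0 < x" "x < \<delta>" "\<epsilon> > 0"
    then show "\<forall>\<^sub>F z in at (cis x) within disc. norm (q (cis \<theta> * z)) < K * exp (- N * pi) + \<epsilon>"
      using arc by (intro eventually_at_disc_rotate) (simp add: cis_mult)
  qed (use z in \<open>auto simp: norm_mult intro!: qK\<close>)
  moreover have "cis \<theta> * (cis (- \<theta>) * z) = z" by (simp add: cis_mult flip: mult.assoc)
  ultimately show ?thesis by simp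
qed

lemma norm_lim_disc_le_1:
  assumes "norm \<sigma> = 1" "(f \<longlongrightarrow> l) (at \<sigma> within disc)" "f ` disc \<subseteq> disc"
  shows "norm l \<le> 1"
proof (rule tendsto_upperbound[OF tendsto_norm[OF assms(2)]])
  show "\<forall>\<^sub>F z in at \<sigma> within disc. norm (f z) \<le> 1"
    unfolding eventually_at_filter using assms(3) by (intro always_eventually) (auto simp: image_subset_iff intro: less_imp_le)
qed (rule disc_accumulates[OF assms(1)])

text \<open>Seen from a fixed \<open>z\<close> the arc has positive harmonic measure, so a large
  \<open>N\<close> makes the interior bound small, at the price of the exponentially small tolerance
  \<open>2 * exp (- N * pi)\<close> on the arc. The filter will be that of time tending to
  infinity.\<close>

lemma tendsto_from_arc:
  fixes f :: "'a \<Rightarrow> complex \<Rightarrow> complex"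
  assumes hol: "\<forall>\<^sub>F t in F. f t holomorphic_on disc \<and> f t ` disc \<subseteq> disc"
    and d: "0 < \<delta>" "\<delta> < 2 * pi" and e: "norm e \<le> 1"
    and arc: "\<And>\<eta>. \<eta> > 0 \<Longrightarrow> \<forall>\<^sub>F t in F. \<forall>x. 0 < x \<and> x < \<delta> \<longrightarrow>
        (\<exists>l. (f t \<longlongrightarrow> l) (at (cis (\<theta> + x)) within disc) \<and> norm (l - e) \<le> \<eta>)"
    and z: "z \<in> disc"
  shows "((\<lambda>t. f t z) \<longlongrightarrow> e) F"
proof (rule tendstoI)
  fix \<epsilon> :: real assume eps: "\<epsilon> > 0"
  \<comment> \<open>\<open>c\<close> is \<open>pi\<close> times the harmonic measure of the arc seen
    from \<open>z\<close>.\<close>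
  define c where "c = pi / 2 + Arg (arc_angle \<delta> (cis (- \<theta>) * z))"
  have "Re (arc_angle \<delta> (cis (- \<theta>) * z)) > 0"
    using arc_angle_Re_pos d z by (simp add: norm_mult)
  then have c: "c > 0" using Arg_Re_pos[of "arc_angle \<delta> (cis (- \<theta>) * z)"] unfolding c_def by linarith
  obtain N where N: "N \<ge> 0" "2 * exp (- N * c) < \<epsilon>" using ex_exp_neg_less[OF c eps] .
  have "2 * exp (- N * pi) > 0" by simp
  from hol arc[OF this] show "\<forall>\<^sub>F t in F. dist (f t z) e < \<epsilon>"
  proof eventually_elim
    case (elim t)
    have "norm (f t z - e) \<le> 2 * exp (- N * (pi / 2 + Arg (arc_angle \<delta> (cis (- \<theta>) * z))))"
    proof (rule two_constants_arc[where q = "\<lambda>z. f t z - e", OF _ _ d N(1) _ z])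
      show "(\<lambda>z. f t z - e) holomorphic_on disc" using elim by (auto intro!: holomorphic_intros)
      fix z :: complex assume "z \<in> disc"
      then have "norm (f t z) < 1" using elim by force
      then show "norm (f t z - e) \<le> 2" using e norm_triangle_ineq4[of "f t z" e] by linarith
    next
      fix x \<epsilon>' :: real assume x: "0 < x" "x < \<delta>" "\<epsilon>' > 0"
      then obtain l where l: "(f t \<longlongrightarrow> l) (at (cis (\<theta> + x)) within disc)" "norm (l - e) \<le> 2 * exp (- N * pi)"
        using elim by blast
      have "((\<lambda>z. norm (f t z - e)) \<longlongrightarrow> norm (l - e)) (at (cis (\<theta> + x)) within disc)"
        by (intro tendsto_intros l)
      then show "\<forall>\<^sub>F z in at (cis (\<theta> + x)) within disc. norm (f t z - e) < 2 * exp (- N * pi) + \<epsilon>'"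
        by (rule order_tendstoD) (use l x in linarith)
    qed
    then show ?case using N(2) by (simp add: c_def dist_norm)
  qed
qed

text \<open>Near an end of the arc, \<open>arc_angle\<close> is a simple factor times a function
  tending to a positive constant. A sector \<open>norm v \<le> M * Re v\<close> survives
  multiplication by such a function once \<open>M\<close> is doubled.\<close>

lemma Re_mult_sector:
  assumes lim: "(B \<longlongrightarrow> of_real r) F" and r: "r > 0" and M: "M > 0"
  shows "\<forall>\<^sub>F z in F. \<forall>v. norm v \<le> M * Re v \<longrightarrow> norm (B z * v) \<le> 2 * M * Re (B z * v)"
proof -
  have "((\<lambda>z. 2 * M * norm (B z - of_real r) + norm (B z)) \<longlongrightarrow> 2 * M * norm (of_real r - of_real r :: complex) + norm (of_real r :: complex)) F"
    by (intro tendsto_intros lim)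
  then have "\<forall>\<^sub>F z in F. 2 * M * norm (B z - of_real r) + norm (B z) < 2 * r"
    by (rule order_tendstoD) (use r in simp)
  then show ?thesis
  proof eventually_elim
    case (elim z)
    show ?case
    proof (intro allI impI)
      fix v :: complex assume v: "norm v \<le> M * Re v"
      have "Re (B z * v) = r * Re v + Re ((B z - of_real r) * v)" by (simp add: algebra_simps)
      moreover have "Re ((B z - of_real r) * v) \<ge> - norm ((B z - of_real r) * v)"
        using abs_Re_le_cmod[of "(B z - of_real r) * v"] by linarith
      ultimately have 1: "Re (B z * v) \<ge> r * Re v - norm (B z - of_real r) * norm v" by (simp add: norm_mult)
      have "norm (B z * v) = norm (B z) * norm v" by (simp add: norm_mult)
      also have "\<dots> \<le> (2 * r - 2 * M * norm (B z - of_real r)) * norm v"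
        using elim by (intro mult_right_mono) auto
      also have "\<dots> = 2 * r * norm v - 2 * M * (norm (B z - of_real r) * norm v)" by (simp add: algebra_simps)
      also have "\<dots> \<le> 2 * r * (M * Re v) - 2 * M * (norm (B z - of_real r) * norm v)"
        using v r by simp
      also have "\<dots> = 2 * M * (r * Re v - norm (B z - of_real r) * norm v)" by (simp add: algebra_simps)
      also have "\<dots> \<le> 2 * M * Re (B z * v)" using 1 M by (intro mult_left_mono) auto
      finally show "norm (B z * v) \<le> 2 * M * Re (B z * v)" .
    qed
  qed
qed

text \<open>\<open>u z\<close> tends to \<open>1\<close> inside a sector, and \<open>s\<close>
  chooses the end of the arc to which it is rotated: \<open>1\<close>, where
  \<open>arc_angle\<close> has its pole, or \<open>cis \<delta>\<close>, where it vanishes. The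
  leading factor is \<open>1 / (1 - u z)\<close> in the first case and \<open>1 - u z\<close> in the
  second, and both lie in the same sector.\<close>

lemma arc_angle_sector:
  assumes d: "0 < \<delta>" "\<delta> < 2 * pi" and M: "M > 0" and s: "s = 1 \<or> s = (- 1 :: real)"
    and F: "(u \<longlongrightarrow> 1) F" "\<forall>\<^sub>F z in F. norm (1 - u z) \<le> M * Re (1 - u z) \<and> u z \<noteq> 1"
  shows "\<forall>\<^sub>F z in F. norm (arc_angle \<delta> (cis (if s = 1 then 0 else \<delta>) * u z)) \<le>
    2 * M * Re (arc_angle \<delta> (cis (if s = 1 then 0 else \<delta>) * u z))"
proof (cases "s = 1")
  case True
  define B where "B = (\<lambda>z. - \<i> * cis (- \<delta> / 2) * (cis \<delta> - u z))"
  have sd: "sin (\<delta> / 2) > 0" using d by (intro sin_gt_zero) auto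
  have "- \<i> * cis (- \<delta> / 2) * (cis \<delta> - 1) = of_real (2 * sin (\<delta> / 2))"
    by (subst minus_diff_eq[symmetric], subst one_minus_cis) (simp add: cis_mult)
  moreover have "(B \<longlongrightarrow> - \<i> * cis (- \<delta> / 2) * (cis \<delta> - 1)) F"
    unfolding B_def by (intro tendsto_intros F)
  ultimately have "(B \<longlongrightarrow> of_real (2 * sin (\<delta> / 2))) F" by (simp only:)
  from Re_mult_sector[OF this _ M] sd
  have "\<forall>\<^sub>F z in F. \<forall>v. norm v \<le> M * Re v \<longrightarrow> norm (B z * v) \<le> 2 * M * Re (B z * v)" by simp
  from this F(2) show ?thesis
  proof eventually_elim
    case (elim z)
    define v where "v = inverse (1 - u z)"
    have nz: "norm (1 - u z) > 0" using elim by simp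
    have "norm v \<le> M * Re v"
    proof -
      have "Re v = Re (1 - u z) / (norm (1 - u z))\<^sup>2" by (simp add: v_def cmod_power2)
      moreover have "norm v = norm (1 - u z) / (norm (1 - u z))\<^sup>2"
      proof -
        have "inverse a = a / a\<^sup>2" if "a > 0" for a :: real
          using that by (simp add: field_simps power2_eq_square)
        from this[OF nz] show ?thesis by (simp only: v_def norm_inverse)
      qed
      ultimately show ?thesis using elim nz by (simp add: divide_right_mono)
    qed
    then have "norm (B z * v) \<le> 2 * M * Re (B z * v)" using elim by blast
    moreover have "B z * v = arc_angle \<delta> (u z)" 
      unfolding B_def v_def arc_angle_def divide_inverse by (simp only: mult.assoc)
    ultimately show ?case using True by simp
  qed
next
  case False
  define B where "B = (\<lambda>z. - \<i> * cis (\<delta> / 2) / (1 - cis \<delta> * u z))"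
  have sd: "sin (\<delta> / 2) > 0" using d by (intro sin_gt_zero) auto
  have *: "- \<i> * cis (\<delta> / 2) / (1 - cis \<delta> * 1) = of_real (1 / (2 * sin (\<delta> / 2)))"
    using sd by (simp add: one_minus_cis)
  have "1 - cis \<delta> * 1 \<noteq> 0" using sd by (simp add: one_minus_cis)
  then have "(B \<longlongrightarrow> - \<i> * cis (\<delta> / 2) / (1 - cis \<delta> * 1)) F"
    unfolding B_def by (intro tendsto_intros F)
  then have "(B \<longlongrightarrow> of_real (1 / (2 * sin (\<delta> / 2)))) F" unfolding * .
  from Re_mult_sector[OF this _ M] sd
  have "\<forall>\<^sub>F z in F. \<forall>v. norm v \<le> M * Re v \<longrightarrow> norm (B z * v) \<le> 2 * M * Re (B z * v)" by simp
  from this F(2) show ?thesis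
  proof eventually_elim
    case (elim z)
    then have "norm (B z * (1 - u z)) \<le> 2 * M * Re (B z * (1 - u z))" by blast
    moreover have "B z * (1 - u z) = arc_angle \<delta> (cis \<delta> * u z)"
    proof -
      have "cis (\<delta> / 2) = cis (- \<delta> / 2) * cis \<delta>" by (simp add: cis_mult)
      then have "- \<i> * cis (\<delta> / 2) * (1 - u z) = - \<i> * cis (- \<delta> / 2) * (cis \<delta> - cis \<delta> * u z)"
        by (simp add: algebra_simps)
      moreover have "B z * (1 - u z) = - \<i> * cis (\<delta> / 2) * (1 - u z) / (1 - cis \<delta> * u z)"
        by (simp add: B_def)
      ultimately show ?thesis by (simp only: arc_angle_def times_divide_eq_right)
    qed
    ultimately show ?case using False by simp
  qed
qed

lemma Arg_sector_le:
  assumes "norm w \<le> M * Re w" "w \<noteq> 0" "M > 1"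
  shows "\<bar>Arg w\<bar> \<le> arccos (1 / M)"
proof -
  have "Re w = norm w * cos (Arg w)" by (metis Re_rcis rcis_cmod_Arg)
  then have "norm w * 1 \<le> norm w * (M * cos (Arg w))" using assms by (simp add: mult_ac)
  then have "1 \<le> M * cos (Arg w)" using assms by simp
  then have "1 / M \<le> cos \<bar>Arg w\<bar>" using assms by (simp add: field_simps abs_if)
  then have "arccos (cos \<bar>Arg w\<bar>) \<le> arccos (1 / M)"
    using assms by (intro arccos_le_arccos) (auto intro: order_trans[of _ 0])
  moreover have "arccos (cos \<bar>Arg w\<bar>) = \<bar>Arg w\<bar>"
    using Arg_bounded[of w] by (intro arccos_cos) auto
  ultimately show ?thesis by simp
qed

text \<open>In a Stolz region, near the end of an arc at its vertex, the harmonic measure of that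
  arc is bounded below, because \<open>Arg\<close> stays above \<open>- arccos (1 / (2 * M))\<close>
  there. Closeness of the boundary values to \<open>L\<close> on one side therefore forces the
  angular limit.\<close>

lemma Lindelof_one_sided:
  assumes holf: "f holomorphic_on disc" and f: "f ` disc \<subseteq> disc"
    and \<delta>0: "\<delta>0 > 0" and s: "s = 1 \<or> s = (- 1 :: real)"
    and lim: "\<And>x. 0 < x \<Longrightarrow> x < \<delta>0 \<Longrightarrow> (f \<longlongrightarrow> l x) (at (cis (\<theta> + s * x)) within disc)"
    and lL: "(l \<longlongrightarrow> L) (at_right 0)"
  shows "has_nontangential_limit f (cis \<theta>) L"
  unfolding has_nontangential_limit_def
proof (intro allI impI tendstoI)
  fix M \<epsilon> :: real assume M: "M > 1" and eps: "\<epsilon> > 0"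
  have "norm L \<le> 1"
  proof (rule tendsto_upperbound[OF tendsto_norm[OF lL]])
    show "\<forall>\<^sub>F x in at_right 0. norm (l x) \<le> 1"
      using \<delta>0 norm_lim_disc_le_1[OF _ lim f] by (intro eventually_at_rightI[of 0 \<delta>0]) auto
  qed simp
  \<comment> \<open>A lower bound for \<open>pi\<close> times the harmonic measure;
    \<open>2 * M\<close> is the constant that \<open>arc_angle_sector\<close> returns.\<close>
  define c where "c = pi / 2 - arccos (1 / (2 * M))"
  have "arccos (1 / (2 * M)) < arccos 0" using M by (subst arccos_less_mono) auto
  then have c: "c > 0" by (simp add: c_def)
  obtain N where N: "N \<ge> 0" "2 * exp (- N * c) < \<epsilon>" using ex_exp_neg_less[OF c eps] .
  have "2 * exp (- N * pi) > 0" by simp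
  from tendstoD[OF lL this] obtain b where b: "b > 0" "\<And>x. 0 < x \<Longrightarrow> x < b \<Longrightarrow> dist (l x) L < 2 * exp (- N * pi)"
    unfolding eventually_at_right_field by auto
  define \<delta> where "\<delta> = min 1 (min b \<delta>0)"
  have d: "0 < \<delta>" "\<delta> < 2 * pi" using b \<delta>0 pi_gt3 by (auto simp: \<delta>_def)
  \<comment> \<open>The arc always runs counterclockwise from \<open>cis \<theta>'\<close>, so for
    \<open>s = - 1\<close> the point \<open>cis \<theta>\<close> is its other end.\<close>
  define \<theta>' where "\<theta>' = (if s = 1 then \<theta> else \<theta> - \<delta>)"
  have bound: "norm (f z - L) \<le> 2 * exp (- N * (pi / 2 + Arg (arc_angle \<delta> (cis (- \<theta>') * z))))" if z: "z \<in> disc" for z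
  proof (rule two_constants_arc[where q = "\<lambda>z. f z - L", OF _ _ d N(1) _ z])
    show "(\<lambda>z. f z - L) holomorphic_on disc" using holf by (auto intro!: holomorphic_intros)
    fix z :: complex assume "z \<in> disc"
    then have "norm (f z) < 1" using f by force
    then show "norm (f z - L) \<le> 2" using \<open>norm L \<le> 1\<close> norm_triangle_ineq4[of "f z" L] by linarith
  next
    fix x \<epsilon>' :: real assume x: "0 < x" "x < \<delta>" "\<epsilon>' > 0"
    define y where "y = (if s = 1 then x else \<delta> - x)"
    have y: "0 < y" "y < \<delta>" using x by (auto simp: y_def)
    have eq: "\<theta>' + x = \<theta> + s * y" using s by (auto simp: \<theta>'_def y_def)
    have "dist (l y) L < 2 * exp (- N * pi)" using b y by (simp add: \<delta>_def)
    moreover have "((\<lambda>z. norm (f z - L)) \<longlongrightarrow> norm (l y - L)) (at (cis (\<theta>' + x)) within disc)"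
      unfolding eq by (intro tendsto_intros lim) (use y in \<open>auto simp: \<delta>_def\<close>)
    ultimately show "\<forall>\<^sub>F z in at (cis (\<theta>' + x)) within disc. norm (f z - L) < 2 * exp (- N * pi) + \<epsilon>'"
      using x by (intro order_tendstoD) (auto simp: dist_norm)
  qed
  have st: "\<forall>\<^sub>F z in at (cis \<theta>) within stolz_region (cis \<theta>) M. z \<in> stolz_region (cis \<theta>) M"
    by (simp add: eventually_at_filter)
  have "((\<lambda>z. cis (- \<theta>) * z) \<longlongrightarrow> cis (- \<theta>) * cis \<theta>) (at (cis \<theta>) within stolz_region (cis \<theta>) M)"
    by (intro tendsto_intros)
  then have u: "((\<lambda>z. cis (- \<theta>) * z) \<longlongrightarrow> 1) (at (cis \<theta>) within stolz_region (cis \<theta>) M)"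
    by (simp add: cis_mult)
  have "\<forall>\<^sub>F z in at (cis \<theta>) within stolz_region (cis \<theta>) M.
     norm (1 - cis (- \<theta>) * z) \<le> M * Re (1 - cis (- \<theta>) * z) \<and> cis (- \<theta>) * z \<noteq> 1"
    using st
  proof eventually_elim
    case (elim z)
    define u where "u = cis (- \<theta>) * z"
    have "cis \<theta> * (1 - u) = cis \<theta> - z" by (simp add: u_def algebra_simps cis_mult flip: mult.assoc)
    then have 1: "norm (cis \<theta> - z) = norm (1 - u)" by (metis mult.left_neutral norm_cis norm_mult)
    have 2: "norm z = norm u" by (simp add: u_def norm_mult)
    have u: "norm u < 1" "norm (1 - u) < M * (1 - norm u)" using elim unfolding stolz_region_def by (auto simp: 1 2)
    have "M * (1 - norm u) \<le> M * Re (1 - u)"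
      using M complex_Re_le_cmod[of u] by (intro mult_left_mono) auto
    then show ?case using u unfolding u_def[symmetric] by auto
  qed
  from arc_angle_sector[OF d _ s u this] M
  have "\<forall>\<^sub>F z in at (cis \<theta>) within stolz_region (cis \<theta>) M.
    norm (arc_angle \<delta> (cis (if s = 1 then 0 else \<delta>) * (cis (- \<theta>) * z))) \<le>
    2 * M * Re (arc_angle \<delta> (cis (if s = 1 then 0 else \<delta>) * (cis (- \<theta>) * z)))" by simp
  then show "\<forall>\<^sub>F z in at (cis \<theta>) within stolz_region (cis \<theta>) M. dist (f z) L < \<epsilon>"
    using st
  proof eventually_elim
    case (elim z)
    have z: "z \<in> disc" using elim by (simp add: stolz_region_def)
    define w where "w = arc_angle \<delta> (cis (- \<theta>') * z)"
    have eq: "cis (if s = 1 then 0 else \<delta>) * (cis (- \<theta>) * z) = cis (- \<theta>') * z"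
      by (simp add: \<theta>'_def cis_mult flip: mult.assoc)
    have "Re w > 0" unfolding w_def using arc_angle_Re_pos[OF d] z by (simp add: norm_mult)
    then have "w \<noteq> 0" by auto
    then have "\<bar>Arg w\<bar> \<le> arccos (1 / (2 * M))"
      using elim(1) M unfolding eq w_def by (intro Arg_sector_le) auto
    then have "- N * (pi / 2 + Arg w) \<le> - N * c" using N(1) by (simp add: c_def mult_left_mono)
    then have "2 * exp (- N * (pi / 2 + Arg w)) \<le> 2 * exp (- N * c)" by simp
    then have "norm (f z - L) < \<epsilon>"
      using bound[OF z] N(2) unfolding w_def by linarith
    then show ?case by (simp add: dist_norm)
  qed
qed

section \<open>Extension of inner functions across the boundary\<close>

abbreviation upper_half_disc :: "complex \<Rightarrow> real \<Rightarrow> complex set" where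
  "upper_half_disc c r \<equiv> ball c r \<inter> {w. Im w > 0}"

lemma open_upper_half_disc: "open (upper_half_disc c r)"
  by (intro open_Int open_ball open_halfspace_Im_gt)

lemma convex_upper_half_disc: "convex (upper_half_disc c r)"
  by (intro convex_Int convex_ball convex_halfspace_Im_gt)

lemma closure_upper_half_disc_subset: "closure (upper_half_disc c r) \<subseteq> cball c r \<inter> {w. Im w \<ge> 0}"
  by (rule closure_minimal) (auto intro: closed_Int closed_halfspace_Im_ge)

lemma real_in_closure_upper_half_disc:
  assumes "w \<in> ball c r" "Im w \<ge> 0"
  shows "w islimpt upper_half_disc c r"
  unfolding islimpt_approachable
proof (intro allI impI)
  fix e :: real assume e: "e > 0"
  define t where "t = min (e / 2) ((r - dist c w) / 2)"
  have t: "0 < t" "t < e" "t < r - dist c w" using e assms by (auto simp: t_def min_def)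
  have "dist c (w + \<i> * of_real t) \<le> dist c w + dist w (w + \<i> * of_real t)" by (rule dist_triangle)
  also have "dist w (w + \<i> * of_real t) = t" using t by (simp add: dist_norm norm_mult)
  finally have "w + \<i> * of_real t \<in> upper_half_disc c r" using t assms by auto
  moreover have "w + \<i> * of_real t \<noteq> w" "dist (w + \<i> * of_real t) w < e"
    using t by (auto simp: dist_norm norm_mult)
  ultimately show "\<exists>x'\<in>upper_half_disc c r. x' \<noteq> w \<and> dist x' w < e" by blast
qed

text \<open>On the half disc of radius \<open>\<delta>\<close> about the real point \<open>x\<close>, the harmonic function
  \<open>Re ((w - x)\<^sup>2 / \<delta>\<^sup>2) + 2 Im w / \<delta>\<close> is nonnegative on the diameter and at least 1 on the
  half circle, so a multiple of it dominates \<open>- ln \<bar>k\<bar>\<close>.\<close>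

lemma half_disc_barrier:
  fixes x :: real
  assumes holk: "k holomorphic_on upper_half_disc 0 r"
    and bd: "\<And>x. \<bar>x\<bar> < r \<Longrightarrow> ((\<lambda>w. norm (k w)) \<longlongrightarrow> 1) (at (of_real x) within upper_half_disc 0 r)"
    and half: "\<And>w. w \<in> upper_half_disc 0 r \<Longrightarrow> norm (k w) > 1/2"
    and d: "\<delta> > 0" "\<bar>x\<bar> + \<delta> < r" and y: "0 < y" "y < \<delta>"
  shows "norm (k (Complex x y)) \<ge> 1 - 2 * y / \<delta>"
proof -
  define V where "V = (\<lambda>w. (w - of_real x)\<^sup>2 / of_real (\<delta>\<^sup>2) - 2 * \<i> / of_real \<delta> * (w - of_real x))"
  have ReV: "Re (V w) = ((Re w - x)\<^sup>2 - (Im w)\<^sup>2) / \<delta>\<^sup>2 + 2 * Im w / \<delta>" for w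
  proof -
    have "(w - of_real x)\<^sup>2 / of_real (\<delta>\<^sup>2) = (w - of_real x)\<^sup>2 * of_real (1 / \<delta>\<^sup>2)" by simp
    then have "Re ((w - of_real x)\<^sup>2 / of_real (\<delta>\<^sup>2)) = Re ((w - of_real x)\<^sup>2) * (1 / \<delta>\<^sup>2)"
      by (metis Re_complex_of_real Im_complex_of_real mult_zero_right diff_zero times_complex.sel(1))
    moreover have "2 * \<i> / of_real \<delta> * (w - of_real x) = \<i> * (of_real (2 / \<delta>) * (w - of_real x))" by simp
    then have "Re (2 * \<i> / of_real \<delta> * (w - of_real x)) = - (2 / \<delta> * Im w)"
      by (simp only: Re_i_times) simp
    ultimately show ?thesis by (simp add: V_def power2_eq_square)
  qed
  define \<Omega> where "\<Omega> = upper_half_disc (of_real x) \<delta>"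
  have sub: "\<Omega> \<subseteq> upper_half_disc 0 r"
  proof
    fix w assume w: "w \<in> \<Omega>"
    have "dist 0 w \<le> dist 0 (complex_of_real x) + dist (of_real x) w" by (rule dist_triangle)
    then show "w \<in> upper_half_disc 0 r" using w d by (auto simp: \<Omega>_def)
  qed
  have nz: "k w \<noteq> 0" if "w \<in> upper_half_disc 0 r" for w using half[OF that] by force
  have nz': "k w \<noteq> 0" if "w \<in> \<Omega>" for w using nz sub that by blast
  \<comment> \<open>With this constant the bound \<open>norm (k w) > 1/2\<close> on the half circle
    is exactly balanced by \<open>Re (V w) \<ge> 1\<close>.\<close>
  define c where "c = ln (2::real)"
  have c: "0 \<le> c" "c \<le> 1" "exp c = 2" "exp (- c) = 1 / 2"
    unfolding c_def using ln_le_minus_one[of 2] by (auto simp: exp_minus)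
  \<comment> \<open>\<open>half\<close> excludes zeros of \<open>k\<close>; the bound
    \<open>norm (f w) \<le> 1\<close> then says that \<open>norm (k w)\<close> is at least
    \<open>exp (- c * Re (V w))\<close>.\<close>
  define f where "f = (\<lambda>w. exp (- of_real c * V w) / k w)"
  have nf: "norm (f w) = exp (- c * Re (V w)) / norm (k w)" for w by (simp add: f_def norm_divide)
  have contV: "((\<lambda>w. exp (- c * Re (V w))) \<longlongrightarrow> exp (- c * Re (V \<zeta>))) (at \<zeta> within S)" for \<zeta> S
    unfolding V_def using d by (intro tendsto_intros) auto
  have "norm (f (Complex x y)) \<le> 1"
  proof (rule maximum_modulus_limsup[of f \<Omega>])
    show "f holomorphic_on \<Omega>" unfolding f_def V_def
      by (intro holomorphic_intros holomorphic_on_subset[OF holk sub]) (use nz' d in auto)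
    show "open \<Omega>" unfolding \<Omega>_def by (rule open_upper_half_disc)
    show "bounded \<Omega>" unfolding \<Omega>_def by (simp add: bounded_Int)
    show "Complex x y \<in> \<Omega>" using y by (simp add: \<Omega>_def dist_norm cmod_def)
    fix \<zeta> :: complex and \<epsilon> :: real assume z: "\<zeta> \<in> frontier \<Omega>" and eps: "\<epsilon> > 0"
    have "\<zeta> \<in> closure \<Omega>" "\<zeta> \<notin> \<Omega>" using z \<open>open \<Omega>\<close> by (auto simp: frontier_def interior_open)
    then have zc: "dist (of_real x) \<zeta> \<le> \<delta>" "Im \<zeta> \<ge> 0" and zn: "Im \<zeta> = 0 \<or> dist (of_real x) \<zeta> = \<delta>"
      using closure_upper_half_disc_subset[of "of_real x" \<delta>] by (auto simp: \<Omega>_def)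
    have inO: "\<forall>\<^sub>F w in at \<zeta> within \<Omega>. w \<in> \<Omega>" by (simp add: eventually_at_filter)
    have zr: "norm \<zeta> < r"
    proof -
      have "dist 0 \<zeta> \<le> dist 0 (complex_of_real x) + dist (of_real x) \<zeta>" by (rule dist_triangle)
      then show ?thesis using zc d by simp
    qed
    show "\<forall>\<^sub>F w in at \<zeta> within \<Omega>. norm (f w) < 1 + \<epsilon>"
    proof (cases "Im \<zeta> = 0")
      case True
      then have zeq: "\<zeta> = of_real (Re \<zeta>)" by (simp add: complex_eq_iff)
      have "((\<lambda>w. norm (k w)) \<longlongrightarrow> 1) (at \<zeta> within \<Omega>)"
        using tendsto_within_subset[OF bd[of "Re \<zeta>"] sub] zr zeq by (metis abs_Re_le_cmod le_less_trans)
      then have "((\<lambda>w. exp (- c * Re (V w)) / norm (k w)) \<longlongrightarrow> exp (- c * Re (V \<zeta>)) / 1) (at \<zeta> within \<Omega>)"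
        by (intro tendsto_divide contV) auto
      moreover have "Re (V \<zeta>) \<ge> 0" unfolding ReV using True by simp
      then have "exp (- c * Re (V \<zeta>)) / 1 < 1 + \<epsilon>" using eps c
        by (simp add: add_strict_increasing2 order.strict_trans1[of _ 1])
      ultimately show ?thesis unfolding nf by (rule order_tendstoD)
    next
      case False
      then have dz: "dist (of_real x) \<zeta> = \<delta>" and Iz: "Im \<zeta> > 0" using zn zc by auto
      have "(Re \<zeta> - x)\<^sup>2 + (Im \<zeta>)\<^sup>2 = \<delta>\<^sup>2"
        using dz d by (simp add: dist_norm norm_minus_commute) (metis cmod_power2 Re_complex_of_real Im_complex_of_real minus_complex.sel diff_zero)
      \<comment> \<open>On the half circle \<open>Re (V \<zeta>)\<close> becomes
        \<open>1 + 2 * y * (1 - y)\<close> with \<open>y = Im \<zeta> / \<delta>\<close> between 0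
        and 1.\<close>
      then have 1: "(Re \<zeta> - x)\<^sup>2 - (Im \<zeta>)\<^sup>2 = \<delta>\<^sup>2 - 2 * (Im \<zeta>)\<^sup>2" by simp
      have "Im \<zeta> \<le> \<delta>"
      proof -
        have "\<bar>Im (of_real x - \<zeta>)\<bar> \<le> \<delta>" using abs_Im_le_cmod dz by (metis dist_norm)
        then show ?thesis by simp
      qed
      then have "(Im \<zeta>)\<^sup>2 \<le> \<delta> * Im \<zeta>" using Iz by (simp add: power2_eq_square mult_right_mono)
      then have "Re (V \<zeta>) \<ge> 1" unfolding ReV 1 using d by (simp add: field_simps power2_eq_square)
      then have "c * 1 \<le> c * Re (V \<zeta>)" using c by (intro mult_left_mono) auto
      then have "exp (- c * Re (V \<zeta>)) \<le> exp (- c)" by simp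
      then have le: "exp (- c * Re (V \<zeta>)) * 2 \<le> 1" using c by simp
      have "((\<lambda>w. exp (- c * Re (V w)) * 2) \<longlongrightarrow> exp (- c * Re (V \<zeta>)) * 2) (at \<zeta> within \<Omega>)"
        by (intro tendsto_mult contV tendsto_const)
      then have "\<forall>\<^sub>F w in at \<zeta> within \<Omega>. exp (- c * Re (V w)) * 2 < 1 + \<epsilon>"
        by (rule order_tendstoD) (use le eps in linarith)
      then show ?thesis using inO
      proof eventually_elim
        case (elim w)
        have "norm (k w) > 1 / 2" using half[of w] elim sub by blast
        then have "exp (- c * Re (V w)) / norm (k w) \<le> exp (- c * Re (V w)) / (1 / 2)"
          by (intro divide_left_mono) auto
        then show ?case using elim unfolding nf by simp
      qed
    qed
  qed
  then have "exp (- c * Re (V (Complex x y))) \<le> norm (k (Complex x y))"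
  proof -
    have "Complex x y \<in> \<Omega>" using y by (simp add: \<Omega>_def dist_norm cmod_def)
    then have "norm (k (Complex x y)) > 0" using nz' by simp
    then show ?thesis using \<open>norm (f _) \<le> 1\<close> by (simp add: nf)
  qed
  moreover have "exp (- c * Re (V (Complex x y))) \<ge> 1 - c * Re (V (Complex x y))"
    using exp_ge_add_one_self[of "- c * Re (V (Complex x y))"] by simp
  moreover have "c * Re (V (Complex x y)) \<le> 2 * y / \<delta>"
  proof -
    have "Re (V (Complex x y)) \<le> 2 * y / \<delta>" by (simp add: ReV)
    then have "c * Re (V (Complex x y)) \<le> c * (2 * y / \<delta>)" using c by (intro mult_left_mono)
    also have "\<dots> \<le> 1 * (2 * y / \<delta>)" using c d y by (intro mult_right_mono) auto
    finally show ?thesis by simp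
  qed
  ultimately show ?thesis by linarith
qed

text \<open>The barrier bounds \<open>1 - norm (k w)\<close> by a multiple of \<open>Im w\<close>,
  and Schwarz-Pick on the disc about \<open>w\<close> of radius \<open>Im w\<close> divides this by
  \<open>Im w\<close> again. So \<open>deriv k\<close> is bounded near the centre, and a Lipschitz
  function extends to the closure.\<close>

lemma half_disc_continuous_extension:
  assumes r: "r > 0" and holk: "k holomorphic_on upper_half_disc 0 r" and kd: "k ` upper_half_disc 0 r \<subseteq> disc"
    and bd: "\<And>x. \<bar>x\<bar> < r \<Longrightarrow> ((\<lambda>w. norm (k w)) \<longlongrightarrow> 1) (at (of_real x) within upper_half_disc 0 r)"
  obtains \<rho> g where "0 < \<rho>" "\<rho> \<le> r" "continuous_on (ball 0 \<rho> \<inter> {w. Im w \<ge> 0}) g"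
    "\<And>w. w \<in> upper_half_disc 0 \<rho> \<Longrightarrow> g w = k w" "\<And>x. \<bar>x\<bar> < \<rho> \<Longrightarrow> norm (g (of_real x)) = 1"
proof -
  have "((\<lambda>w. norm (k w)) \<longlongrightarrow> 1) (at 0 within upper_half_disc 0 r)" using bd[of 0] r by simp
  then have "\<forall>\<^sub>F w in at 0 within upper_half_disc 0 r. norm (k w) > 1/2" by (rule order_tendstoD) simp
  then obtain d where d: "d > 0" "\<And>w. w \<in> upper_half_disc 0 r \<Longrightarrow> w \<noteq> 0 \<Longrightarrow> dist w 0 < d \<Longrightarrow> norm (k w) > 1/2"
    unfolding eventually_at by blast
  define r1 where "r1 = min d r"
  have r1: "0 < r1" "r1 \<le> r" using d r by (auto simp: r1_def)
  have sub: "upper_half_disc 0 r1 \<subseteq> upper_half_disc 0 r" using r1 by auto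
  have half: "norm (k w) > 1/2" if "w \<in> upper_half_disc 0 r1" for w
  proof -
    have "w \<noteq> 0" using that by auto
    then show ?thesis using d(2)[of w] that by (simp add: r1_def)
  qed
  have holk1: "k holomorphic_on upper_half_disc 0 r1" using holk sub holomorphic_on_subset by blast
  have bd1: "((\<lambda>w. norm (k w)) \<longlongrightarrow> 1) (at (of_real x) within upper_half_disc 0 r1)" if "\<bar>x\<bar> < r1" for x
    using tendsto_within_subset[OF bd sub] that r1 by auto
  \<comment> \<open>A third of \<open>r1\<close>, because the discs and half discs used below have
    their centres within \<open>\<delta>\<close> of the origin and radii at most
    \<open>\<delta>\<close>.\<close>
  define \<delta> where "\<delta> = r1 / 3"
  have dl: "\<delta> > 0" using r1 by (simp add: \<delta>_def)
  define S where "S = upper_half_disc 0 \<delta>"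
  have Sr: "S \<subseteq> upper_half_disc 0 r1" unfolding S_def \<delta>_def using r1 by auto
  have deriv: "norm (deriv k w) \<le> 4 / \<delta>" if w: "w \<in> S" for w
  proof -
    define y where "y = Im w"
    have y: "0 < y" "y < \<delta>" "\<bar>Re w\<bar> < \<delta>"
      using w abs_Im_le_cmod[of w] abs_Re_le_cmod[of w] unfolding S_def y_def by auto
    have bs: "ball w y \<subseteq> upper_half_disc 0 r1"
    proof
      fix v assume v: "v \<in> ball w y"
      have "dist 0 v \<le> dist 0 w + dist w v" by (rule dist_triangle)
      then have "norm v < r1" using w v y by (auto simp: S_def \<delta>_def)
      moreover have "\<bar>Im (w - v)\<bar> < y" using v abs_Im_le_cmod[of "w - v"] by (simp add: dist_norm)
      then have "Im v > 0" unfolding y_def by simp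
      ultimately show "v \<in> upper_half_disc 0 r1" by simp
    qed
    have "norm (deriv k w) \<le> (1 - (norm (k w))\<^sup>2) / y"
    proof (rule Schwarz_Pick_deriv)
      show "k holomorphic_on ball w y" using holk1 bs holomorphic_on_subset by blast
      show "k ` ball w y \<subseteq> disc" using kd bs sub by blast
    qed (rule y)
    also have "\<dots> \<le> (4 * y / \<delta>) / y"
    proof (intro divide_right_mono)
      have "norm (k (Complex (Re w) y)) \<ge> 1 - 2 * y / \<delta>"
        by (rule half_disc_barrier[OF holk1 bd1 half]) (use y dl in \<open>auto simp: \<delta>_def\<close>)
      then have n: "norm (k w) \<ge> 1 - 2 * y / \<delta>" by (simp add: y_def)
      have "norm (k w) < 1" using kd w Sr sub by (auto simp: image_subset_iff)
      have "0 \<le> (1 - norm (k w))\<^sup>2" by simp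
      then have "1 - (norm (k w))\<^sup>2 \<le> 2 * (1 - norm (k w))" by (simp add: power2_eq_square algebra_simps)
      then show "1 - (norm (k w))\<^sup>2 \<le> 4 * y / \<delta>"
      proof -
        have "4 * y / \<delta> = 2 * (2 * y / \<delta>)" by simp
        moreover have "a \<le> 2 * q" if "a \<le> 2 * (1 - b)" "1 - q \<le> b" for a b q :: real
          using that unfolding right_diff_distrib by linarith
        ultimately show ?thesis using n \<open>1 - _ \<le> 2 * _\<close> by metis
      qed
    qed (use y in auto)
    also have "\<dots> = 4 / \<delta>" using y by simp
    finally show ?thesis .
  qed
  have lip: "norm (k v - k w) \<le> 4 / \<delta> * norm (v - w)" if "v \<in> S" "w \<in> S" for v w
  proof (rule field_differentiable_bound[where S = S and f' = "deriv k"])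
    show "convex S" unfolding S_def by (rule convex_upper_half_disc)
    fix z assume z: "z \<in> S"
    have "(k has_field_derivative deriv k z) (at z)"
      by (rule holomorphic_derivI[OF holk1 open_upper_half_disc]) (use z Sr in blast)
    then show "(k has_field_derivative deriv k z) (at z within S)" by (rule has_field_derivative_at_within)
  qed (use deriv that in auto)
  have "uniformly_continuous_on S k"
    unfolding uniformly_continuous_on_def
  proof (intro allI impI)
    fix e :: real assume e: "e > 0"
    show "\<exists>da>0. \<forall>x\<in>S. \<forall>x'\<in>S. dist x' x < da \<longrightarrow> dist (k x') (k x) < e"
    proof (intro exI[of _ "e * \<delta> / 4"] conjI ballI impI)
      fix x x' assume "x \<in> S" "x' \<in> S" "dist x' x < e * \<delta> / 4"
      then have "4 / \<delta> * norm (x' - x) < e" using dl by (simp add: dist_norm field_simps)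
      then show "dist (k x') (k x) < e" using lip[OF \<open>x' \<in> S\<close> \<open>x \<in> S\<close>] by (simp add: dist_norm)
    qed (use e dl in auto)
  qed
  then obtain g where ug: "uniformly_continuous_on (closure S) g" and kg: "\<And>x. x \<in> S \<Longrightarrow> k x = g x"
    by (rule uniformly_continuous_on_extension_on_closure) blast
  have subc: "ball 0 \<delta> \<inter> {w. Im w \<ge> 0} \<subseteq> closure S"
    unfolding S_def closure_def using real_in_closure_upper_half_disc by auto
  have cg: "continuous_on (ball 0 \<delta> \<inter> {w. Im w \<ge> 0}) g"
    using continuous_on_subset[OF uniformly_continuous_imp_continuous[OF ug] subc] .
  show thesis
  proof (rule that[of \<delta> g])
    show "\<delta> > 0" "\<delta> \<le> r" using dl r1 by (auto simp: \<delta>_def)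
    show "continuous_on (ball 0 \<delta> \<inter> {w. Im w \<ge> 0}) g" by (rule cg)
    show "g w = k w" if "w \<in> upper_half_disc 0 \<delta>" for w using kg that by (simp add: S_def)
    fix x :: real assume x: "\<bar>x\<bar> < \<delta>"
    have nb: "at (of_real x) within S \<noteq> bot"
      using real_in_closure_upper_half_disc[of "of_real x" 0 \<delta>] x by (simp add: S_def trivial_limit_within)
    have "(g \<longlongrightarrow> g (of_real x)) (at (of_real x) within S)"
      using cg x unfolding continuous_on_def
      by (rule_tac tendsto_within_subset[of _ _ _ "ball 0 \<delta> \<inter> {w. Im w \<ge> 0}"]) (auto simp: S_def)
    then have "((\<lambda>w. norm (g w)) \<longlongrightarrow> norm (g (of_real x))) (at (of_real x) within S)" by (rule tendsto_norm)
    moreover have "((\<lambda>w. norm (k w)) \<longlongrightarrow> 1) (at (of_real x) within S)"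
      by (rule tendsto_within_subset[OF bd1 Sr]) (use x dl in \<open>auto simp: \<delta>_def\<close>)
    then have "((\<lambda>w. norm (g w)) \<longlongrightarrow> 1) (at (of_real x) within S)"
      by (rule Lim_transform_eventually) (auto simp: eventually_at_filter kg)
    ultimately show "norm (g (of_real x)) = 1" using tendsto_unique[OF nb] by blast
  qed
qed

text \<open>On the unit circle conjugation is inversion, which leaves the Cayley quotient
  fixed.\<close>

lemma cayley_real:
  assumes "norm \<zeta> = 1" "norm z = 1" "\<zeta> + z \<noteq> 0"
  shows "\<i> * (\<zeta> - z) / (\<zeta> + z) \<in> \<real>"
proof -
  have nz: "\<zeta> \<noteq> 0" "z \<noteq> 0" using assms by auto
  have c: "cnj \<zeta> = inverse \<zeta>" "cnj z = inverse z"
    using assms complex_norm_square[of \<zeta>] complex_norm_square[of z]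
    by (metis inverse_unique of_real_1 power_one)+
  have "inverse \<zeta> - inverse z = (z - \<zeta>) / (\<zeta> * z)" "inverse \<zeta> + inverse z = (\<zeta> + z) / (\<zeta> * z)"
    using nz by (simp_all add: field_simps)
  then have "cnj (\<i> * (\<zeta> - z) / (\<zeta> + z)) = - \<i> * ((z - \<zeta>) / (\<zeta> * z)) / ((\<zeta> + z) / (\<zeta> * z))"
    by (simp only: complex_cnj_divide complex_cnj_mult complex_cnj_add complex_cnj_diff complex_cnj_i c)
  also have "\<dots> = - \<i> * (z - \<zeta>) / (\<zeta> + z)"
    using nz by simp
  also have "\<dots> = \<i> * (\<zeta> - z) / (\<zeta> + z)" by (simp add: algebra_simps)
  finally have "cnj (\<i> * (\<zeta> - z) / (\<zeta> + z)) = \<i> * (\<zeta> - z) / (\<zeta> + z)" .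
  then show ?thesis by (simp add: Reals_cnj_iff)
qed

text \<open>A Cayley map based at the boundary value of \<open>k\<close> at \<open>0\<close> turns
  unimodular values into real ones, so Schwarz reflection applies. The derivative at
  \<open>0\<close> cannot vanish: otherwise \<open>1 - norm (K w)\<close> would be of smaller order
  than \<open>Im w\<close> along the imaginary axis, against the growth estimate.\<close>

lemma boundary_extension:
  assumes r: "r > 0" and holk: "k holomorphic_on upper_half_disc 0 r" and kd: "k ` upper_half_disc 0 r \<subseteq> disc"
    and bd: "\<And>x. \<bar>x\<bar> < r \<Longrightarrow> ((\<lambda>w. norm (k w)) \<longlongrightarrow> 1) (at (of_real x) within upper_half_disc 0 r)"
  obtains \<rho> K where "0 < \<rho>" "\<rho> \<le> r" "K holomorphic_on ball 0 \<rho>"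
    "\<And>w. w \<in> upper_half_disc 0 \<rho> \<Longrightarrow> K w = k w" "\<And>x. \<bar>x\<bar> < \<rho> \<Longrightarrow> norm (K (of_real x)) = 1"
    "deriv K 0 \<noteq> 0"
proof -
  obtain \<rho>0 g where rho0: "0 < \<rho>0" "\<rho>0 \<le> r" and cg: "continuous_on (ball 0 \<rho>0 \<inter> {w. Im w \<ge> 0}) g"
    and gk: "\<And>w. w \<in> upper_half_disc 0 \<rho>0 \<Longrightarrow> g w = k w" and g1: "\<And>x. \<bar>x\<bar> < \<rho>0 \<Longrightarrow> norm (g (of_real x)) = 1"
    by (rule half_disc_continuous_extension[OF r holk kd bd]) auto
  define \<zeta> where "\<zeta> = g 0"
  have z1: "norm \<zeta> = 1" using g1[of 0] rho0 by (simp add: \<zeta>_def)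
  have "\<exists>d>0. \<forall>w\<in>ball 0 \<rho>0 \<inter> {w. Im w \<ge> 0}. dist w 0 < d \<longrightarrow> dist (g w) \<zeta> < 1"
    using cg rho0 unfolding continuous_on_iff \<zeta>_def by (auto dest!: bspec[where x = 0])
  then obtain d where d: "d > 0" "\<And>w. w \<in> ball 0 \<rho>0 \<inter> {w. Im w \<ge> 0} \<Longrightarrow> norm w < d \<Longrightarrow> dist (g w) \<zeta> < 1"
    by auto
  define \<rho>1 where "\<rho>1 = min d \<rho>0"
  have rho1: "0 < \<rho>1" "\<rho>1 \<le> \<rho>0" using d rho0 by (auto simp: \<rho>1_def)
  define S where "S = (ball 0 \<rho>1 :: complex set)"
  \<comment> \<open>The Cayley map sends \<open>\<zeta>\<close> to \<open>0\<close> and has its pole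
    at \<open>- \<zeta>\<close>; on the closed upper half of \<open>S\<close> the values of
    \<open>g\<close> stay within distance 1 of \<open>\<zeta>\<close>.\<close>
  define f where "f = (\<lambda>w. \<i> * (\<zeta> - g w) / (\<zeta> + g w))"
  have nz: "\<zeta> + g w \<noteq> 0" if "w \<in> S" "Im w \<ge> 0" for w
  proof
    assume "\<zeta> + g w = 0"
    then have "g w = - \<zeta>" by (simp add: eq_neg_iff_add_eq_0 add.commute)
    moreover have "dist (g w) \<zeta> < 1" using d(2) that by (auto simp: S_def \<rho>1_def)
    moreover have "dist (- \<zeta>) \<zeta> = 2"
    proof -
      have "- \<zeta> - \<zeta> = - (2 * \<zeta>)" by simp
      then have "norm (- \<zeta> - \<zeta>) = 2" using z1 by (simp only: norm_minus_cancel norm_mult) simp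
      then show ?thesis by (simp add: dist_norm)
    qed
    ultimately show False by simp
  qed
  have "(\<lambda>z. if 0 \<le> Im z then f z else cnj (f (cnj z))) holomorphic_on S"
  proof (rule Schwarz_reflection)
    show "open S" "cnj ` S \<subseteq> S" by (auto simp: S_def)
    have "k holomorphic_on S \<inter> {z. 0 < Im z}"
      by (rule holomorphic_on_subset[OF holk]) (use rho1 rho0 in \<open>auto simp: S_def\<close>)
    then have "g holomorphic_on S \<inter> {z. 0 < Im z}"
      by (rule holomorphic_transform) (use gk rho1 in \<open>auto simp: S_def\<close>)
    then show "f holomorphic_on S \<inter> {z. 0 < Im z}"
      unfolding f_def by (intro holomorphic_intros) (use nz in auto)
    have "continuous_on (S \<inter> {z. 0 \<le> Im z}) g"
      by (rule continuous_on_subset[OF cg]) (use rho1 in \<open>auto simp: S_def\<close>)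
    then show "continuous_on (S \<inter> {z. 0 \<le> Im z}) f"
      unfolding f_def by (intro continuous_intros) (use nz in auto)
    fix z assume z: "z \<in> S" "z \<in> \<real>"
    then obtain x where x: "z = of_real x" by (auto simp: Reals_def)
    then have "norm (g z) = 1" using g1[of x] z rho1 by (auto simp: S_def)
    moreover have "\<zeta> + g z \<noteq> 0" using nz[of z] z x by simp
    ultimately show "f z \<in> \<real>" unfolding f_def by (rule cayley_real[OF z1])
  qed
  then obtain h where h: "h holomorphic_on S" "\<And>w. 0 \<le> Im w \<Longrightarrow> h w = f w" by (metis (mono_tags, lifting))
  have h0: "h 0 = 0" using h(2)[of 0] z1 by (simp add: f_def \<zeta>_def)
  have "isCont h 0"
    using h(1) rho1 holomorphic_on_imp_continuous_on continuous_on_eq_continuous_at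
    by (metis S_def centre_in_ball open_ball)
  then have "\<exists>e>0. \<forall>w. dist w 0 < e \<longrightarrow> dist (h w) (h 0) < 1"
    by (simp add: continuous_at_eps_delta)
  then obtain e where e: "e > 0" "\<And>w. norm w < e \<Longrightarrow> norm (h w) < 1" by (auto simp: h0)
  \<comment> \<open>Shrinking keeps \<open>h\<close> away from the pole \<open>- \<i>\<close> of the
    inverse Cayley map.\<close>
  define \<rho> where "\<rho> = min e \<rho>1"
  have rho: "0 < \<rho>" "\<rho> \<le> \<rho>1" using e rho1 by (auto simp: \<rho>_def)
  define K where "K = (\<lambda>w. \<zeta> * (\<i> - h w) / (\<i> + h w))"
  have hi: "\<i> + h w \<noteq> 0" if "norm w < \<rho>" for w
  proof
    assume "\<i> + h w = 0"
    then have "h w = - \<i>" by (simp add: eq_neg_iff_add_eq_0 add.commute)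
    then show False using e(2)[of w] that by (simp add: \<rho>_def)
  qed
  have Kg: "K w = g w" if w: "norm w < \<rho>" "Im w \<ge> 0" for w
  proof -
    have "w \<in> S" using w rho by (simp add: S_def)
    then have n: "\<zeta> + g w \<noteq> 0" using nz w by blast
    have "h w * (\<zeta> + g w) = \<i> * (\<zeta> - g w)" using h(2)[OF w(2)] n by (simp add: f_def)
    then have "\<zeta> * (\<i> - h w) = g w * (\<i> + h w)" by algebra
    then show ?thesis using hi[OF w(1)] by (simp add: K_def)
  qed
  have holK: "K holomorphic_on ball 0 \<rho>"
    unfolding K_def by (intro holomorphic_intros holomorphic_on_subset[OF h(1)]) (use rho hi in \<open>auto simp: S_def\<close>)
  have Kk: "K w = k w" if "w \<in> upper_half_disc 0 \<rho>" for w
    using Kg[of w] gk[of w] that rho rho1 by simp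
  have K1: "norm (K (of_real x)) = 1" if "\<bar>x\<bar> < \<rho>" for x
    using Kg[of "of_real x"] g1[of x] that rho rho1 by simp
  have "deriv K 0 \<noteq> 0"
  proof
    assume d0: "deriv K 0 = 0"
    define y0 where "y0 = \<rho> / 2"
    have y0: "y0 > 0" using rho by (simp add: y0_def)
    \<comment> \<open>A disc in the half plane tangent to the real axis at \<open>0\<close>; along
      its radius to the point of contact the growth estimate is linear in the distance
      \<open>y\<close> to that point.\<close>
    have bs: "ball (\<i> * of_real y0) y0 \<subseteq> upper_half_disc 0 \<rho>"
    proof
      fix w assume w: "w \<in> ball (\<i> * of_real y0) y0"
      have "dist 0 w \<le> dist 0 (\<i> * of_real y0) + dist (\<i> * of_real y0) w" by (rule dist_triangle)
      then have "norm w < \<rho>" using w y0 by (simp add: norm_mult y0_def)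
      moreover have "\<bar>Im (\<i> * of_real y0 - w)\<bar> < y0"
        using w abs_Im_le_cmod[of "\<i> * of_real y0 - w"] by (simp add: dist_norm)
      then have "Im w > 0" by simp
      ultimately show "w \<in> upper_half_disc 0 \<rho>" by simp
    qed
    have Kd: "K ` upper_half_disc 0 \<rho> \<subseteq> disc" using Kk kd rho rho1 rho0 by (auto simp: image_subset_iff)
    define c where "c = (1 - norm (K (\<i> * of_real y0))) / (4 * y0)"
    have "\<i> * of_real y0 \<in> upper_half_disc 0 \<rho>" using bs y0 by (meson centre_in_ball subsetD)
    then have "norm (K (\<i> * of_real y0)) < 1" using Kd by (auto simp: image_subset_iff)
    then have c: "c > 0" using y0 by (simp add: c_def)
    have low: "1 - norm (K (\<i> * of_real y)) \<ge> c * y" if y: "0 < y" "y < y0" for y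
    proof -
      have ds: "dist (\<i> * of_real y0) (\<i> * of_real y) = y0 - y"
      proof -
        have "\<i> * of_real y0 - \<i> * of_real y = \<i> * of_real (y0 - y)" by (simp add: algebra_simps)
        then show ?thesis using y by (simp only: dist_norm norm_mult norm_of_real) simp
      qed
      have "1 - norm (K (\<i> * of_real y)) \<ge> (1 - norm (K (\<i> * of_real y0))) * (1 - dist (\<i> * of_real y0) (\<i> * of_real y) / y0) / 4"
      proof (rule Schwarz_Pick_growth)
        show "K holomorphic_on ball (\<i> * of_real y0) y0" using holK bs holomorphic_on_subset by blast
        show "K ` ball (\<i> * of_real y0) y0 \<subseteq> disc" using Kd bs by blast
      qed (use ds y in auto)
      also have "(1 - norm (K (\<i> * of_real y0))) * (1 - dist (\<i> * of_real y0) (\<i> * of_real y) / y0) / 4 = c * y"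
        unfolding ds c_def using y0 by (simp add: field_simps)
      finally show ?thesis .
    qed
    have "(K has_field_derivative 0) (at 0)"
      using holK rho d0 by (metis centre_in_ball holomorphic_derivI open_ball)
    then have "((\<lambda>w. (K w - K 0) / w) \<longlongrightarrow> 0) (at 0)" by (simp add: has_field_derivative_iff)
    then have "\<forall>\<^sub>F w in at 0. dist ((K w - K 0) / w) 0 < c" using c by (rule tendstoD)
    then obtain b where b: "b > 0" "\<And>w. w \<noteq> 0 \<Longrightarrow> norm w < b \<Longrightarrow> norm ((K w - K 0) / w) < c"
      unfolding eventually_at by auto
    define y where "y = min b y0 / 2"
    have y: "0 < y" "y < b" "y < y0" using b y0 by (auto simp: y_def min_def)
    have "norm ((K (\<i> * of_real y) - K 0) / (\<i> * of_real y)) < c"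
      using y by (intro b(2)) (auto simp: norm_mult)
    then have "norm (K (\<i> * of_real y) - K 0) < c * y" using y by (simp add: norm_divide norm_mult field_simps)
    moreover have "norm (K 0) = 1" using K1[of 0] rho by simp
    moreover have "norm (K 0) - norm (K (\<i> * of_real y)) \<le> norm (K (\<i> * of_real y) - K 0)"
      by (metis norm_minus_commute norm_triangle_ineq2)
    ultimately show False using low[OF y(1,3)] by linarith
  qed
  then show thesis using that rho rho1 rho0 holK Kk K1 by (meson order_trans)
qed

section \<open>Semigroups and Wolff's lemma\<close>

locale generated_semigroup =
  fixes \<phi> :: "real \<Rightarrow> complex \<Rightarrow> complex" and G :: "complex \<Rightarrow> complex"
  assumes semigroup: "holomorphic_semigroup \<phi>" and generator: "infinitesimal_generator \<phi> G"
begin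

lemma flow_holomorphic: "t \<ge> 0 \<Longrightarrow> \<phi> t holomorphic_on disc"
  and flow_image: "t \<ge> 0 \<Longrightarrow> \<phi> t ` disc \<subseteq> disc"
  and flow_0: "z \<in> disc \<Longrightarrow> \<phi> 0 z = z"
  and flow_add: "s \<ge> 0 \<Longrightarrow> t \<ge> 0 \<Longrightarrow> z \<in> disc \<Longrightarrow> \<phi> (s + t) z = \<phi> s (\<phi> t z)"
  using semigroup unfolding holomorphic_semigroup_def by blast+

lemma flow_in_disc: "t \<ge> 0 \<Longrightarrow> z \<in> disc \<Longrightarrow> \<phi> t z \<in> disc"
  using flow_image by blast

lemma flow_has_vector_derivative:
  "t \<ge> 0 \<Longrightarrow> z \<in> disc \<Longrightarrow> ((\<lambda>s. \<phi> s z) has_vector_derivative G (\<phi> t z)) (at t within {0..})"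
  using generator unfolding infinitesimal_generator_def by blast

lemma generator_holomorphic: "G holomorphic_on disc"
  using generator unfolding infinitesimal_generator_def by blast

lemma isCont_flow: "t \<ge> 0 \<Longrightarrow> z \<in> disc \<Longrightarrow> isCont (\<phi> t) z"
  using flow_holomorphic holomorphic_on_imp_continuous_on continuous_on_eq_continuous_at open_ball by blast

lemma continuous_on_flow_time: "z \<in> disc \<Longrightarrow> continuous_on {0..} (\<lambda>t. \<phi> t z)"
  unfolding continuous_on_eq_continuous_within
  using flow_has_vector_derivative has_vector_derivative_continuous by fastforce

text \<open>Both sides are the right derivative at \<open>s = 0\<close> of
  \<open>\<phi> t (\<phi> s z) = \<phi> (t + s) z\<close>. The identity controls
  \<open>deriv (\<phi> t)\<close> through values of \<open>G\<close> alone, also close to the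
  circle.\<close>

lemma deriv_flow_generator:
  assumes t: "t \<ge> 0" and z: "z \<in> disc"
  shows "deriv (\<phi> t) z * G z = G (\<phi> t z)"
proof -
  have 1: "((\<lambda>s. \<phi> t (\<phi> s z)) has_vector_derivative G z * deriv (\<phi> t) z) (at 0 within {0..})"
  proof (rule field_vector_diff_chain_within[unfolded o_def, of "\<lambda>s. \<phi> s z" "G z" 0 "{0..}" "\<phi> t" "deriv (\<phi> t) z"])
    show "((\<lambda>s. \<phi> s z) has_vector_derivative G z) (at 0 within {0..})"
      using flow_has_vector_derivative[of 0 z] z flow_0[OF z] by simp
    show "(\<phi> t has_field_derivative deriv (\<phi> t) z) (at (\<phi> 0 z) within (\<lambda>s. \<phi> s z) ` {0..})"
      using holomorphic_derivI[OF flow_holomorphic[OF t] open_ball z] flow_0[OF z]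
      by (simp add: has_field_derivative_at_within)
  qed
  have "((\<lambda>s. \<phi> (t + s) z) has_vector_derivative 1 *\<^sub>R G (\<phi> t z)) (at 0 within {0..})"
  proof (rule vector_diff_chain_within[unfolded o_def, of "\<lambda>s. t + s" 1 0 "{0..}" "\<lambda>s. \<phi> s z" "G (\<phi> t z)"])
    show "((\<lambda>s. t + s) has_vector_derivative 1) (at 0 within {0..})"
      by (auto intro!: derivative_eq_intros)
    show "((\<lambda>s. \<phi> s z) has_vector_derivative G (\<phi> t z)) (at (t + 0) within (\<lambda>s. t + s) ` {0..})"
      using flow_has_vector_derivative[OF t z] t by (simp add: has_vector_derivative_within_subset)
  qed
  then have 2: "((\<lambda>s. \<phi> t (\<phi> s z)) has_vector_derivative G (\<phi> t z)) (at 0 within {0..})"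
    by (subst (asm) scaleR_one, rule_tac has_vector_derivative_transform[of 0 "{0..}" _ "\<lambda>s. \<phi> (t + s) z"])
       (use t z flow_add in auto)
  have "at (0::real) within {0..} \<noteq> bot" by (simp add: at_within_Ici_at_right)
  then show ?thesis using vector_derivative_unique_within[OF _ 1 2] by (simp add: mult.commute)
qed

text \<open>\<open>G (\<phi> t z)\<close> is a multiple of \<open>G z\<close>, so the orbit of a
  zero has velocity zero throughout.\<close>

lemma fixed_point_of_generator_zero:
  assumes z: "z \<in> disc" and G0: "G z = 0" and t: "t \<ge> 0"
  shows "\<phi> t z = z"
proof -
  have "\<exists>c. \<forall>x\<in>{0..}. \<phi> x z = c"
  proof (rule has_vector_derivative_zero_constant)
    fix x :: real assume "x \<in> {0..}"
    then show "((\<lambda>s. \<phi> s z) has_vector_derivative 0) (at x within {0..})"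
      using flow_has_vector_derivative[of x z] deriv_flow_generator[of x z] z G0 by simp
  qed auto
  then show ?thesis using flow_0[OF z] t by (metis atLeast_iff order_refl)
qed

text \<open>If \<open>G\<close> had no zero in the disc, a primitive of \<open>1 / G\<close> would
  grow by exactly the elapsed time along an orbit, which a period rules out; a zero is a common
  fixed point. The inverse of \<open>\<phi> t\<close> is \<open>\<phi> (real n * Q - t)\<close> for
  large \<open>n\<close>.\<close>

lemma elliptic_group_if_period:
  assumes Q: "Q > 0" and per: "\<And>z. z \<in> disc \<Longrightarrow> \<phi> Q z = z"
  shows "elliptic_group \<phi>"
proof -
  have ex0: "\<exists>z\<in>disc. G z = 0"
  proof (rule ccontr)
    assume nz: "\<not> ?thesis"
    have "(\<lambda>z. 1 / G z) holomorphic_on disc"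
      by (intro holomorphic_intros generator_holomorphic) (use nz in auto)
    then obtain H where H: "\<And>z. z \<in> disc \<Longrightarrow> (H has_field_derivative 1 / G z) (at z)"
      using holomorphic_convex_primitive'[of disc "\<lambda>z. 1 / G z"] at_within_open[OF _ open_ball]
      by (metis convex_ball open_ball)
    define k where "k = (\<lambda>t. H (\<phi> t 0) - of_real t)"
    have "\<exists>c. \<forall>t\<in>{0..}. k t = c"
    proof (rule has_vector_derivative_zero_constant)
      fix t :: real assume t: "t \<in> {0..}"
      then have fd: "\<phi> t 0 \<in> disc" using flow_in_disc[of t 0] by simp
      have "((\<lambda>s. H (\<phi> s 0)) has_vector_derivative G (\<phi> t 0) * (1 / G (\<phi> t 0))) (at t within {0..})"
        by (rule field_vector_diff_chain_within[unfolded o_def])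
           (use t H[OF fd] flow_has_vector_derivative[of t 0] has_field_derivative_at_within in auto)
      then have "((\<lambda>s. H (\<phi> s 0)) has_vector_derivative 1) (at t within {0..})" using nz fd by auto
      moreover have "((\<lambda>s. complex_of_real s) has_vector_derivative 1) (at t within {0..})"
        by (auto intro!: derivative_eq_intros)
      ultimately show "(k has_vector_derivative 0) (at t within {0..})"
        unfolding k_def using has_vector_derivative_diff by fastforce
    qed auto
    then have "k Q = k 0" using Q by (metis atLeast_iff less_imp_le order_refl)
    then show False using Q per[of 0] flow_0[of 0] by (simp add: k_def)
  qed
  have powQ: "\<phi> (real n * Q) z = z" if z: "z \<in> disc" for n z
  proof (induction n)
    case (Suc n)
    have "\<phi> (Q + real n * Q) z = \<phi> Q (\<phi> (real n * Q) z)" using Q z by (intro flow_add) auto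
    then show ?case using Suc per[OF z] by (simp add: algebra_simps)
  qed (use flow_0[OF z] in auto)
  have "bij_betw (\<phi> t) disc disc" if t: "t \<ge> 0" for t
  proof -
    obtain n :: nat where n: "t < real n * Q" using ex_less_of_nat_mult[OF Q] by blast
    show ?thesis
      by (rule bij_betw_byWitness[where f' = "\<phi> (real n * Q - t)"])
         (use n t flow_image flow_add[of "real n * Q - t" t] flow_add[of t "real n * Q - t"] powQ[of _ n] in auto)
  qed
  then show ?thesis
    using ex0 fixed_point_of_generator_zero unfolding elliptic_group_def elliptic_def by blast
qed

text \<open>Wolff's lemma: apply Schwarz-Pick with one of the points running along an orbit.\<close>

lemma horodisc_invariant:
  assumes dw: "is_denjoy_wolff_point \<phi> e" and e: "norm e = 1" and t: "t \<ge> 0" and z: "z \<in> disc"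
  shows "(norm (1 - cnj e * \<phi> t z))\<^sup>2 / (1 - (norm (\<phi> t z))\<^sup>2) \<le> (norm (1 - cnj e * z))\<^sup>2 / (1 - (norm z)\<^sup>2)"
    (is "?L \<le> ?R")
proof (rule ccontr)
  assume "\<not> ?thesis"
  then have neg: "?R * 1 - ?L < 0" by simp
  define w where "w = (\<lambda>s. \<phi> s 0)"
  define d where "d = (\<lambda>s. 1 - (norm (w s))\<^sup>2)"
  define L where "L = (\<lambda>s. (norm (1 - cnj (\<phi> t (w s)) * \<phi> t z))\<^sup>2 / (1 - (norm (\<phi> t z))\<^sup>2))"
  define R where "R = (\<lambda>s. (norm (1 - cnj (w s) * z))\<^sup>2 / (1 - (norm z)\<^sup>2))"
  have wd: "norm (w s) < 1" if "s \<ge> 0" for s using flow_in_disc[OF that, of 0] by (simp add: w_def)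
  have wlim: "(w \<longlongrightarrow> e) at_top" using dw unfolding is_denjoy_wolff_point_def w_def by simp
  have dpos: "d s > 0" if "s \<ge> 0" for s
    using wd[OF that] by (simp add: d_def power_less_one_iff abs_square_less_1)
  have "(d \<longlongrightarrow> 1 - (norm e)\<^sup>2) at_top" unfolding d_def by (intro tendsto_intros wlim)
  then have dlim: "(d \<longlongrightarrow> 0) at_top" using e by simp
  have wt: "\<phi> t (w s) = w (t + s)" if "s \<ge> 0" for s
    using flow_add[OF t that, of 0] by (simp add: w_def)
  \<comment> \<open>Since \<open>d\<close> is positive and tends to \<open>0\<close>, it cannot
    increase at every late step of length \<open>t\<close>. Hence at arbitrarily late times the
    quotient \<open>d (t + s) / d s\<close>, the last factor in Schwarz-Pick, is at most 1.\<close>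
  have freq: "\<exists>\<^sub>F s in at_top. d (t + s) \<le> d s"
  proof (rule ccontr)
    assume "\<not> ?thesis"
    then have "\<forall>\<^sub>F s in at_top. d s < d (t + s)" by (simp add: not_frequently not_le)
    then obtain S where S: "\<And>s. s \<ge> S \<Longrightarrow> d s < d (t + s)" unfolding eventually_at_top_linorder by auto
    define S0 where "S0 = max S 0"
    have tpos: "t > 0" using S[of S] t by (cases "t = 0") auto
    have inc: "d S0 \<le> d (S0 + real n * t)" for n
    proof (induction n)
      case (Suc n)
      have "d (S0 + real n * t) < d (t + (S0 + real n * t))" using t by (intro S) (simp add: S0_def add_increasing2)
      then show ?case using Suc by (simp add: algebra_simps)
    qed auto
    have "filterlim (\<lambda>n. S0 + real n * t) at_top sequentially"
      using tpos by (intro filterlim_tendsto_add_at_top[OF tendsto_const]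
        filterlim_at_top_mult_tendsto_pos[OF tendsto_const] filterlim_real_sequentially) auto
    then have "(\<lambda>n. d (S0 + real n * t)) \<longlonglongrightarrow> 0" using dlim filterlim_compose by blast
    then have "d S0 \<le> 0" by (rule LIMSEQ_le_const) (use inc in auto)
    then show False using dpos[of S0] by (simp add: S0_def)
  qed
  have "((\<lambda>s. w (t + s)) \<longlongrightarrow> e) at_top"
    by (rule filterlim_compose[OF wlim filterlim_tendsto_add_at_top[OF tendsto_const filterlim_ident]])
  then have wtlim: "((\<lambda>s. \<phi> t (w s)) \<longlongrightarrow> e) at_top"
    by (rule Lim_transform_eventually) (use wt in \<open>auto simp: eventually_at_top_linorder intro!: exI[of _ 0]\<close>)
  have nz: "1 - (norm (\<phi> t z))\<^sup>2 > 0" "1 - (norm z)\<^sup>2 > 0"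
    using flow_in_disc[OF t z] z by (simp_all add: power_less_one_iff abs_square_less_1)
  have "(L \<longlongrightarrow> ?L) at_top" "(R \<longlongrightarrow> ?R) at_top"
    unfolding L_def R_def using nz by (auto intro!: tendsto_intros wlim wtlim)
  then have "((\<lambda>s. R s * 1 - L s) \<longlongrightarrow> ?R * 1 - ?L) at_top" by (intro tendsto_intros)
  then have "\<forall>\<^sub>F s in at_top. R s * 1 - L s < 0" using neg order_tendstoD(2) by blast
  moreover have "\<forall>\<^sub>F s::real in at_top. s \<ge> 0" by (rule eventually_ge_at_top)
  ultimately have "\<exists>\<^sub>F s in at_top. d (t + s) \<le> d s \<and> R s * 1 - L s < 0 \<and> s \<ge> 0"
    using frequently_eventually_frequently[OF freq eventually_conj] by blast
  then obtain s where s: "d (t + s) \<le> d s" "R s < L s" "s \<ge> 0" by (auto dest!: frequently_ex)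
  have "L s \<le> R s * (d (t + s) / d s)"
    using Schwarz_Pick_power2[OF flow_holomorphic[OF t] flow_image[OF t], of z "w s"] z wd[OF s(3)]
    by (simp add: L_def R_def d_def wt[OF s(3)])
  also have "\<dots> \<le> R s * 1"
    using s(1) dpos[OF s(3)] nz by (intro mult_left_mono) (auto simp: R_def)
  finally show False using s(2) by simp
qed

text \<open>Radial points tending to \<open>e\<close> lie in horodiscs that shrink to
  \<open>e\<close>, and these are invariant. An angular limit inside the disc at the end of an arc
  will thereby exclude the Denjoy-Wolff point.\<close>

lemma nontangential_limit_at_denjoy_wolff:
  assumes dw: "is_denjoy_wolff_point \<phi> e" and e: "norm e = 1" and t: "t \<ge> 0"
    and l: "has_nontangential_limit (\<phi> t) e l"
  shows "l = e"
proof -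
  define r where "r = (\<lambda>n. 1 - inverse (real (Suc (Suc n))))"
  define x where "x = (\<lambda>n. complex_of_real (r n) * e)"
  have r: "0 < r n" "r n < 1" for n by (auto simp: r_def field_simps)
  have rlim: "r \<longlonglongrightarrow> 1"
    unfolding r_def using tendsto_diff[OF tendsto_const LIMSEQ_Suc[OF LIMSEQ_inverse_real_of_nat], of 1] by simp
  have xn: "norm (x n) = r n" for n using r[of n] e by (simp add: x_def norm_mult)
  have xd: "x n \<in> disc" for n using r[of n] xn by simp
  have "(\<lambda>n. complex_of_real (r n) * e) \<longlonglongrightarrow> complex_of_real 1 * e"
    by (intro tendsto_intros rlim)
  then have xlim: "x \<longlonglongrightarrow> e" by (simp add: x_def)
  have xe: "norm (e - x n) = 1 - r n" for n
  proof -
    have "e - x n = of_real (1 - r n) * e" by (simp add: x_def algebra_simps)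
    then show ?thesis using r[of n] e by (simp only: norm_mult norm_of_real) simp
  qed
  have "x n \<in> stolz_region e 2" for n using xd xe xn r[of n] by (simp add: stolz_region_def)
  moreover have "x n \<noteq> e" for n using xe[of n] r[of n] by auto
  ultimately have "filterlim x (at e within stolz_region e 2) sequentially"
    using xlim by (simp add: filterlim_at)
  moreover have "(\<phi> t \<longlongrightarrow> l) (at e within stolz_region e 2)"
    using l by (simp add: has_nontangential_limit_def)
  ultimately have lim1: "(\<lambda>n. \<phi> t (x n)) \<longlonglongrightarrow> l" using filterlim_compose by blast
  have ee: "e * cnj e = 1" using e by (simp add: complex_norm_square[symmetric])
  have bound: "(norm (1 - cnj e * \<phi> t (x n)))\<^sup>2 \<le> 1 - r n" for n
  proof -
    have y: "norm (\<phi> t (x n)) < 1" using flow_in_disc[OF t xd] by auto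
    have "1 - cnj e * x n = of_real (1 - r n)"
      using ee by (simp add: x_def algebra_simps)
    then have n1: "norm (1 - cnj e * x n) = 1 - r n" using r[of n] by (simp only: norm_of_real)
    have h: "(norm (1 - cnj e * \<phi> t (x n)))\<^sup>2 / (1 - (norm (\<phi> t (x n)))\<^sup>2) \<le> (1 - r n)\<^sup>2 / (1 - (r n)\<^sup>2)"
      using horodisc_invariant[OF dw e t xd[of n]] unfolding n1 xn .
    have "1 - (r n)\<^sup>2 = (1 - r n) * (1 + r n)" by (simp add: power2_eq_square algebra_simps)
    then have "(1 - r n)\<^sup>2 / (1 - (r n)\<^sup>2) = (1 - r n) / (1 + r n)"
      using r[of n] by (simp add: power2_eq_square)
    also have "\<dots> \<le> 1 - r n" using r[of n] divide_left_mono[of 1 "1 + r n" "1 - r n"] by simp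
    finally have 2: "(1 - r n)\<^sup>2 / (1 - (r n)\<^sup>2) \<le> 1 - r n" .
    have pos: "0 < 1 - (norm (\<phi> t (x n)))\<^sup>2" "1 - (norm (\<phi> t (x n)))\<^sup>2 \<le> 1"
      using y by (simp_all add: power_less_one_iff abs_square_less_1)
    have "(norm (1 - cnj e * \<phi> t (x n)))\<^sup>2 \<le> (norm (1 - cnj e * \<phi> t (x n)))\<^sup>2 / (1 - (norm (\<phi> t (x n)))\<^sup>2)"
      using pos by (simp add: pos_le_divide_eq mult_left_le)
    then show ?thesis using h 2 by linarith
  qed
  have "(\<lambda>n. (norm (1 - cnj e * \<phi> t (x n)))\<^sup>2) \<longlonglongrightarrow> (norm (1 - cnj e * l))\<^sup>2" by (intro tendsto_intros lim1)
  moreover have "(\<lambda>n. 1 - r n) \<longlonglongrightarrow> 1 - 1" by (intro tendsto_intros rlim)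
  ultimately have "(norm (1 - cnj e * l))\<^sup>2 \<le> 1 - 1" using bound by (intro LIMSEQ_le) auto
  then have "cnj e * l = 1" by simp
  then have "e * (cnj e * l) = e" by simp
  then show ?thesis using ee by (simp add: mult.assoc[symmetric])
qed

end

section \<open>The flow along a contact arc\<close>

text \<open>The arc is run through by \<open>u \<mapsto> cis (s * u)\<close> in the direction of \<open>F\<close>, so \<open>s = - 1\<close> if \<open>F\<close> points
  clockwise; \<open>m = \<bar>F\<bar>\<close>, and \<open>\<tau>\<close> is the time along the boundary trajectory.  The interval \<open>{a<..<b}\<close>
  may be longer than \<open>2 * pi\<close>.\<close>

locale contact_flow = generated_semigroup +
  fixes F :: "complex \<Rightarrow> complex" and U :: "complex set" and s :: real
    and m \<tau> :: "real \<Rightarrow> real" and a b :: real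
  assumes s: "s = 1 \<or> s = - 1" and open_U: "open U" and holomorphic_F: "F holomorphic_on U"
    and F_eq_G: "\<And>z. z \<in> disc \<Longrightarrow> z \<in> U \<Longrightarrow> F z = G z"
    and arc_in_U: "\<And>u. a < u \<Longrightarrow> u < b \<Longrightarrow> cis (s * u) \<in> U"
    and F_arc: "\<And>u. a < u \<Longrightarrow> u < b \<Longrightarrow> F (cis (s * u)) = \<i> * of_real s * cis (s * u) * of_real (m u)"
    and m_pos: "\<And>u. a < u \<Longrightarrow> u < b \<Longrightarrow> m u > 0"
    and m_cont: "continuous_on {a<..<b} m"
    and tau_deriv: "\<And>u. a < u \<Longrightarrow> u < b \<Longrightarrow> (\<tau> has_real_derivative 1 / m u) (at u)"
begin

definition p :: "real \<Rightarrow> complex" where "p u = cis (s * u)"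

lemma norm_p [simp]: "norm (p u) = 1" by (simp add: p_def)

lemma p_has_vector_derivative: "(p has_vector_derivative \<i> * of_real s * p u) (at u within X)"
proof -
  have "((\<lambda>u. exp (\<i> * of_real s * of_real u)) has_vector_derivative \<i> * of_real s * exp (\<i> * of_real s * of_real u)) (at u within X)"
    by (rule has_vector_derivative_real_field) (auto intro!: derivative_eq_intros)
  moreover have "p = (\<lambda>u. exp (\<i> * of_real s * of_real u))"
    by (simp add: p_def cis_conv_exp fun_eq_iff mult_ac)
  ultimately show ?thesis by simp
qed

lemma isCont_p: "isCont p u"
  using p_has_vector_derivative has_vector_derivative_continuous by blast

lemma p_in_U: "a < u \<Longrightarrow> u < b \<Longrightarrow> p u \<in> U" using arc_in_U by (simp add: p_def)

lemma F_p: "a < u \<Longrightarrow> u < b \<Longrightarrow> F (p u) = \<i> * of_real s * p u * of_real (m u)"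
  using F_arc by (simp add: p_def)

lemma tau_less: "a < u \<Longrightarrow> u < v \<Longrightarrow> v < b \<Longrightarrow> \<tau> u < \<tau> v"
  by (rule DERIV_pos_imp_increasing) (use tau_deriv m_pos in \<open>force intro!: exI[of _ "1 / m _"]\<close>)+

lemma tau_le: "a < u \<Longrightarrow> u \<le> v \<Longrightarrow> v < b \<Longrightarrow> \<tau> u \<le> \<tau> v"
  using tau_less by (cases "u = v") force+

lemma tau_less_iff: "a < u \<Longrightarrow> u < b \<Longrightarrow> a < v \<Longrightarrow> v < b \<Longrightarrow> \<tau> u < \<tau> v \<longleftrightarrow> u < v"
  using tau_less tau_le by (meson not_le)

lemma isCont_tau: "a < u \<Longrightarrow> u < b \<Longrightarrow> isCont \<tau> u"
  using tau_deriv DERIV_isCont by blast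

lemma tau_IVT:
  assumes "a < u" "v < b" "u \<le> v" "\<tau> u \<le> r" "r \<le> \<tau> v"
  obtains w where "u \<le> w" "w \<le> v" "\<tau> w = r"
  using IVT[of \<tau> u r v] assms isCont_tau by (meson le_less_trans less_le_trans)

text \<open>The orbit of a nearby point is compared with the boundary trajectory over the arc
  parameter instead of time: the clock runs at rate \<open>1 / m\<close>, and \<open>p\<close> has
  unit speed. The Lipschitz bound for \<open>F\<close> lets the deviation grow by at most
  \<open>\<epsilon>' / 2\<close> in one step, and the step length is uniform on
  \<open>{c..d}\<close>.\<close>

lemma flow_step:
  assumes c: "a < c" "c \<le> d" "d < b"
  obtains h where "h > 0"
    "\<And>u v. c \<le> u \<Longrightarrow> u \<le> v \<Longrightarrow> v \<le> d \<Longrightarrow> v \<le> u + h \<Longrightarrow>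
      (\<phi> (\<tau> v - \<tau> u) \<longlongrightarrow> p v) (at (p u) within disc)"
proof -
  have K: "compact (p ` {c..d})"
    by (intro compact_continuous_image continuous_at_imp_continuous_on) (auto intro: isCont_p)
  moreover have "p ` {c..d} \<subseteq> U" using c by (auto intro!: p_in_U)
  ultimately obtain \<eta> where eta: "\<eta> > 0" "(\<Union>x\<in>p ` {c..d}. cball x \<eta>) \<subseteq> U"
    using compact_subset_open_imp_cball_epsilon_subset[OF _ open_U] by blast
  \<comment> \<open>A closed neighbourhood of the compact arc; written as a sum of two compact sets
    it is seen to be compact.\<close>
  define K' where "K' = (\<Union>x\<in>p ` {c..d}. cball x \<eta>)"
  have "K' = {x + y |x y. x \<in> p ` {c..d} \<and> y \<in> cball 0 \<eta>}"
    unfolding K'_def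
    by (auto simp: dist_norm) (metis (no_types, lifting) add_diff_cancel_left' add.commute diff_add_cancel norm_minus_commute atLeastAtMost_iff imageI)
  then have "compact K'" using compact_sums[OF K compact_cball, of 0 \<eta>] by (simp only:)
  moreover have "continuous_on K' (deriv F)"
    using holomorphic_on_imp_continuous_on[OF holomorphic_deriv[OF holomorphic_F open_U]] eta(2)
    unfolding K'_def by (rule continuous_on_subset)
  ultimately have "bounded (deriv F ` K')" using compact_continuous_image compact_imp_bounded by blast
  then obtain L where L: "L > 0" "\<And>x. x \<in> K' \<Longrightarrow> norm (deriv F x) \<le> L" by (auto simp: bounded_pos)
  have lip: "norm (F x - F (p u)) \<le> L * norm (x - p u)" if "u \<in> {c..d}" "x \<in> cball (p u) \<eta>" for x u
  proof (rule field_differentiable_bound[where S = "cball (p u) \<eta>" and f' = "deriv F"])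
    fix z assume "z \<in> cball (p u) \<eta>"
    then have z: "z \<in> K'" using that by (auto simp: K'_def)
    then show "norm (deriv F z) \<le> L" by (rule L)
    show "(F has_field_derivative deriv F z) (at z within cball (p u) \<eta>)"
      using holomorphic_derivI[OF holomorphic_F open_U] z eta unfolding K'_def
      by (meson has_field_derivative_at_within subsetD)
  qed (use that eta in auto)
  have "continuous_on {c..d} (\<lambda>u. 1 / m u)"
  proof (intro continuous_intros continuous_on_subset[OF m_cont] ballI)
    show "m u \<noteq> 0" if "u \<in> {c..d}" for u using m_pos[of u] that c by auto
  qed (use c in auto)
  then have "bounded ((\<lambda>u. 1 / m u) ` {c..d})" using compact_continuous_image compact_imp_bounded by blast
  then obtain M where M: "M > 0" "\<And>u. u \<in> {c..d} \<Longrightarrow> 1 / m u \<le> M" by (auto simp: bounded_pos abs_le_iff)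
  show thesis
  \<comment> \<open>This length makes \<open>L * M * T\<close> at most one half, which leaves room
    for an initial distance below \<open>\<epsilon>' / 2\<close>.\<close>
  proof (rule that[of "1 / (2 * L * M)"])
    show "1 / (2 * L * M) > 0" using L M by simp
    fix u v assume uv: "c \<le> u" "u \<le> v" "v \<le> d" "v \<le> u + 1 / (2 * L * M)"
    define T where "T = v - u"
    have T: "T \<ge> 0" "L * M * T \<le> 1 / 2" using uv L M by (auto simp: T_def field_simps)
    show "(\<phi> (\<tau> v - \<tau> u) \<longlongrightarrow> p v) (at (p u) within disc)"
    proof (rule tendstoI)
      fix \<epsilon> :: real assume "\<epsilon> > 0"
      define \<epsilon>' where "\<epsilon>' = min \<epsilon> \<eta>"
      have e': "0 < \<epsilon>'" "\<epsilon>' \<le> \<eta>" "\<epsilon>' \<le> \<epsilon>" using \<open>\<epsilon> > 0\<close> eta by (auto simp: \<epsilon>'_def)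
      have "dist (\<phi> (\<tau> v - \<tau> u) z) (p v) < \<epsilon>" if z: "z \<in> disc" "dist z (p u) < \<epsilon>' / 2" for z
      proof -
        define \<gamma> where "\<gamma> = (\<lambda>x. \<phi> (\<tau> (u + x) - \<tau> u) z - p (u + x))"
        define \<gamma>' where "\<gamma>' = (\<lambda>x. (G (\<phi> (\<tau> (u + x) - \<tau> u) z) - F (p (u + x))) * of_real (1 / m (u + x)))"
        have mon: "\<tau> (u + x) - \<tau> u \<ge> 0" if "0 \<le> x" "x \<le> T" for x
          using that tau_le[of u "u + x"] uv c by (auto simp: T_def)
        have "norm (\<gamma> T - \<gamma> 0) \<le> (L * \<epsilon>' * M) * T"
        proof (rule vector_derivative_trapped_bound[where \<zeta> = 0 and \<eta> = \<epsilon>' and \<gamma>' = \<gamma>'])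
          fix x assume x: "0 \<le> x" "x \<le> T"
          have ux: "a < u + x" "u + x < b" "u + x \<in> {c..d}" using x uv c by (auto simp: T_def)
          have m: "m (u + x) > 0" using ux m_pos by blast
          have "((\<lambda>x. \<tau> (u + x)) has_real_derivative 1 / m (u + x) * 1) (at x)"
            by (rule DERIV_chain2[where f = \<tau> and g = "\<lambda>x. u + x", OF tau_deriv[OF ux(1,2)]])
                 (auto intro!: derivative_eq_intros)
          then have "((\<lambda>x. \<tau> (u + x) - \<tau> u) has_real_derivative 1 / m (u + x) * 1 - 0) (at x)"
            by (intro DERIV_diff DERIV_const)
          then have "((\<lambda>x. \<tau> (u + x) - \<tau> u) has_real_derivative 1 / m (u + x)) (at x within {0..T})"
            by (simp add: has_field_derivative_at_within)
          then have "((\<lambda>x. \<tau> (u + x) - \<tau> u) has_vector_derivative 1 / m (u + x)) (at x within {0..T})"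
            by (simp add: has_real_derivative_iff_has_vector_derivative)
          moreover have "((\<lambda>t. \<phi> t z) has_vector_derivative G (\<phi> (\<tau> (u + x) - \<tau> u) z))
              (at (\<tau> (u + x) - \<tau> u) within (\<lambda>x. \<tau> (u + x) - \<tau> u) ` {0..T})"
            by (rule has_vector_derivative_within_subset[OF flow_has_vector_derivative])
               (use mon x z in auto)
          ultimately have "((\<lambda>x. \<phi> (\<tau> (u + x) - \<tau> u) z) has_vector_derivative
              (1 / m (u + x)) *\<^sub>R G (\<phi> (\<tau> (u + x) - \<tau> u) z)) (at x within {0..T})"
            by (rule vector_diff_chain_within[unfolded o_def])
          moreover have "((\<lambda>x. p (u + x)) has_vector_derivative 1 *\<^sub>R (\<i> * of_real s * p (u + x))) (at x within {0..T})"
            by (rule vector_diff_chain_within[unfolded o_def, of "\<lambda>x. u + x" 1 x "{0..T}" p])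
               (auto intro!: derivative_eq_intros p_has_vector_derivative)
          ultimately have "(\<gamma> has_vector_derivative (1 / m (u + x)) *\<^sub>R G (\<phi> (\<tau> (u + x) - \<tau> u) z) - 1 *\<^sub>R (\<i> * of_real s * p (u + x))) (at x within {0..T})"
            unfolding \<gamma>_def by (rule has_vector_derivative_diff)
          moreover have "(1 / m (u + x)) *\<^sub>R G (\<phi> (\<tau> (u + x) - \<tau> u) z) - 1 *\<^sub>R (\<i> * of_real s * p (u + x)) = \<gamma>' x"
            using F_p[OF ux(1,2)] m by (simp add: \<gamma>'_def scaleR_conv_of_real field_simps)
          ultimately show "(\<gamma> has_vector_derivative \<gamma>' x) (at x within {0..T})" by simp
          assume "norm (\<gamma> x - 0) \<le> \<epsilon>'"
          then have g: "norm (\<phi> (\<tau> (u + x) - \<tau> u) z - p (u + x)) \<le> \<epsilon>'" by (simp add: \<gamma>_def)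
          then have cb: "\<phi> (\<tau> (u + x) - \<tau> u) z \<in> cball (p (u + x)) \<eta>"
            using e' by (simp add: dist_norm norm_minus_commute)
          then have "\<phi> (\<tau> (u + x) - \<tau> u) z \<in> U" using ux(3) eta(2) by blast
          \<comment> \<open>As long as the orbit is in \<open>U\<close>, its velocity is given by
            \<open>F\<close>, so the Lipschitz bound controls the velocity relative to
            \<open>p\<close>.\<close>
          then have "G (\<phi> (\<tau> (u + x) - \<tau> u) z) = F (\<phi> (\<tau> (u + x) - \<tau> u) z)"
            using F_eq_G flow_in_disc[OF mon[OF x] z(1)] by metis
          then have "norm (\<gamma>' x) = norm (F (\<phi> (\<tau> (u + x) - \<tau> u) z) - F (p (u + x))) * (1 / m (u + x))"
            using m by (simp add: \<gamma>'_def norm_mult norm_divide)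
          also have "\<dots> \<le> (L * \<epsilon>') * M"
          proof (rule mult_mono)
            show "norm (F (\<phi> (\<tau> (u + x) - \<tau> u) z) - F (p (u + x))) \<le> L * \<epsilon>'"
              using lip[OF ux(3) cb] g L(1) by (meson mult_left_mono less_imp_le order_trans)
          qed (use M(2)[OF ux(3)] m L e' in auto)
          finally show "norm (\<gamma>' x) \<le> L * \<epsilon>' * M" .
        next
          have "L * \<epsilon>' * M * T = (L * M * T) * \<epsilon>'" by simp
          also have "\<dots> \<le> 1 / 2 * \<epsilon>'" using T e' by (intro mult_right_mono) auto
          finally show "norm (\<gamma> 0 - 0) + L * \<epsilon>' * M * T < \<epsilon>'"
            using z flow_0[OF z(1)] by (simp add: \<gamma>_def dist_norm)
        qed (use L M e' T in auto)
        moreover have "L * \<epsilon>' * M * T = (L * M * T) * \<epsilon>'" by simp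
        moreover have "(L * M * T) * \<epsilon>' \<le> 1 / 2 * \<epsilon>'" using T e' by (intro mult_right_mono) auto
        moreover have "norm (\<gamma> 0) < \<epsilon>' / 2"
          using z flow_0[OF z(1)] by (simp add: \<gamma>_def dist_norm)
        moreover have "norm (\<gamma> T) \<le> norm (\<gamma> T - \<gamma> 0) + norm (\<gamma> 0)" by (metis diff_add_cancel norm_triangle_ineq)
        ultimately have "norm (\<gamma> T) < \<epsilon>'" by linarith
        then show ?thesis using e' by (simp add: \<gamma>_def T_def dist_norm)
      qed
      then show "\<forall>\<^sub>F z in at (p u) within disc. dist (\<phi> (\<tau> v - \<tau> u) z) (p v) < \<epsilon>"
        unfolding eventually_at using e' by (intro exI[of _ "\<epsilon>' / 2"]) auto
    qed
  qed
qed

lemma tendsto_flow_compose: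
  assumes "t \<ge> 0" "(\<phi> t \<longlongrightarrow> p v) (at x within disc)" "(f \<longlongrightarrow> l) (at (p v) within disc)"
  shows "((\<lambda>z. f (\<phi> t z)) \<longlongrightarrow> l) (at x within disc)"
proof (rule filterlim_compose[OF assms(3)])
  have "\<phi> t z \<in> disc" "\<phi> t z \<noteq> p v" if "z \<in> disc" for z
    using flow_in_disc[OF assms(1) that] norm_p[of v] by auto
  then show "filterlim (\<phi> t) (at (p v) within disc) (at x within disc)"
    using assms(2) by (auto simp: filterlim_at eventually_at_filter)
qed

lemma tendsto_flow_add:
  assumes "t \<ge> 0" "(\<phi> t \<longlongrightarrow> p v) (at x within disc)" "r \<ge> 0" "(\<phi> r \<longlongrightarrow> l) (at (p v) within disc)"
  shows "(\<phi> (r + t) \<longlongrightarrow> l) (at x within disc)"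
  by (rule Lim_transform_eventually[OF tendsto_flow_compose[OF assms(1,2,4)]])
     (use assms flow_add in \<open>auto simp: eventually_at_filter\<close>)

text \<open>The step length of \<open>flow_step\<close> is uniform on \<open>{u..v}\<close>, so
  finitely many steps lead from \<open>u\<close> to \<open>v\<close>.\<close>

lemma flow_along_arc:
  assumes u: "a < u" and uv: "u \<le> v" and v: "v < b"
  shows "(\<phi> (\<tau> v - \<tau> u) \<longlongrightarrow> p v) (at (p u) within disc)"
proof -
  obtain h where h: "h > 0"
    "\<And>x y. u \<le> x \<Longrightarrow> x \<le> y \<Longrightarrow> y \<le> v \<Longrightarrow> y \<le> x + h \<Longrightarrow>
      (\<phi> (\<tau> y - \<tau> x) \<longlongrightarrow> p y) (at (p x) within disc)"
    using flow_step[OF u uv v] by blast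
  have main: "(\<phi> (\<tau> w - \<tau> u) \<longlongrightarrow> p w) (at (p u) within disc)" if "u \<le> w" "w \<le> v" "w - u \<le> real n * h" for n w
    using that
  proof (induction n arbitrary: w)
    case 0
    then have "w = u" by simp
    then show ?case using h(2)[of u u] h(1) uv by simp
  next
    case (Suc n)
    define x where "x = max u (w - h)"
    have x: "u \<le> x" "x \<le> w" "x \<le> v" "x - u \<le> real n * h" "w \<le> x + h"
      using Suc.prems h(1) by (auto simp: x_def algebra_simps max_def)
    have "(\<phi> ((\<tau> w - \<tau> x) + (\<tau> x - \<tau> u)) \<longlongrightarrow> p w) (at (p u) within disc)"
      by (rule tendsto_flow_add[OF _ Suc.IH _ h(2)]) (use x u v Suc.prems in \<open>auto intro!: tau_le\<close>)
    then show ?case by simp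
  qed
  obtain n :: nat where "v - u < real n * h" using ex_less_of_nat_mult[OF h(1)] by blast
  then show ?thesis using main[of v n] uv by simp
qed

section \<open>Boundary values of the flow at a point of the arc\<close>

lemma disc_filter_nontrivial [simp]: "at (p u) within disc \<noteq> bot"
  by (rule disc_accumulates) simp

text \<open>The limit is taken within the whole disc and not only non-tangentially, so that it can
  be composed with the flow along the arc.\<close>

definition interior_limit :: "real \<Rightarrow> real \<Rightarrow> bool" where
  "interior_limit u t \<longleftrightarrow> (\<exists>\<zeta>\<in>disc. (\<phi> t \<longlongrightarrow> \<zeta>) (at (p u) within disc))"

text \<open>The derivative of \<open>\<phi> t\<close> at \<open>z\<close> is \<open>G (\<phi> t z) / G z\<close>, and \<open>G\<close> is bounded away from zero
  near a contact point; hence \<open>\<phi> t\<close> varies little as long as its values stay in a compact subset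
  of the disc.\<close>

lemma interior_limit_or_inner:
  assumes u: "a < u" "u < b" and t: "t \<ge> 0"
  shows "interior_limit u t \<or> ((\<lambda>z. norm (\<phi> t z)) \<longlongrightarrow> 1) (at (p u) within disc)"
proof (rule disjCI)
  assume "\<not> ((\<lambda>z. norm (\<phi> t z)) \<longlongrightarrow> 1) (at (p u) within disc)"
  then obtain \<epsilon> where eps: "\<epsilon> > 0" "\<exists>\<^sub>F z in at (p u) within disc. \<not> dist (norm (\<phi> t z)) 1 < \<epsilon>"
    unfolding tendsto_iff by (auto simp: not_eventually)
  \<comment> \<open>If the modulus does not tend to one, there are points tending to
    \<open>p u\<close> whose images stay in a smaller disc; a cluster value \<open>\<zeta>\<close>
    of these images is the candidate limit.\<close>
  have "\<exists>z\<in>disc. dist z (p u) < 1 / real (Suc n) \<and> norm (\<phi> t z) \<le> 1 - \<epsilon>" for n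
  proof -
    have "\<forall>\<^sub>F z in at (p u) within disc. z \<in> disc \<and> dist z (p u) < 1 / real (Suc n)"
      unfolding eventually_at by (intro exI[of _ "1 / real (Suc n)"]) auto
    then have "\<exists>\<^sub>F z in at (p u) within disc. (z \<in> disc \<and> dist z (p u) < 1 / real (Suc n)) \<and> \<not> dist (norm (\<phi> t z)) 1 < \<epsilon>"
      by (rule frequently_eventually_conj[OF eps(2)])
    then obtain z where z: "z \<in> disc" "dist z (p u) < 1 / real (Suc n)" "\<not> dist (norm (\<phi> t z)) 1 < \<epsilon>"
      by (auto dest!: frequently_ex)
    moreover have "norm (\<phi> t z) < 1" using flow_in_disc[OF t z(1)] by simp
    ultimately show ?thesis by (auto simp: dist_real_def)
  qed
  then obtain x where x: "\<And>n. x n \<in> disc" "\<And>n. dist (x n) (p u) < 1 / real (Suc n)" "\<And>n. norm (\<phi> t (x n)) \<le> 1 - \<epsilon>"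
    by metis
  have xlim: "x \<longlonglongrightarrow> p u"
    by (rule metric_tendsto_imp_tendsto[OF LIMSEQ_inverse_real_of_nat])
       (use x(2) in \<open>auto simp: inverse_eq_divide intro!: always_eventually less_imp_le\<close>)
  have "\<forall>n. \<phi> t (x n) \<in> cball 0 (1 - \<epsilon>)" using x(3) by simp
  then obtain \<zeta> r where z: "\<zeta> \<in> cball 0 (1 - \<epsilon>)" and r: "strict_mono r" "((\<lambda>n. \<phi> t (x n)) \<circ> r) \<longlonglongrightarrow> \<zeta>"
    using compact_cball[of "0::complex" "1 - \<epsilon>"] unfolding compact_def by meson
  have zd: "\<zeta> \<in> disc" using z eps(1) by auto
  have "(\<phi> t \<longlongrightarrow> \<zeta>) (at (p u) within disc)"
  proof (rule tendstoI)
    fix \<eta>0 :: real assume "\<eta>0 > 0"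
    obtain \<eta>1 where eta1: "\<eta>1 > 0" "cball \<zeta> \<eta>1 \<subseteq> disc" using zd open_contains_cball open_ball by blast
    define \<eta> where "\<eta> = min \<eta>0 \<eta>1"
    have eta: "\<eta> > 0" "cball \<zeta> \<eta> \<subseteq> disc" "\<eta> \<le> \<eta>0" using eta1 \<open>\<eta>0 > 0\<close> by (auto simp: \<eta>_def)
    have "continuous_on (cball \<zeta> \<eta>) G"
      using holomorphic_on_imp_continuous_on[OF generator_holomorphic] eta(2) continuous_on_subset by blast
    then have "bounded (G ` cball \<zeta> \<eta>)" using compact_continuous_image compact_imp_bounded compact_cball by blast
    then obtain C where C: "C > 0" "\<And>z. z \<in> cball \<zeta> \<eta> \<Longrightarrow> norm (G z) \<le> C" by (auto simp: bounded_pos)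
    define \<mu> where "\<mu> = m u / 2"
    have mu: "\<mu> > 0" using m_pos[OF u] by (simp add: \<mu>_def)
    have "isCont F (p u)"
      using holomorphic_on_imp_continuous_on[OF holomorphic_F] p_in_U[OF u] open_U continuous_on_eq_continuous_at by blast
    then have "((\<lambda>z. norm (F z)) \<longlongrightarrow> norm (F (p u))) (at (p u))" by (intro tendsto_norm) (simp add: isCont_def)
    moreover have "norm (F (p u)) > \<mu>"
      using F_p[OF u] s m_pos[OF u] by (auto simp: norm_mult \<mu>_def)
    ultimately have "\<forall>\<^sub>F z in at (p u). norm (F z) > \<mu>" by (rule order_tendstoD(1))
    moreover have "\<forall>\<^sub>F z in at (p u). z \<in> U" using p_in_U[OF u] open_U by (metis eventually_at_in_open')
    ultimately have "\<forall>\<^sub>F z in at (p u). norm (F z) > \<mu> \<and> z \<in> U" by (rule eventually_conj)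
    then obtain \<rho> where rho: "\<rho> > 0" "\<And>z. z \<noteq> p u \<Longrightarrow> dist z (p u) < \<rho> \<Longrightarrow> norm (F z) > \<mu> \<and> z \<in> U"
      unfolding eventually_at by auto
    have Gmu: "norm (G z) > \<mu>" if "z \<in> disc" "dist z (p u) < \<rho>" for z
      using rho(2)[of z] F_eq_G[of z] that norm_p[of u] by (metis less_irrefl mem_ball_0)
    \<comment> \<open>Segments of length at most \<open>2 * \<rho>'\<close> in this neighbourhood
      will move the image under \<open>\<phi> t\<close> by at most
      \<open>\<eta> / 3\<close>.\<close>
    define \<rho>' where "\<rho>' = min \<rho> (\<eta> * \<mu> / (6 * C))"
    have rho': "\<rho>' > 0" "\<rho>' \<le> \<rho>" "C / \<mu> * (2 * \<rho>') \<le> \<eta> / 3"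
    proof -
      show "\<rho>' > 0" "\<rho>' \<le> \<rho>" using rho eta mu C by (auto simp: \<rho>'_def)
      have "C / \<mu> * (2 * \<rho>') \<le> C / \<mu> * (2 * (\<eta> * \<mu> / (6 * C)))"
        using C mu by (intro mult_left_mono) (auto simp: \<rho>'_def)
      also have "\<dots> = \<eta> / 3" using C mu by simp
      finally show "C / \<mu> * (2 * \<rho>') \<le> \<eta> / 3" .
    qed
    have "\<forall>\<^sub>F n in sequentially. dist (((\<lambda>n. \<phi> t (x n)) \<circ> r) n) \<zeta> < \<eta> / 3"
      using tendstoD[OF r(2), of "\<eta> / 3"] eta(1) by simp
    moreover have "(x \<circ> r) \<longlonglongrightarrow> p u" using LIMSEQ_subseq_LIMSEQ[OF xlim r(1)] .
    then have "\<forall>\<^sub>F n in sequentially. dist ((x \<circ> r) n) (p u) < \<rho>'" using rho'(1) by (rule tendstoD)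
    ultimately have "\<forall>\<^sub>F n in sequentially. dist (\<phi> t (x (r n))) \<zeta> < \<eta> / 3 \<and> dist (x (r n)) (p u) < \<rho>'"
      by eventually_elim simp
    then obtain N where N: "\<And>n. n \<ge> N \<Longrightarrow> dist (\<phi> t (x (r n))) \<zeta> < \<eta> / 3 \<and> dist (x (r n)) (p u) < \<rho>'"
      unfolding eventually_sequentially by blast
    define y where "y = x (r N)"
    have y: "y \<in> disc" "dist y (p u) < \<rho>'" "dist (\<phi> t y) \<zeta> < \<eta> / 3"
      using N[of N] x(1) by (auto simp: y_def)
    have "dist (\<phi> t w) \<zeta> < \<eta>0" if w: "w \<in> disc" "dist w (p u) < \<rho>'" for w
    proof -
      \<comment> \<open>The image of the segment from \<open>y\<close> to \<open>w\<close>, which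
        stays in the convex set \<open>disc \<inter> ball (p u) \<rho>'\<close>.\<close>
      define \<gamma> where "\<gamma> = (\<lambda>\<xi>::real. \<phi> t (y + of_real \<xi> * (w - y)))"
      define \<gamma>' where "\<gamma>' = (\<lambda>\<xi>::real. (w - y) * deriv (\<phi> t) (y + of_real \<xi> * (w - y)))"
      have wy: "norm (w - y) \<le> 2 * \<rho>'"
        using w(2) y(2) dist_triangle2[of w y "p u"] by (simp add: dist_norm)
      have mem: "y + of_real \<xi> * (w - y) \<in> disc \<inter> ball (p u) \<rho>'" if "0 \<le> \<xi>" "\<xi> \<le> 1" for \<xi> :: real
      proof -
        have "(1 - \<xi>) *\<^sub>R y + \<xi> *\<^sub>R w \<in> disc \<inter> ball (p u) \<rho>'"
          by (rule convexD[OF convex_Int[OF convex_ball convex_ball]])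
             (use w y that in \<open>auto simp: dist_commute\<close>)
        moreover have "(1 - \<xi>) *\<^sub>R y + \<xi> *\<^sub>R w = y + of_real \<xi> * (w - y)"
          by (simp add: scaleR_conv_of_real algebra_simps)
        ultimately show ?thesis by simp
      qed
      have "norm (\<gamma> 1 - \<gamma> 0) \<le> (C / \<mu> * (2 * \<rho>')) * 1"
      proof (rule vector_derivative_trapped_bound[where \<zeta> = \<zeta> and \<eta> = \<eta> and \<gamma>' = \<gamma>'])
        fix \<xi> :: real assume xi: "0 \<le> \<xi>" "\<xi> \<le> 1"
        define q where "q = y + of_real \<xi> * (w - y)"
        have q: "q \<in> disc" "dist q (p u) < \<rho>" using mem[OF xi] rho' by (auto simp: q_def dist_commute)
        show "(\<gamma> has_vector_derivative \<gamma>' \<xi>) (at \<xi> within {0..1})"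
          unfolding \<gamma>_def \<gamma>'_def
        proof (rule field_vector_diff_chain_within[unfolded o_def, of "\<lambda>\<xi>. y + of_real \<xi> * (w - y)" _ _ _ "\<phi> t"])
          show "((\<lambda>\<xi>::real. y + of_real \<xi> * (w - y)) has_vector_derivative (w - y)) (at \<xi> within {0..1})"
            by (auto intro!: derivative_eq_intros)
          show "(\<phi> t has_field_derivative deriv (\<phi> t) (y + of_real \<xi> * (w - y)))
              (at (y + of_real \<xi> * (w - y)) within (\<lambda>\<xi>::real. y + of_real \<xi> * (w - y)) ` {0..1})"
            using holomorphic_derivI[OF flow_holomorphic[OF t] open_ball q(1)]
            by (simp add: q_def has_field_derivative_at_within)
        qed
        assume "norm (\<gamma> \<xi> - \<zeta>) \<le> \<eta>"
        then have "norm (G (\<phi> t q)) \<le> C" by (intro C) (simp add: \<gamma>_def q_def dist_norm norm_minus_commute)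
        moreover have "deriv (\<phi> t) q * G q = G (\<phi> t q)" by (rule deriv_flow_generator[OF t q(1)])
        ultimately have "norm (deriv (\<phi> t) q) * norm (G q) \<le> C" by (metis norm_mult)
        moreover have "norm (deriv (\<phi> t) q) * \<mu> \<le> norm (deriv (\<phi> t) q) * norm (G q)"
          using Gmu[OF q] by (intro mult_left_mono) auto
        ultimately have "norm (deriv (\<phi> t) q) \<le> C / \<mu>" using mu by (simp add: pos_le_divide_eq)
        then have "norm (w - y) * norm (deriv (\<phi> t) q) \<le> (2 * \<rho>') * (C / \<mu>)"
          using wy rho' by (intro mult_mono) auto
        then show "norm (\<gamma>' \<xi>) \<le> C / \<mu> * (2 * \<rho>')" by (simp add: \<gamma>'_def q_def norm_mult mult.commute)
      next
        show "norm (\<gamma> 0 - \<zeta>) + C / \<mu> * (2 * \<rho>') * 1 < \<eta>"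
          using y(3) rho'(3) eta(1) by (simp add: \<gamma>_def dist_norm)
      qed (use C mu rho' in auto)
      then have "norm (\<phi> t w - \<phi> t y) \<le> \<eta> / 3" using rho'(3) by (simp add: \<gamma>_def)
      then have "dist (\<phi> t w) \<zeta> \<le> \<eta> / 3 + dist (\<phi> t y) \<zeta>"
        using dist_triangle[of "\<phi> t w" \<zeta> "\<phi> t y"] by (simp add: dist_norm)
      then show ?thesis using y(3) eta by linarith
    qed
    then show "\<forall>\<^sub>F w in at (p u) within disc. dist (\<phi> t w) \<zeta> < \<eta>0"
      unfolding eventually_at using rho'(1) by auto
  qed
  then show "interior_limit u t" using zd by (auto simp: interior_limit_def)
qed

lemma tendsto_flow_later:
  assumes "t \<ge> 0" "(\<phi> t \<longlongrightarrow> \<zeta>) (at \<sigma> within disc)" "\<zeta> \<in> disc" "r \<ge> 0"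
  shows "(\<phi> (r + t) \<longlongrightarrow> \<phi> r \<zeta>) (at \<sigma> within disc)"
proof -
  have "((\<lambda>z. \<phi> r (\<phi> t z)) \<longlongrightarrow> \<phi> r \<zeta>) (at \<sigma> within disc)"
    using isCont_flow[OF assms(4,3)] assms(2) by (rule isCont_tendsto_compose)
  then show ?thesis
    by (rule Lim_transform_eventually) (use assms flow_add in \<open>auto simp: eventually_at_filter\<close>)
qed

lemma interior_limit_later: "interior_limit u t \<Longrightarrow> t \<ge> 0 \<Longrightarrow> t \<le> r \<Longrightarrow> interior_limit u r"
  using tendsto_flow_later[of t _ "p u" "r - t"] flow_in_disc[of "r - t"]
  unfolding interior_limit_def by fastforce

text \<open>One direction composes limits. In the other an interior limit cannot be read backwards
  through the flow; but its failure at \<open>p v\<close> means that the modulus tends to one there,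
  and this property does pull back to \<open>p u\<close>.\<close>

lemma interior_limit_shift:
  assumes uv: "a < u" "u \<le> v" "v < b" and t: "t \<ge> 0"
  shows "interior_limit u (t + (\<tau> v - \<tau> u)) \<longleftrightarrow> interior_limit v t"
proof
  have d: "\<tau> v - \<tau> u \<ge> 0" using tau_le[OF uv] by simp
  note lim = flow_along_arc[OF uv]
  show "interior_limit v t \<Longrightarrow> interior_limit u (t + (\<tau> v - \<tau> u))"
    unfolding interior_limit_def using tendsto_flow_add[OF d lim t] by blast
  assume "interior_limit u (t + (\<tau> v - \<tau> u))"
  then obtain \<zeta> where z: "\<zeta> \<in> disc" "(\<phi> (t + (\<tau> v - \<tau> u)) \<longlongrightarrow> \<zeta>) (at (p u) within disc)"
    by (auto simp: interior_limit_def)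
  show "interior_limit v t"
  proof (rule ccontr)
    assume "\<not> ?thesis"
    then have "((\<lambda>z. norm (\<phi> t z)) \<longlongrightarrow> 1) (at (p v) within disc)"
      using interior_limit_or_inner[of v t] uv t by auto
    then have "((\<lambda>z. norm (\<phi> t (\<phi> (\<tau> v - \<tau> u) z))) \<longlongrightarrow> 1) (at (p u) within disc)"
    proof (rule filterlim_compose)
      have "\<phi> (\<tau> v - \<tau> u) z \<in> disc" "\<phi> (\<tau> v - \<tau> u) z \<noteq> p v" if "z \<in> disc" for z
        using flow_in_disc[OF d that] norm_p[of v] by auto
      then show "filterlim (\<phi> (\<tau> v - \<tau> u)) (at (p v) within disc) (at (p u) within disc)"
        using lim by (auto simp: filterlim_at eventually_at_filter)
    qed
    then have "((\<lambda>z. norm (\<phi> (t + (\<tau> v - \<tau> u)) z)) \<longlongrightarrow> 1) (at (p u) within disc)"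
      by (rule Lim_transform_eventually) (use d t flow_add in \<open>auto simp: eventually_at_filter\<close>)
    moreover have "((\<lambda>z. norm (\<phi> (t + (\<tau> v - \<tau> u)) z)) \<longlongrightarrow> norm \<zeta>) (at (p u) within disc)"
      by (intro tendsto_norm z)
    ultimately have "norm \<zeta> = 1" using tendsto_unique[OF disc_filter_nontrivial] by blast
    then show False using z(1) by simp
  qed
qed

lemma not_interior_limit_before:
  assumes "a < u" "u \<le> v" "v < b"
  shows "\<not> interior_limit u (\<tau> v - \<tau> u)"
proof
  assume "interior_limit u (\<tau> v - \<tau> u)"
  then obtain \<zeta> where z: "\<zeta> \<in> disc" "(\<phi> (\<tau> v - \<tau> u) \<longlongrightarrow> \<zeta>) (at (p u) within disc)"
    by (auto simp: interior_limit_def)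
  then have "\<zeta> = p v" using flow_along_arc[OF assms] tendsto_unique[OF disc_filter_nontrivial] by blast
  then show False using z(1) by simp
qed

text \<open>Moving along the arc preserves the clock reading \<open>t + \<tau> u\<close>, and
  interior limits persist in time. So a single boundary value at \<open>u0\<close> that is not
  interior has consequences at every point of the arc whose clock shows no later time.\<close>

lemma not_interior_limit_transport:
  assumes u0: "a < u0" "u0 < b" and T0: "T0 \<ge> 0" "\<not> interior_limit u0 T0"
    and u: "a < u" "u < b" and t: "t \<ge> 0" "t + \<tau> u \<le> T0 + \<tau> u0"
  shows "\<not> interior_limit u t"
proof
  assume int: "interior_limit u t"
  show False
  proof (cases "u \<le> u0")
    case True
    show ?thesis
    proof (cases "t < \<tau> u0 - \<tau> u")
      case True
      then obtain w where w: "u \<le> w" "w \<le> u0" "\<tau> w = t + \<tau> u"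
        using tau_IVT[of u u0 "t + \<tau> u"] u u0 \<open>u \<le> u0\<close> t by auto
      then show ?thesis using not_interior_limit_before[of u w] u u0 int by auto
    next
      case False
      then have "interior_limit u0 (t - (\<tau> u0 - \<tau> u))"
        using interior_limit_shift[of u u0 "t - (\<tau> u0 - \<tau> u)"] int u u0 True by simp
      then show ?thesis using interior_limit_later[of u0 "t - (\<tau> u0 - \<tau> u)" T0] T0 t False by simp
    qed
  next
    case False
    then have "interior_limit u0 (t + (\<tau> u - \<tau> u0))"
      using interior_limit_shift[of u0 u t] int u u0 t by simp
    moreover have "t + (\<tau> u - \<tau> u0) \<ge> 0" using tau_le[of u0 u] u0 u t False by simp
    ultimately show ?thesis using interior_limit_later[of u0 "t + (\<tau> u - \<tau> u0)" T0] T0 t by simp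
  qed
qed

text \<open>A total inverse of \<open>\<tau>\<close>, meaningful only on the image of
  \<open>{a<..<b}\<close>.\<close>

definition tau_inv :: "real \<Rightarrow> real" where
  "tau_inv r = (THE w. a < w \<and> w < b \<and> \<tau> w = r)"

lemma tau_inv_tau: "a < w \<Longrightarrow> w < b \<Longrightarrow> tau_inv (\<tau> w) = w"
  unfolding tau_inv_def by (rule the_equality) (auto, metis less_irrefl linorder_neqE tau_less)

lemma tau_inv:
  assumes "a < u" "v < b" "\<tau> u \<le> r" "r \<le> \<tau> v" "u \<le> v"
  shows "u \<le> tau_inv r" "tau_inv r \<le> v" "\<tau> (tau_inv r) = r"
proof -
  obtain w where "u \<le> w" "w \<le> v" "\<tau> w = r" using tau_IVT assms by blast
  then show "u \<le> tau_inv r" "tau_inv r \<le> v" "\<tau> (tau_inv r) = r" using tau_inv_tau[of w] assms by auto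
qed

lemma tau_inv_tendsto:
  assumes w: "a < w" "w < b" and f: "(f \<longlongrightarrow> \<tau> w) L"
  shows "((\<lambda>x. tau_inv (f x)) \<longlongrightarrow> w) L"
proof (rule order_tendstoI)
  fix c assume c: "c < w"
  define c' where "c' = (max a c + w) / 2"
  define d where "d = (w + b) / 2"
  have cd: "a < c'" "c < c'" "c' < w" "w < d" "d < b" using c w by (auto simp: c'_def d_def max_def)
  have "\<forall>\<^sub>F x in L. \<tau> c' < f x" "\<forall>\<^sub>F x in L. f x < \<tau> d"
    using order_tendstoD[OF f] tau_less cd w by auto
  then show "\<forall>\<^sub>F x in L. c < tau_inv (f x)"
    by eventually_elim (use tau_inv(1)[of c' d] cd in \<open>auto intro: less_le_trans\<close>)
next
  fix c assume c: "w < c"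
  define c' where "c' = (min b c + w) / 2"
  define d where "d = (w + a) / 2"
  have cd: "c' < b" "c' < c" "w < c'" "d < w" "a < d" using c w by (auto simp: c'_def d_def min_def)
  have "\<forall>\<^sub>F x in L. \<tau> d < f x" "\<forall>\<^sub>F x in L. f x < \<tau> c'"
    using order_tendstoD[OF f] tau_less cd w by auto
  then show "\<forall>\<^sub>F x in L. tau_inv (f x) < c"
  proof eventually_elim
    case (elim x)
    then have "tau_inv (f x) \<le> c'" using tau_inv(2)[of d c' "f x"] cd by auto
    then show ?case using cd by simp
  qed
qed

lemma flow_limit_arc:
  assumes "a < u" "t \<ge> 0" "u \<le> v" "v < b" "\<tau> u + t \<le> \<tau> v"
  shows "(\<phi> t \<longlongrightarrow> p (tau_inv (\<tau> u + t))) (at (p u) within disc)"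
  using flow_along_arc[of u "tau_inv (\<tau> u + t)"] tau_inv[of u v "\<tau> u + t"] assms by simp

end

section \<open>Contact points\<close>

text \<open>Tangency is only required at \<open>\<sigma>\<close> itself: an open arc is a contact arc if and only if all of its
  points are contact points.\<close>

definition contact_point :: "(complex \<Rightarrow> complex) \<Rightarrow> complex \<Rightarrow> bool" where
  "contact_point G \<sigma> \<longleftrightarrow> (\<exists>r>0. \<exists>f. f holomorphic_on ball \<sigma> r \<and> (\<forall>z\<in>ball \<sigma> r \<inter> disc. f z = G z) \<and>
     Re (cnj \<sigma> * f \<sigma>) = 0 \<and> f \<sigma> \<noteq> 0)"

text \<open>The projection onto the closed unit disc does not increase distances and fixes both
  centres, so the projected point is still in both balls; their open intersection then also contains
  points of the open disc.\<close>

lemma balls_centred_on_circle_meet_disc: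
  fixes \<sigma>1 \<sigma>2 z :: complex
  assumes "norm \<sigma>1 \<le> 1" "norm \<sigma>2 \<le> 1" "z \<in> ball \<sigma>1 r1 \<inter> ball \<sigma>2 r2"
  shows "ball \<sigma>1 r1 \<inter> ball \<sigma>2 r2 \<inter> disc \<noteq> {}"
proof -
  define P where "P = closest_point (cball 0 1) z"
  have "dist \<sigma> P \<le> dist \<sigma> z" if "norm \<sigma> \<le> 1" for \<sigma>
    using closest_point_lipschitz[of "cball 0 1" \<sigma> z] closest_point_self[of \<sigma> "cball 0 1"] that
    by (simp add: P_def)
  then have "P \<in> ball \<sigma>1 r1 \<inter> ball \<sigma>2 r2" using assms by (auto intro: le_less_trans)
  moreover have "P \<in> closure disc" using closest_point_in_set[of "cball 0 1" z] by (simp add: P_def)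
  moreover have "open (ball \<sigma>1 r1 \<inter> ball \<sigma>2 r2)" by auto
  ultimately show ?thesis using open_Int_closure_eq_empty by blast
qed

text \<open>The local extensions agree where their balls overlap: the overlap is convex and meets
  the disc, where both equal \<open>G\<close>.\<close>

lemma contact_points_extension:
  assumes holG: "G holomorphic_on disc" and S: "S \<subseteq> sphere 0 1"
    and cp: "\<And>\<sigma>. \<sigma> \<in> S \<Longrightarrow> contact_point G \<sigma>"
  obtains F U where "open U" "S \<subseteq> U" "F holomorphic_on disc \<union> U" "\<And>z. z \<in> disc \<Longrightarrow> F z = G z"
    "\<And>\<sigma>. \<sigma> \<in> S \<Longrightarrow> Re (cnj \<sigma> * F \<sigma>) = 0 \<and> F \<sigma> \<noteq> 0"
proof -
  obtain r f where rf: "\<And>\<sigma>. \<sigma> \<in> S \<Longrightarrow> r \<sigma> > 0 \<and> f \<sigma> holomorphic_on ball \<sigma> (r \<sigma>) \<and>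
      (\<forall>z\<in>ball \<sigma> (r \<sigma>) \<inter> disc. f \<sigma> z = G z) \<and> Re (cnj \<sigma> * f \<sigma> \<sigma>) = 0 \<and> f \<sigma> \<sigma> \<noteq> 0"
    using cp unfolding contact_point_def by metis
  define U where "U = (\<Union>\<sigma>\<in>S. ball \<sigma> (r \<sigma>))"
  \<comment> \<open>Outside the disc an arbitrary ball containing the point is chosen;
    \<open>agree\<close> makes the value independent of this choice.\<close>
  define F where "F = (\<lambda>z. if z \<in> disc then G z else f (SOME \<sigma>. \<sigma> \<in> S \<and> z \<in> ball \<sigma> (r \<sigma>)) z)"
  have agree: "f \<sigma>1 z = f \<sigma>2 z"
    if s: "\<sigma>1 \<in> S" "\<sigma>2 \<in> S" and z: "z \<in> ball \<sigma>1 (r \<sigma>1) \<inter> ball \<sigma>2 (r \<sigma>2)" for \<sigma>1 \<sigma>2 z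
  proof (rule analytic_continuation_open[where s = "ball \<sigma>1 (r \<sigma>1) \<inter> ball \<sigma>2 (r \<sigma>2) \<inter> disc"
        and s' = "ball \<sigma>1 (r \<sigma>1) \<inter> ball \<sigma>2 (r \<sigma>2)" and f = "f \<sigma>1" and g = "f \<sigma>2"])
    show "ball \<sigma>1 (r \<sigma>1) \<inter> ball \<sigma>2 (r \<sigma>2) \<inter> disc \<noteq> {}"
      by (rule balls_centred_on_circle_meet_disc[OF _ _ z]) (use s S in auto)
    show "connected (ball \<sigma>1 (r \<sigma>1) \<inter> ball \<sigma>2 (r \<sigma>2))"
      by (intro convex_connected convex_Int convex_ball)
    show "f \<sigma>1 holomorphic_on ball \<sigma>1 (r \<sigma>1) \<inter> ball \<sigma>2 (r \<sigma>2)"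
      "f \<sigma>2 holomorphic_on ball \<sigma>1 (r \<sigma>1) \<inter> ball \<sigma>2 (r \<sigma>2)"
      using rf s by (meson holomorphic_on_subset inf_le1 inf_le2)+
    show "f \<sigma>1 w = f \<sigma>2 w" if "w \<in> ball \<sigma>1 (r \<sigma>1) \<inter> ball \<sigma>2 (r \<sigma>2) \<inter> disc" for w
      using rf[OF s(1)] rf[OF s(2)] that by simp
  qed (use z in auto)
  have Ff: "F z = f \<sigma> z" if s: "\<sigma> \<in> S" and z: "z \<in> ball \<sigma> (r \<sigma>)" for \<sigma> z
  proof (cases "z \<in> disc")
    case True
    then show ?thesis using rf[OF s] z by (simp add: F_def)
  next
    case False
    define \<sigma>' where "\<sigma>' = (SOME \<sigma>. \<sigma> \<in> S \<and> z \<in> ball \<sigma> (r \<sigma>))"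
    have "\<sigma>' \<in> S \<and> z \<in> ball \<sigma>' (r \<sigma>')" unfolding \<sigma>'_def by (rule someI[of _ \<sigma>]) (use s z in simp)
    then have "f \<sigma>' z = f \<sigma> z" using agree[of \<sigma>' \<sigma> z] s z by blast
    then show ?thesis using False by (simp add: F_def \<sigma>'_def)
  qed
  show thesis
  proof (rule that[of U F])
    show "open U" by (auto simp: U_def)
    show "S \<subseteq> U" using rf by (force simp: U_def)
    have "F holomorphic_on U"
      unfolding U_def
    proof (rule holomorphic_on_UN_open)
      fix \<sigma> assume s: "\<sigma> \<in> S"
      show "F holomorphic_on ball \<sigma> (r \<sigma>)"
        by (rule holomorphic_transform[of "f \<sigma>"]) (use rf[OF s] Ff[OF s] in auto)
    qed auto
    moreover have "F holomorphic_on disc"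
      by (rule holomorphic_transform[OF holG]) (simp add: F_def)
    ultimately show "F holomorphic_on disc \<union> U"
      using \<open>open U\<close> by (intro holomorphic_on_Un) auto
    show "F z = G z" if "z \<in> disc" for z using that by (simp add: F_def)
    show "Re (cnj \<sigma> * F \<sigma>) = 0 \<and> F \<sigma> \<noteq> 0" if "\<sigma> \<in> S" for \<sigma>
      using rf[OF that] Ff[OF that, of \<sigma>] by simp
  qed
qed

lemma contact_points_of_extension:
  assumes U: "open U" and F: "F holomorphic_on U" "\<And>z. z \<in> disc \<inter> U \<Longrightarrow> F z = G z"
    and s: "\<sigma> \<in> U" "Re (cnj \<sigma> * F \<sigma>) = 0" "F \<sigma> \<noteq> 0"
  shows "contact_point G \<sigma>"
proof -
  obtain r where r: "r > 0" "ball \<sigma> r \<subseteq> U" using U s(1) openE by blast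
  have "F holomorphic_on ball \<sigma> r" using F(1) r(2) by (rule holomorphic_on_subset)
  moreover have "\<forall>z\<in>ball \<sigma> r \<inter> disc. F z = G z" using F(2) r(2) by blast
  ultimately show ?thesis unfolding contact_point_def using r(1) s by blast
qed

text \<open>Differentiate the constant inner product of \<open>K x\<close> with itself along the
  real axis.\<close>

lemma unimodular_deriv_tangent:
  assumes K: "K holomorphic_on ball 0 \<rho>" and K1: "\<And>x. \<bar>x\<bar> < \<rho> \<Longrightarrow> norm (K (of_real x)) = 1" and x: "\<bar>x\<bar> < \<rho>"
  shows "Re (cnj (K (of_real x)) * deriv K (of_real x)) = 0"
proof -
  have "(K has_field_derivative deriv K (of_real x)) (at (of_real x))"
    using holomorphic_derivI[OF K open_ball] x by simp
  then have "((\<lambda>t. K (of_real t)) has_vector_derivative deriv K (of_real x)) (at x)"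
    by (rule has_vector_derivative_real_field)
  then have "((\<lambda>t. K (of_real t) \<bullet> K (of_real t)) has_vector_derivative
      K (of_real x) \<bullet> deriv K (of_real x) + deriv K (of_real x) \<bullet> K (of_real x)) (at x)"
    by (intro bounded_bilinear.has_vector_derivative[OF bounded_bilinear_inner])
  moreover have "((\<lambda>t. K (of_real t) \<bullet> K (of_real t)) has_vector_derivative 0) (at x)"
  proof (rule has_vector_derivative_transform_within_open[of "\<lambda>_. 1" 0 x "{-\<rho><..<\<rho>}"])
    fix t assume "t \<in> {- \<rho><..<\<rho>}"
    then have "norm (K (of_real t)) = 1" by (intro K1) auto
    then show "1 = K (of_real t) \<bullet> K (of_real t)" by (simp add: dot_square_norm)
  qed (use x in auto)
  ultimately have "K (of_real x) \<bullet> deriv K (of_real x) + deriv K (of_real x) \<bullet> K (of_real x) = 0"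
    by (rule vector_derivative_unique_at)
  then have "K (of_real x) \<bullet> deriv K (of_real x) = 0" by (simp add: inner_commute)
  then show ?thesis by (simp add: inner_complex_def)
qed

text \<open>The field \<open>f\<close>, pushed forward by the boundary chart \<open>K\<close>, extends \<open>G\<close> across the circle near \<open>K 0\<close>.\<close>

lemma contact_points_pushforward:
  assumes rho: "\<rho> > 0" and K: "K holomorphic_on ball 0 \<rho>" and K1: "\<And>x. \<bar>x\<bar> < \<rho> \<Longrightarrow> norm (K (of_real x)) = 1"
    and Kd: "K ` upper_half_disc 0 \<rho> \<subseteq> disc" and K': "deriv K 0 \<noteq> 0"
    and f: "f holomorphic_on ball 0 \<rho>" and fr: "\<And>x. \<bar>x\<bar> < \<rho> \<Longrightarrow> f (of_real x) = of_real (g x) \<and> g x \<noteq> 0"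
    and GK: "\<And>w. w \<in> upper_half_disc 0 \<rho> \<Longrightarrow> G (K w) = deriv K w * f w"
  obtains r where "r > 0" "\<And>z. z \<in> ball (K 0) r \<Longrightarrow> norm z = 1 \<Longrightarrow> contact_point G z"
proof -
  have 0: "(0::complex) \<in> ball 0 \<rho>" using rho by simp
  obtain \<rho>1 where rho1: "\<rho>1 > 0" "ball 0 \<rho>1 \<subseteq> (ball 0 \<rho> :: complex set)" "inj_on K (ball 0 \<rho>1)"
    by (rule has_complex_derivative_locally_injective[OF K 0 open_ball K'], rule that)
  define S where "S = (ball 0 \<rho>1 :: complex set)"
  have sub: "S \<subseteq> ball 0 \<rho>" and inj: "inj_on K S" and K0S: "0 \<in> S" and openS: "open S"
    using rho1 by (auto simp: S_def)
  have KS: "K holomorphic_on S" using K sub by (rule holomorphic_on_subset)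
  obtain h where h: "h holomorphic_on K ` S" "\<And>z. z \<in> S \<Longrightarrow> h (K z) = z"
    by (rule holomorphic_has_inverse[OF KS openS inj], rule that)
  have openW: "open (K ` S)" by (rule open_mapping_thm3[OF KS openS inj])
  obtain r where r: "r > 0" "ball (K 0) r \<subseteq> K ` S" using openW K0S openE by blast
  have hS: "h z \<in> S" "K (h z) = z" if z: "z \<in> ball (K 0) r" for z
  proof -
    obtain w where "w \<in> S" "z = K w" using r(2) z by blast
    then show "h z \<in> S" "K (h z) = z" using h(2) by simp_all
  qed
  have conth: "continuous_on (ball (K 0) r) h"
    using holomorphic_on_imp_continuous_on[OF h(1)] r(2) by (rule continuous_on_subset)
  have real_pt: "norm z = 1" if z: "z \<in> ball (K 0) r" "Im (h z) = 0" for z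
  proof -
    have "h z = of_real (Re (h z))" using z(2) by (simp add: complex_eq_iff)
    moreover have "\<bar>Re (h z)\<bar> < \<rho>" using hS(1)[OF z(1)] sub abs_Re_le_cmod[of "h z"] by force
    ultimately show ?thesis using K1[of "Re (h z)"] hS(2)[OF z(1)] by metis
  qed
  have "isCont K 0" using K rho holomorphic_on_imp_continuous_on continuous_on_eq_continuous_at
    by (metis centre_in_ball open_ball)
  then have "\<exists>d>0. \<forall>w. dist w 0 < d \<longrightarrow> dist (K w) (K 0) < r" using r(1) by (simp add: continuous_at_eps_delta)
  then obtain d where d: "d > 0" "\<And>w. norm w < d \<Longrightarrow> dist (K w) (K 0) < r" by auto
  obtain y1 where y1: "0 < y1" "y1 < d" "y1 < \<rho>1" using d(1) rho1(1) by (meson field_lbound_gt_zero)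
  define w1 where "w1 = \<i> * of_real y1"
  have w1: "norm w1 < d" "w1 \<in> S" "Im w1 > 0"
    using y1 by (simp_all add: w1_def S_def norm_mult)
  have "w1 \<in> upper_half_disc 0 \<rho>" using w1 sub by blast
  then have "K w1 \<in> disc" using Kd by blast
  then have Kw1: "K w1 \<in> ball (K 0) r \<inter> disc" using d(2)[OF w1(1)] by (simp add: dist_commute)
  \<comment> \<open>\<open>Im (h z)\<close> has no zero on the convex set
    \<open>ball (K 0) r \<inter> disc\<close>, because \<open>K\<close> maps real points to the
    circle; being positive at \<open>K w1\<close>, it is positive throughout.\<close>
  have up: "Im (h z) > 0" if z: "z \<in> ball (K 0) r \<inter> disc" for z
  proof (rule ccontr)
    assume "\<not> ?thesis"
    then have le: "Im (h z) \<le> 0" by simp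
    have "connected ((\<lambda>z. Im (h z)) ` (ball (K 0) r \<inter> disc))"
    proof (rule connected_continuous_image)
      show "continuous_on (ball (K 0) r \<inter> disc) (\<lambda>z. Im (h z))"
        by (intro continuous_intros continuous_on_subset[OF conth]) auto
      show "connected (ball (K 0) r \<inter> disc)" by (intro convex_connected convex_Int convex_ball)
    qed
    moreover have "Im (h z) \<in> (\<lambda>z. Im (h z)) ` (ball (K 0) r \<inter> disc)"
      "Im w1 \<in> (\<lambda>z. Im (h z)) ` (ball (K 0) r \<inter> disc)"
      using z Kw1 h(2)[OF w1(2)] by (auto intro!: image_eqI[of "Im w1" _ "K w1"])
    ultimately have "0 \<in> (\<lambda>z. Im (h z)) ` (ball (K 0) r \<inter> disc)"
      using connectedD_interval[of _ "Im (h z)" "Im w1" 0] le w1(3) by auto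
    then obtain z0 where "z0 \<in> ball (K 0) r \<inter> disc" "Im (h z0) = 0" by auto
    then show False using real_pt[of z0] by simp
  qed
  define F where "F = (\<lambda>z. deriv K (h z) * f (h z))"
  have holF: "F holomorphic_on ball (K 0) r"
  proof -
    have "deriv K \<circ> h holomorphic_on ball (K 0) r"
      by (rule holomorphic_on_compose_gen[OF holomorphic_on_subset[OF h(1) r(2)] holomorphic_deriv[OF K open_ball]])
         (use hS sub in blast)
    moreover have "f \<circ> h holomorphic_on ball (K 0) r"
      by (rule holomorphic_on_compose_gen[OF holomorphic_on_subset[OF h(1) r(2)] f]) (use hS sub in blast)
    ultimately show ?thesis unfolding F_def by (auto simp: o_def intro: holomorphic_on_mult)
  qed
  have FG: "F z = G z" if z: "z \<in> disc \<inter> ball (K 0) r" for z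
    using GK[of "h z"] up[of z] hS[of z] sub z by (auto simp: F_def)
  show thesis
  proof (rule that[OF r(1)])
    fix z assume z: "z \<in> ball (K 0) r" "norm z = 1"
    have nb: "at z within disc \<noteq> bot" by (rule disc_accumulates[OF z(2)])
    have "isCont h z" using conth z(1) continuous_on_eq_continuous_at open_ball by blast
    \<comment> \<open>A point of the circle is a limit of points of the disc, so
      \<open>Im (h z)\<close> is not negative; it is not positive either, as \<open>K\<close> maps
      the upper half disc into the open disc.\<close>
    then have "((\<lambda>y. Im (h y)) \<longlongrightarrow> Im (h z)) (at z within disc)"
      by (intro tendsto_Im) (simp add: continuous_at_imp_continuous_at_within continuous_within[symmetric])
    moreover have "\<forall>\<^sub>F y in at z within disc. Im (h y) \<ge> 0"
    proof -
      have "\<forall>\<^sub>F y in at z. y \<in> ball (K 0) r" using z(1) by (intro eventually_at_in_open') auto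
      then show ?thesis unfolding eventually_at_filter by eventually_elim (use up less_imp_le in blast)
    qed
    ultimately have "Im (h z) \<ge> 0" using nb by (intro tendsto_lowerbound)
    moreover have "\<not> Im (h z) > 0"
    proof
      assume "Im (h z) > 0"
      then have "h z \<in> upper_half_disc 0 \<rho>" using hS(1)[OF z(1)] sub by blast
      then have "K (h z) \<in> disc" using Kd by blast
      then show False using hS[OF z(1)] z(2) by simp
    qed
    ultimately have im0: "Im (h z) = 0" by simp
    define x where "x = Re (h z)"
    have hx: "h z = of_real x" using im0 by (simp add: x_def complex_eq_iff)
    have xr: "\<bar>x\<bar> < \<rho>" using hS(1)[OF z(1)] sub abs_Re_le_cmod[of "h z"] unfolding x_def by force
    have "deriv K (h z) \<noteq> 0" by (rule holomorphic_injective_imp_regular[OF KS openS inj hS(1)[OF z(1)]])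
    then have F0: "F z \<noteq> 0" using fr[OF xr] by (simp add: F_def hx)
    \<comment> \<open>On the real axis \<open>f\<close> is real, so \<open>F\<close> is a real
      multiple of the tangent vector \<open>deriv K\<close>.\<close>
    have "cnj z * F z = (cnj (K (of_real x)) * deriv K (of_real x)) * of_real (g x)"
      using fr[OF xr] hS(2)[OF z(1)] by (simp add: F_def hx)
    then have "Re (cnj z * F z) = Re (cnj (K (of_real x)) * deriv K (of_real x)) * g x"
      by (simp only: Re_complex_of_real Im_complex_of_real times_complex.sel mult_zero_right diff_zero)
    then have "Re (cnj z * F z) = 0" using unimodular_deriv_tangent[OF K K1 xr] by simp
    then show "contact_point G z"
      using contact_points_of_extension[OF open_ball holF FG z(1)] F0 by blast
  qed
qed

context contact_flow
begin

text \<open>A relation instead of \<open>Sup\<close>, whose value says nothing when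
  \<open>\<tau>\<close> is unbounded. The bound is strict because \<open>\<tau>\<close> is strictly
  increasing on an open interval; the second clause also forces \<open>{a<..<b}\<close> to be
  nonempty.\<close>

definition tau_sup :: "real \<Rightarrow> bool" where
  "tau_sup \<beta> \<longleftrightarrow> (\<forall>u. a < u \<and> u < b \<longrightarrow> \<tau> u < \<beta>) \<and> (\<forall>r<\<beta>. \<exists>u. a < u \<and> u < b \<and> r < \<tau> u)"

lemma tau_sup_ex:
  assumes ab: "a < b" and bd: "\<And>u. a < u \<Longrightarrow> u < b \<Longrightarrow> \<tau> u \<le> B"
  obtains \<beta> where "tau_sup \<beta>"
proof
  define \<beta> where "\<beta> = Sup (\<tau> ` {a<..<b})"
  have bdd: "bdd_above (\<tau> ` {a<..<b})" using bd by (auto intro!: bdd_aboveI2)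
  have "\<tau> u < \<beta>" if u: "a < u" "u < b" for u
  proof -
    have "\<tau> u < \<tau> ((u + b) / 2)" using u by (intro tau_less) auto
    also have "\<dots> \<le> \<beta>" unfolding \<beta>_def using u by (intro cSUP_upper bdd) auto
    finally show ?thesis .
  qed
  moreover have "\<exists>u. a < u \<and> u < b \<and> r < \<tau> u" if "r < \<beta>" for r
    using that less_cSUP_iff[OF _ bdd, of r] ab unfolding \<beta>_def by force
  ultimately show "tau_sup \<beta>" by (simp add: tau_sup_def)
qed

lemma tau_inv_tendsto_sup:
  assumes beta: "tau_sup \<beta>" and f: "(f \<longlongrightarrow> \<beta>) L" and lt: "\<forall>\<^sub>F x in L. f x < \<beta>"
  shows "((\<lambda>x. tau_inv (f x)) \<longlongrightarrow> b) L"
proof -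
  have near: "\<forall>\<^sub>F x in L. c \<le> tau_inv (f x) \<and> tau_inv (f x) < b" if c: "a < c" "c < b" for c
  proof -
    have "\<tau> c < \<beta>" using beta c by (simp add: tau_sup_def)
    then have "\<forall>\<^sub>F x in L. \<tau> c < f x" using f order_tendstoD(1) by blast
    with lt show ?thesis
    proof eventually_elim
      case (elim x)
      obtain v where v: "a < v" "v < b" "f x < \<tau> v" using beta elim by (auto simp: tau_sup_def)
      have "c \<le> v" using tau_le[of v c] v c elim by (meson less_le_trans less_trans not_less le_less_linear less_imp_le)
      then show ?case using tau_inv(1,2)[of c v "f x"] v c elim by auto
    qed
  qed
  obtain u where u: "a < u" "u < b" using beta unfolding tau_sup_def by (meson lt_ex)
  show ?thesis
  proof (rule order_tendstoI)
    fix c assume c: "c < b"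
    have "\<forall>\<^sub>F x in L. (max c u + b) / 2 \<le> tau_inv (f x) \<and> tau_inv (f x) < b"
      using c u by (intro near) (auto simp: max_def)
    then show "\<forall>\<^sub>F x in L. c < tau_inv (f x)" by eventually_elim (use c in \<open>auto simp: max_def split: if_splits\<close>)
  next
    fix c assume "b < c"
    then show "\<forall>\<^sub>F x in L. tau_inv (f x) < c" using near[OF u] by (auto elim: eventually_mono)
  qed
qed

text \<open>If \<open>\<phi> T0\<close> were still inner at \<open>p u0\<close> although \<open>p u0\<close> has flowed past the end of the arc, then
  at the time of arrival the flow maps a neighbourhood of \<open>p u0\<close> biholomorphically onto one of \<open>p b\<close>,
  and transports \<open>F\<close> there.\<close>

lemma contact_points_near_end:
  assumes beta: "tau_sup \<beta>" and u0: "a < u0" "u0 < b" and T0: "T0 \<ge> 0" "\<not> interior_limit u0 T0"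
    and late: "\<beta> < T0 + \<tau> u0"
  obtains r where "r > 0" "\<And>z. z \<in> ball (p b) r \<Longrightarrow> norm z = 1 \<Longrightarrow> contact_point G z"
proof -
  have ss: "s * s = 1" "\<bar>s\<bar> = 1" using s by auto
  \<comment> \<open>The time at which \<open>p u0\<close> reaches the end of the arc.\<close>
  define T where "T = \<beta> - \<tau> u0"
  have T: "T > 0" using beta u0 by (simp add: T_def tau_sup_def)
  \<comment> \<open>A chart that maps the upper half plane into the disc and the real axis to the
    circle, with \<open>p u0\<close> as the image of the origin. It runs counterclockwise, so the
    arc parameter belonging to a real \<open>x\<close> is \<open>u0 + s * x\<close>.\<close>
  define E where "E = (\<lambda>w. p u0 * exp (\<i> * w))"
  have E_norm: "norm (E w) = exp (- Im w)" for w by (simp add: E_def norm_mult)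
  have E_real: "E (of_real x) = p (u0 + s * x)" for x
  proof -
    have "E (of_real x) = cis (s * u0) * cis x" by (simp add: E_def p_def cis_conv_exp)
    also have "\<dots> = cis (s * u0 + s * s * x)" by (simp add: cis_mult ss)
    finally show ?thesis by (simp add: p_def algebra_simps)
  qed
  have E_deriv: "(E has_field_derivative \<i> * E w) (at w)" for w
    unfolding E_def by (auto intro!: derivative_eq_intros)
  have E_hol: "E holomorphic_on X" for X unfolding E_def by (intro holomorphic_intros)
  have E_cont: "isCont E w" for w using E_deriv DERIV_isCont by blast
  have "E 0 \<in> U" using E_real[of 0] p_in_U[OF u0] by simp
  then have "\<forall>\<^sub>F w in nhds 0. E w \<in> U"
    using E_cont[of 0] open_U by (metis topological_tendstoD tendsto_nhds_iff isCont_def)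
  then obtain r1 where r1: "r1 > 0" "\<And>w. norm w < r1 \<Longrightarrow> E w \<in> U"
    unfolding eventually_nhds_metric by auto
  \<comment> \<open>The margin in \<open>late\<close> keeps time \<open>T\<close> admissible for
    \<open>not_interior_limit_transport\<close> also slightly beyond \<open>u0\<close>, where the
    flow along the arc gives no information.\<close>
  have "((\<lambda>u. T + \<tau> u) \<longlongrightarrow> T + \<tau> u0) (at u0)"
    using isCont_tau[OF u0] by (intro tendsto_intros) (simp add: isCont_def)
  then have "\<forall>\<^sub>F u in at u0. T + \<tau> u < T0 + \<tau> u0" using late by (intro order_tendstoD(2)) (auto simp: T_def)
  then obtain r3 where r3: "r3 > 0" "\<And>u. u \<noteq> u0 \<Longrightarrow> dist u u0 < r3 \<Longrightarrow> T + \<tau> u < T0 + \<tau> u0"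
    unfolding eventually_at by auto
  define r where "r = Min {r1, u0 - a, b - u0, r3}"
  have r: "r > 0" "r \<le> r1" "r \<le> u0 - a" "r \<le> b - u0" "r \<le> r3" using r1 r3 u0 by (auto simp: r_def)
  have near: "a < u \<and> u < b \<and> T + \<tau> u \<le> T0 + \<tau> u0" if "\<bar>u - u0\<bar> < r" for u
    using that r r3(2)[of u] late by (cases "u = u0") (auto simp: T_def dist_real_def)
  define k where "k = (\<lambda>w. \<phi> T (E w))"
  have E_disc: "E w \<in> disc" if "w \<in> upper_half_disc 0 \<rho>" for w \<rho> using that by (simp add: E_norm)
  have E_lim: "filterlim E (at (p (u0 + s * x)) within disc) (at (of_real x) within upper_half_disc 0 \<rho>)" for x \<rho>
  proof -
    have "(E \<longlongrightarrow> p (u0 + s * x)) (at (of_real x) within upper_half_disc 0 \<rho>)"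
      using E_cont[of "of_real x"] E_real[of x]
      by (metis continuous_at_imp_continuous_at_within continuous_within)
    moreover have "E w \<in> disc \<and> E w \<noteq> p (u0 + s * x)" if "w \<in> upper_half_disc 0 \<rho>" for w
      using E_disc[OF that] norm_p[of "u0 + s * x"] by auto
    ultimately show ?thesis by (auto simp: filterlim_at eventually_at_filter)
  qed
  have holk: "k holomorphic_on upper_half_disc 0 \<rho>" for \<rho>
  proof -
    have "\<phi> T \<circ> E holomorphic_on upper_half_disc 0 \<rho>"
      by (rule holomorphic_on_compose_gen[OF E_hol flow_holomorphic]) (use T E_disc in auto)
    then show ?thesis by (simp add: k_def o_def)
  qed
  have kd: "k ` upper_half_disc 0 \<rho> \<subseteq> disc" for \<rho>
    using flow_in_disc[of T] T E_disc unfolding k_def by (meson image_subsetI less_imp_le)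
  have bd: "((\<lambda>w. norm (k w)) \<longlongrightarrow> 1) (at (of_real x) within upper_half_disc 0 r)" if x: "\<bar>x\<bar> < r" for x
  proof -
    define u where "u = u0 + s * x"
    have "\<bar>u - u0\<bar> < r" using x ss by (simp add: u_def abs_mult)
    from near[OF this] have u: "a < u" "u < b" "T + \<tau> u \<le> T0 + \<tau> u0" by auto
    then have "\<not> interior_limit u T" using not_interior_limit_transport[OF u0 T0] T by simp
    then have "((\<lambda>z. norm (\<phi> T z)) \<longlongrightarrow> 1) (at (p u) within disc)"
      using interior_limit_or_inner[OF u(1,2), of T] T by simp
    then show ?thesis unfolding k_def using E_lim[of x] by (rule_tac filterlim_compose) (simp_all add: u_def)
  qed
  obtain \<rho> K where rho: "0 < \<rho>" "\<rho> \<le> r" and holK: "K holomorphic_on ball 0 \<rho>"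
    and Kk: "\<And>w. w \<in> upper_half_disc 0 \<rho> \<Longrightarrow> K w = k w"
    and K1: "\<And>x. \<bar>x\<bar> < \<rho> \<Longrightarrow> norm (K (of_real x)) = 1" and K'0: "deriv K 0 \<noteq> 0"
    by (rule boundary_extension[OF r(1) holk kd bd]) auto
  have K_cont: "isCont K w" if "norm w < \<rho>" for w
    using holomorphic_on_imp_continuous_on[OF holK] that continuous_on_eq_continuous_at[of "ball 0 \<rho>" K] by simp
  \<comment> \<open>At parameters before \<open>u0\<close> the end has not been reached at time
    \<open>T\<close>, so there \<open>K\<close> is known from the flow along the arc; letting
    \<open>y\<close> tend to \<open>0\<close> will identify \<open>K 0\<close>.\<close>
  have K_arc: "K (of_real (- s * y)) = p (tau_inv (\<tau> (u0 - y) + T))" if y: "0 < y" "y < \<rho>" for y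
  proof -
    define x where "x = - s * y"
    have x: "\<bar>x\<bar> < \<rho>" "u0 + s * x = u0 - y" using y ss by (auto simp: x_def abs_mult mult.assoc[symmetric])
    have u: "a < u0 - y" "u0 - y < b" using y rho r by auto
    have "\<tau> (u0 - y) < \<tau> u0" using u y u0 by (intro tau_less) auto
    then have "\<tau> (u0 - y) + T < \<beta>" by (simp add: T_def)
    then obtain v where v: "a < v" "v < b" "\<tau> (u0 - y) + T < \<tau> v" using beta by (auto simp: tau_sup_def)
    have "\<tau> (u0 - y) < \<tau> v" using v(3) T by simp
    then have "u0 - y \<le> v" using tau_less_iff u v by force
    then have "(\<phi> T \<longlongrightarrow> p (tau_inv (\<tau> (u0 - y) + T))) (at (p (u0 + s * x)) within disc)"
      unfolding x(2) using u v T by (intro flow_limit_arc[of _ _ v]) auto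
    then have "((\<lambda>w. \<phi> T (E w)) \<longlongrightarrow> p (tau_inv (\<tau> (u0 - y) + T))) (at (of_real x) within upper_half_disc 0 \<rho>)"
      by (rule filterlim_compose[OF _ E_lim])
    then have "(K \<longlongrightarrow> p (tau_inv (\<tau> (u0 - y) + T))) (at (of_real x) within upper_half_disc 0 \<rho>)"
      by (rule Lim_transform_eventually) (auto simp: eventually_at_filter Kk k_def)
    moreover have "(K \<longlongrightarrow> K (of_real x)) (at (of_real x) within upper_half_disc 0 \<rho>)"
      using K_cont[of "of_real x"] x(1) by (simp add: continuous_at_imp_continuous_at_within continuous_within[symmetric])
    moreover have "at (of_real x) within upper_half_disc 0 \<rho> \<noteq> bot"
      using real_in_closure_upper_half_disc[of "of_real x" 0 \<rho>] x by (simp add: trivial_limit_within)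
    ultimately show ?thesis using tendsto_unique unfolding x_def by blast
  qed
  have K0: "K 0 = p b"
  proof -
    have ev: "\<forall>\<^sub>F y in at_right 0. 0 < y \<and> y < \<rho>"
      unfolding eventually_at_right_field using rho by (intro exI[of _ \<rho>]) auto
    have "((\<lambda>y. complex_of_real (- s * y)) \<longlongrightarrow> of_real (- s * 0)) (at_right 0)"
      by (intro tendsto_intros)
    then have "((\<lambda>y. complex_of_real (- s * y)) \<longlongrightarrow> 0) (at_right 0)" by simp
    then have "((\<lambda>y. K (complex_of_real (- s * y))) \<longlongrightarrow> K 0) (at_right 0)"
      using K_cont[of 0] rho by (intro isCont_tendsto_compose[of 0 K]) auto
    then have 1: "((\<lambda>y. p (tau_inv (\<tau> (u0 - y) + T))) \<longlongrightarrow> K 0) (at_right 0)"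
      by (rule Lim_transform_eventually) (use ev in \<open>auto elim!: eventually_mono simp: K_arc[simplified]\<close>)
    have "((\<lambda>y. u0 - y) \<longlongrightarrow> u0 - 0) (at_right 0)" by (intro tendsto_intros)
    then have "((\<lambda>y. \<tau> (u0 - y)) \<longlongrightarrow> \<tau> u0) (at_right 0)"
      using isCont_tau[OF u0] by (intro isCont_tendsto_compose[of u0 \<tau>]) auto
    then have "((\<lambda>y. \<tau> (u0 - y) + T) \<longlongrightarrow> \<tau> u0 + T) (at_right 0)" by (intro tendsto_intros)
    then have "((\<lambda>y. \<tau> (u0 - y) + T) \<longlongrightarrow> \<beta>) (at_right 0)" by (simp add: T_def)
    moreover have "\<forall>\<^sub>F y in at_right 0. \<tau> (u0 - y) + T < \<beta>"
      using ev
    proof eventually_elim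
      case (elim y)
      then have "\<tau> (u0 - y) < \<tau> u0" using u0 rho r by (intro tau_less) auto
      then show ?case by (simp add: T_def)
    qed
    ultimately have "((\<lambda>y. tau_inv (\<tau> (u0 - y) + T)) \<longlongrightarrow> b) (at_right 0)" by (rule tau_inv_tendsto_sup[OF beta])
    then have "((\<lambda>y. p (tau_inv (\<tau> (u0 - y) + T))) \<longlongrightarrow> p b) (at_right 0)"
      using isCont_p by (rule isCont_tendsto_compose[rotated])
    with 1 show ?thesis using tendsto_unique trivial_limit_at_right_real by blast
  qed
  \<comment> \<open>The field \<open>F\<close> in the chart \<open>E\<close>; it is real on the real
    axis, with the sign of \<open>s\<close>.\<close>
  define f where "f = (\<lambda>w. F (E w) / (\<i> * E w))"
  have E_nz: "E w \<noteq> 0" for w using E_norm[of w] by (metis exp_not_eq_zero norm_zero)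
  have holf: "f holomorphic_on ball 0 \<rho>"
  proof -
    have "F \<circ> E holomorphic_on ball 0 \<rho>"
      by (rule holomorphic_on_compose_gen[OF E_hol holomorphic_F]) (use r1 r rho in auto)
    then show ?thesis unfolding f_def using E_nz by (intro holomorphic_intros E_hol) (auto simp: o_def)
  qed
  obtain R where "R > 0" "\<And>z. z \<in> ball (K 0) R \<Longrightarrow> norm z = 1 \<Longrightarrow> contact_point G z"
  proof (rule contact_points_pushforward[OF rho(1) holK K1 _ K'0 holf])
    show "K ` upper_half_disc 0 \<rho> \<subseteq> disc" using Kk kd[of \<rho>] by (auto simp: image_subset_iff)
    fix x :: real assume x: "\<bar>x\<bar> < \<rho>"
    define u where "u = u0 + s * x"
    have "\<bar>u - u0\<bar> < r" using x rho ss by (simp add: u_def abs_mult)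
    from near[OF this] have u: "a < u" "u < b" by auto
    have "f (of_real x) = of_real (s * m u)"
      using F_p[OF u] E_nz[of "of_real x"] by (simp add: f_def E_real u_def)
    then show "f (of_real x) = of_real (s * m (u0 + s * x)) \<and> s * m (u0 + s * x) \<noteq> 0"
      using m_pos[OF u] s by (auto simp: u_def)
  next
    fix w assume w: "w \<in> upper_half_disc 0 \<rho>"
    have Ew: "E w \<in> disc" "E w \<in> U" using E_disc[OF w] r1(2)[of w] w rho r by auto
    have "((\<lambda>w. \<phi> T (E w)) has_field_derivative deriv (\<phi> T) (E w) * (\<i> * E w)) (at w)"
      by (rule DERIV_chain2[of "\<phi> T"]) (use holomorphic_derivI[OF flow_holomorphic open_ball Ew(1)] T E_deriv in auto)
    then have "(K has_field_derivative deriv (\<phi> T) (E w) * (\<i> * E w)) (at w)"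
      by (rule has_field_derivative_transform_within_open[OF _ open_upper_half_disc w]) (simp add: Kk k_def)
    then have "deriv K w = deriv (\<phi> T) (E w) * (\<i> * E w)" by (rule DERIV_imp_deriv)
    then have "deriv K w * f w = deriv (\<phi> T) (E w) * F (E w)" using E_nz[of w] by (simp add: f_def)
    also have "\<dots> = G (\<phi> T (E w))" using deriv_flow_generator[of T "E w"] T Ew F_eq_G by simp
    finally show "G (K w) = deriv K w * f w" using Kk[OF w] by (simp add: k_def)
  qed auto
  then show thesis using that K0 by auto
qed

end

section \<open>Boundary values at the end points\<close>

text \<open>Only times below and above \<open>L\<close> have to be decided; the premise at time
  \<open>0\<close> keeps the set nonempty when \<open>L = 0\<close>.\<close>

lemma life_time_eqI:
  assumes "0 \<le> L" "nontangential_limit (\<phi> 0) \<sigma> \<in> sphere 0 1"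
    and "\<And>t. t \<ge> 0 \<Longrightarrow> ereal t < L \<Longrightarrow> nontangential_limit (\<phi> t) \<sigma> \<in> sphere 0 1"
    and "\<And>t. t \<ge> 0 \<Longrightarrow> L < ereal t \<Longrightarrow> nontangential_limit (\<phi> t) \<sigma> \<notin> sphere 0 1"
  shows "life_time \<phi> \<sigma> = L"
proof (rule antisym)
  show "life_time \<phi> \<sigma> \<le> L"
    unfolding life_time_def by (rule Sup_least) (use assms(4) not_le_imp_less in fastforce)
  show "L \<le> life_time \<phi> \<sigma>"
  proof (rule dense_le)
    fix y assume y: "y < L"
    show "y \<le> life_time \<phi> \<sigma>"
    proof (cases "y \<le> 0")
      case True
      have "ereal 0 \<le> life_time \<phi> \<sigma>"
        unfolding life_time_def by (rule Sup_upper) (use assms(2) in auto)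
      then show ?thesis using True by (metis order_trans zero_ereal_def)
    next
      case False
      then obtain t where t: "y = ereal t" "t \<ge> 0" using y by (cases y) auto
      then show ?thesis
        unfolding life_time_def by (intro Sup_upper) (use assms(3) y in auto)
    qed
  qed
qed

lemma (in generated_semigroup) nontangential_limit_flow_0:
  assumes "norm \<sigma> = 1"
  shows "nontangential_limit (\<phi> 0) \<sigma> = \<sigma>"
proof (rule nontangential_limit_eqI[OF assms has_nontangential_limitI])
  have "((\<lambda>z. z) \<longlongrightarrow> \<sigma>) (at \<sigma> within disc)" by (rule tendsto_ident_at)
  then show "(\<phi> 0 \<longlongrightarrow> \<sigma>) (at \<sigma> within disc)"
    by (rule Lim_transform_eventually) (simp add: eventually_at_filter flow_0)
qed

context contact_flow
begin

text \<open>The points of a subarc with closure in the open arc reach a given neighbourhood of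
  \<open>p b\<close> after a common time, determined by the end with the smallest
  \<open>\<tau>\<close>; harmonic measure carries this convergence into the disc.\<close>

lemma denjoy_wolff_if_tau_unbounded:
  assumes ab: "a < b" and unb: "\<And>r. \<exists>u. a < u \<and> u < b \<and> r < \<tau> u"
  shows "is_denjoy_wolff_point \<phi> (p b)"
proof -
  \<comment> \<open>The bound 1 keeps the subarc shorter than the circle, as \<open>b - a\<close>
    may exceed \<open>2 * pi\<close>.\<close>
  define \<delta> where "\<delta> = min 1 ((b - a) / 2)"
  define c where "c = (a + b) / 2"
  have d: "0 < \<delta>" "\<delta> < 2 * pi" using ab pi_gt3 by (auto simp: \<delta>_def min_def)
  have sub: "a < c - \<delta> / 2" "c + \<delta> / 2 < b"
  proof -
    have le: "\<delta> \<le> (b - a) / 2" unfolding \<delta>_def by (rule min.cobounded2)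
    then have "2 * \<delta> \<le> b - a" by simp
    with ab show "a < c - \<delta> / 2" "c + \<delta> / 2 < b" by (simp_all add: c_def field_simps)
  qed
  have "((\<lambda>t. \<phi> t z) \<longlongrightarrow> p b) at_top" if z: "z \<in> disc" for z
  proof (rule tendsto_from_arc[where \<delta> = \<delta> and \<theta> = "s * c - \<delta> / 2", OF _ d _ _ z])
    show "\<forall>\<^sub>F t in at_top. \<phi> t holomorphic_on disc \<and> \<phi> t ` disc \<subseteq> disc"
      using eventually_ge_at_top[of 0] by eventually_elim (use flow_holomorphic flow_image in blast)
    show "norm (p b) \<le> 1" by simp
    fix \<eta> :: real assume eta: "\<eta> > 0"
    have "p \<midarrow>b\<rightarrow> p b" using isCont_p by (simp add: isCont_def)
    then have "\<forall>\<^sub>F v in at b. dist (p v) (p b) < \<eta>" using eta by (rule tendstoD)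
    then obtain d' where d': "d' > 0" "\<And>v. v \<noteq> b \<Longrightarrow> dist v b < d' \<Longrightarrow> dist (p v) (p b) < \<eta>"
      unfolding eventually_at by auto
    define c1 where "c1 = max ((a + b) / 2) (b - d' / 2)"
    have c1: "a < c1" "c1 < b" "b - d' < c1" using ab d' by (auto simp: c1_def max_def)
    show "\<forall>\<^sub>F t in at_top. \<forall>x. 0 < x \<and> x < \<delta> \<longrightarrow>
        (\<exists>l. (\<phi> t \<longlongrightarrow> l) (at (cis (s * c - \<delta> / 2 + x)) within disc) \<and> norm (l - p b) \<le> \<eta>)"
      using eventually_ge_at_top[of "max 0 (\<tau> c1 - \<tau> (c - \<delta> / 2))"]
    proof (eventually_elim, intro allI impI)
      fix t x assume t: "max 0 (\<tau> c1 - \<tau> (c - \<delta> / 2)) \<le> t" and x: "0 < x \<and> x < \<delta>"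
      \<comment> \<open>In \<open>tendsto_from_arc\<close> the angle increases with
        \<open>x\<close>; this is the same point in the parameter of \<open>p\<close>.\<close>
      define u where "u = c + s * (x - \<delta> / 2)"
      have u: "c - \<delta> / 2 \<le> u" "u < c + \<delta> / 2" using s x by (auto simp: u_def)
      then have u': "a < u" "u < b" using sub by auto
      have "s * u = s * c + (s * s) * (x - \<delta> / 2)" by (simp add: u_def algebra_simps)
      then have su: "s * u = s * c - \<delta> / 2 + x" using s by auto
      have "\<tau> (c - \<delta> / 2) \<le> \<tau> u" using sub u u' by (intro tau_le) auto
      then have ge: "\<tau> c1 \<le> \<tau> u + t" "t \<ge> 0" using t by auto
      obtain v where v: "a < v" "v < b" "\<tau> u + t < \<tau> v" using unb by blast
      have "u \<le> v" "c1 \<le> v" using v ge u' c1 tau_less_iff[of u v] tau_less_iff[of c1 v] by auto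
      then have lim: "(\<phi> t \<longlongrightarrow> p (tau_inv (\<tau> u + t))) (at (p u) within disc)"
        using flow_limit_arc[of u t v] v u' ge by auto
      have "c1 \<le> tau_inv (\<tau> u + t)" "tau_inv (\<tau> u + t) \<le> v"
        using tau_inv[of c1 v "\<tau> u + t"] c1 v ge \<open>c1 \<le> v\<close> by auto
      then have "dist (p (tau_inv (\<tau> u + t))) (p b) < \<eta>"
        using c1 v by (intro d'(2)) (auto simp: dist_real_def)
      then show "\<exists>l. (\<phi> t \<longlongrightarrow> l) (at (cis (s * c - \<delta> / 2 + x)) within disc) \<and> norm (l - p b) \<le> \<eta>"
        using lim unfolding p_def su by (intro exI[of _ "p (tau_inv (\<tau> u + t))"]) (simp add: dist_norm p_def su)
    qed
  qed
  then show ?thesis by (simp add: is_denjoy_wolff_point_def)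
qed

section \<open>Angular limits at the two ends from limits along the arc\<close>

definition tau_inf :: "real \<Rightarrow> bool" where
  "tau_inf \<alpha> \<longleftrightarrow> (\<forall>u. a < u \<and> u < b \<longrightarrow> \<alpha> < \<tau> u) \<and> (\<forall>r>\<alpha>. \<exists>u. a < u \<and> u < b \<and> \<tau> u < r)"

lemma tau_inf_ex:
  assumes ab: "a < b" and bd: "\<And>u. a < u \<Longrightarrow> u < b \<Longrightarrow> B \<le> \<tau> u"
  obtains \<alpha> where "tau_inf \<alpha>"
proof
  define \<alpha> where "\<alpha> = Inf (\<tau> ` {a<..<b})"
  have bdd: "bdd_below (\<tau> ` {a<..<b})" using bd by (auto intro!: bdd_belowI2)
  have "\<alpha> < \<tau> u" if u: "a < u" "u < b" for u
  proof -
    have "\<alpha> \<le> \<tau> ((u + a) / 2)" unfolding \<alpha>_def using u by (intro cINF_lower bdd) auto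
    also have "\<dots> < \<tau> u" using u by (intro tau_less) auto
    finally show ?thesis .
  qed
  moreover have "\<exists>u. a < u \<and> u < b \<and> \<tau> u < r" if "\<alpha> < r" for r
    using that cINF_less_iff[OF _ bdd, of r] ab unfolding \<alpha>_def by force
  ultimately show "tau_inf \<alpha>" by (simp add: tau_inf_def)
qed

lemma tau_tendsto_sup:
  assumes "tau_sup \<beta>"
  shows "((\<lambda>x. \<tau> (b - x)) \<longlongrightarrow> \<beta>) (at_right 0)"
proof (rule order_tendstoI)
  fix r assume "r < \<beta>"
  then obtain u where u: "a < u" "u < b" "r < \<tau> u" using assms by (auto simp: tau_sup_def)
  show "\<forall>\<^sub>F x in at_right 0. r < \<tau> (b - x)"
    unfolding eventually_at_right_field
    using tau_le[of u] u by (intro exI[of _ "b - u"]) (auto intro: less_le_trans)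
next
  fix r assume r: "\<beta> < r"
  obtain u where u: "a < u" "u < b" using assms unfolding tau_sup_def by (meson lt_ex)
  have "\<tau> (b - x) < r" if "0 < x" "x < b - u" for x
  proof -
    have "\<tau> (b - x) < \<beta>" using assms that u unfolding tau_sup_def by simp
    then show ?thesis using r by simp
  qed
  then show "\<forall>\<^sub>F x in at_right 0. \<tau> (b - x) < r"
    unfolding eventually_at_right_field using u by (intro exI[of _ "b - u"]) auto
qed

lemma tau_tendsto_inf:
  assumes "tau_inf \<alpha>"
  shows "((\<lambda>x. \<tau> (a + x)) \<longlongrightarrow> \<alpha>) (at_right 0)"
proof (rule order_tendstoI)
  fix r assume "\<alpha> < r"
  then obtain u where u: "a < u" "u < b" "\<tau> u < r" using assms by (auto simp: tau_inf_def)
  show "\<forall>\<^sub>F x in at_right 0. \<tau> (a + x) < r"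
    unfolding eventually_at_right_field
  proof (intro exI[of _ "u - a"] conjI allI impI)
    show "\<tau> (a + x) < r" if "0 < x" "x < u - a" for x
      using tau_le[of "a + x" u] that u by simp
  qed (use u in auto)
next
  fix r assume r: "r < \<alpha>"
  obtain u where u: "a < u" "u < b" using assms unfolding tau_inf_def by (meson gt_ex)
  have "r < \<tau> (a + x)" if "0 < x" "x < u - a" for x
  proof -
    have "\<alpha> < \<tau> (a + x)" using assms that u unfolding tau_inf_def by simp
    then show ?thesis using r by simp
  qed
  then show "\<forall>\<^sub>F x in at_right 0. r < \<tau> (a + x)"
    unfolding eventually_at_right_field using u by (intro exI[of _ "u - a"]) auto
qed

text \<open>Approaching \<open>b\<close> from below means approaching the angle \<open>s * b\<close>
  from the side \<open>- s\<close>.\<close>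

lemma nontangential_limit_end:
  assumes "d > 0" "t \<ge> 0" "\<And>x. 0 < x \<Longrightarrow> x < d \<Longrightarrow> (\<phi> t \<longlongrightarrow> l x) (at (p (b - x)) within disc)"
    and "(l \<longlongrightarrow> L) (at_right 0)"
  shows "has_nontangential_limit (\<phi> t) (p b) L"
  unfolding p_def
proof (rule Lindelof_one_sided[OF flow_holomorphic flow_image assms(1) _ _ assms(4), of _ "- s"])
  show "(\<phi> t \<longlongrightarrow> l x) (at (cis (s * b + - s * x)) within disc)" if "0 < x" "x < d" for x
    using assms(3)[OF that] by (simp add: p_def algebra_simps)
qed (use assms(2) s in auto)

lemma nontangential_limit_start:
  assumes "d > 0" "t \<ge> 0" "\<And>x. 0 < x \<Longrightarrow> x < d \<Longrightarrow> (\<phi> t \<longlongrightarrow> l x) (at (p (a + x)) within disc)"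
    and "(l \<longlongrightarrow> L) (at_right 0)"
  shows "has_nontangential_limit (\<phi> t) (p a) L"
  unfolding p_def
proof (rule Lindelof_one_sided[OF flow_holomorphic flow_image assms(1) s _ assms(4)])
  show "(\<phi> t \<longlongrightarrow> l x) (at (cis (s * a + s * x)) within disc)" if "0 < x" "x < d" for x
    using assms(3)[OF that] by (simp add: p_def algebra_simps)
qed (use assms(2) in auto)

text \<open>The flow moves \<open>p (b - x)\<close> towards \<open>p b\<close> without ever reaching
  it, so the image parameters are squeezed between \<open>b - x\<close> and
  \<open>b\<close>.\<close>

lemma nontangential_limit_end_unbounded:
  assumes ab: "a < b" and unb: "\<And>r. \<exists>u. a < u \<and> u < b \<and> r < \<tau> u" and t: "t \<ge> 0"
  shows "has_nontangential_limit (\<phi> t) (p b) (p b)"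
proof (rule nontangential_limit_end[where d = "b - a" and l = "\<lambda>x. p (tau_inv (\<tau> (b - x) + t))"])
  have bounds: "b - x \<le> tau_inv (\<tau> (b - x) + t) \<and> tau_inv (\<tau> (b - x) + t) < b \<and>
      (\<phi> t \<longlongrightarrow> p (tau_inv (\<tau> (b - x) + t))) (at (p (b - x)) within disc)" if x: "0 < x" "x < b - a" for x
  proof -
    obtain v where v: "a < v" "v < b" "\<tau> (b - x) + t < \<tau> v" using unb by blast
    have "b - x \<le> v" using v t x tau_less_iff[of "b - x" v] by auto
    then show ?thesis using tau_inv[of "b - x" v "\<tau> (b - x) + t"] flow_limit_arc[of "b - x" t v] v t x by auto
  qed
  then show "(\<phi> t \<longlongrightarrow> p (tau_inv (\<tau> (b - x) + t))) (at (p (b - x)) within disc)" if "0 < x" "x < b - a" for x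
    using that by blast
  have "((\<lambda>x. tau_inv (\<tau> (b - x) + t)) \<longlongrightarrow> b) (at_right 0)"
  proof (rule tendsto_sandwich[where f = "\<lambda>x. b - x" and h = "\<lambda>_. b"])
    show "\<forall>\<^sub>F x in at_right 0. b - x \<le> tau_inv (\<tau> (b - x) + t)"
      "\<forall>\<^sub>F x in at_right 0. tau_inv (\<tau> (b - x) + t) \<le> b"
      unfolding eventually_at_right_field using bounds ab by (intro exI[of _ "b - a"]; force)+
    have "((\<lambda>x. b - x) \<longlongrightarrow> b - 0) (at_right 0)" by (intro tendsto_intros)
    then show "((\<lambda>x. b - x) \<longlongrightarrow> b) (at_right 0)" by simp
  qed auto
  then show "((\<lambda>x. p (tau_inv (\<tau> (b - x) + t))) \<longlongrightarrow> p b) (at_right 0)"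
    using isCont_p by (rule isCont_tendsto_compose[rotated])
qed (use ab t in auto)

text \<open>Close to \<open>a\<close> the clock starts so far in the past that an additional time
  \<open>t\<close> still leaves the point near \<open>a\<close>.\<close>

lemma nontangential_limit_start_unbounded:
  assumes ab: "a < b" and unb: "\<And>r. \<exists>u. a < u \<and> u < b \<and> \<tau> u < r" and t: "t \<ge> 0"
  shows "has_nontangential_limit (\<phi> t) (p a) (p a)"
proof -
  define v where "v = (a + b) / 2"
  have v: "a < v" "v < b" using ab by (auto simp: v_def)
  have near: "\<exists>d>0. d < c - a \<and> (\<forall>x. 0 < x \<and> x < d \<longrightarrow> \<tau> (a + x) + t < \<tau> c)" if c: "a < c" "c < b" for c
  proof -
    obtain u where u: "a < u" "u < b" "\<tau> u < \<tau> c - t" using unb by blast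
    have "\<tau> u < \<tau> c" using u t by simp
    then have uc: "u < c" using tau_less_iff u c by blast
    have "\<tau> (a + x) + t < \<tau> c" if "0 < x" "x < u - a" for x
      using tau_le[of "a + x" u] that u by simp
    then show ?thesis using u uc by (intro exI[of _ "u - a"]) auto
  qed
  obtain d where d: "d > 0" "d < v - a" "\<And>x. 0 < x \<Longrightarrow> x < d \<Longrightarrow> \<tau> (a + x) + t < \<tau> v"
    using near[OF v] by blast
  have bounds: "a + x \<le> tau_inv (\<tau> (a + x) + t)" if "0 < x" "x < d" for x
    using tau_inv(1)[of "a + x" v "\<tau> (a + x) + t"] d(3)[OF that] that d v t by auto
  show ?thesis
  proof (rule nontangential_limit_start[where d = d and l = "\<lambda>x. p (tau_inv (\<tau> (a + x) + t))"])
    show "(\<phi> t \<longlongrightarrow> p (tau_inv (\<tau> (a + x) + t))) (at (p (a + x)) within disc)" if "0 < x" "x < d" for x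
      using flow_limit_arc[of "a + x" t v] d(3)[OF that] that d v t by auto
    have "((\<lambda>x. tau_inv (\<tau> (a + x) + t)) \<longlongrightarrow> a) (at_right 0)"
    proof (rule order_tendstoI)
      fix c assume "c < a"
      then show "\<forall>\<^sub>F x in at_right 0. c < tau_inv (\<tau> (a + x) + t)"
        unfolding eventually_at_right_field using bounds d(1) by (intro exI[of _ d]) force
    next
      fix c assume c: "a < c"
      define c' where "c' = (a + min c b) / 2"
      have c': "a < c'" "c' < b" "c' < c" using c ab by (auto simp: c'_def min_def)
      obtain d' where d': "d' > 0" "d' < c' - a" "\<And>x. 0 < x \<Longrightarrow> x < d' \<Longrightarrow> \<tau> (a + x) + t < \<tau> c'"
        using near[OF c'(1,2)] by blast
      have "tau_inv (\<tau> (a + x) + t) < c" if "0 < x" "x < d'" for x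
        using tau_inv(2)[of "a + x" c' "\<tau> (a + x) + t"] d'(3)[OF that] that d' c' t by auto
      then show "\<forall>\<^sub>F x in at_right 0. tau_inv (\<tau> (a + x) + t) < c"
        unfolding eventually_at_right_field using d'(1) by blast
    qed
    then show "((\<lambda>x. p (tau_inv (\<tau> (a + x) + t))) \<longlongrightarrow> p a) (at_right 0)"
      using isCont_p by (rule isCont_tendsto_compose[rotated])
  qed (use d t in auto)
qed

lemma nontangential_limit_start_arc:
  assumes inf: "tau_inf \<alpha>" and t: "t \<ge> 0" and w: "a < w" "w < b" "\<alpha> + t = \<tau> w"
  shows "has_nontangential_limit (\<phi> t) (p a) (p w)"
proof -
  define v where "v = (w + b) / 2"
  have v: "a < v" "v < b" "w < v" using w by (auto simp: v_def)
  have lim: "((\<lambda>x. \<tau> (a + x) + t) \<longlongrightarrow> \<tau> w) (at_right 0)"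
    using tendsto_add[OF tau_tendsto_inf[OF inf] tendsto_const, of t] w(3) by simp
  have "\<tau> w < \<tau> v" using tau_less w v by blast
  then have "\<forall>\<^sub>F x in at_right 0. \<tau> (a + x) + t < \<tau> v" using lim order_tendstoD(2) by blast
  then obtain d where d: "d > 0" "\<And>x. 0 < x \<Longrightarrow> x < d \<Longrightarrow> \<tau> (a + x) + t < \<tau> v"
    unfolding eventually_at_right_field by auto
  show ?thesis
  proof (rule nontangential_limit_start[where d = "min d (v - a)" and l = "\<lambda>x. p (tau_inv (\<tau> (a + x) + t))"])
    show "(\<phi> t \<longlongrightarrow> p (tau_inv (\<tau> (a + x) + t))) (at (p (a + x)) within disc)" if "0 < x" "x < min d (v - a)" for x
      using flow_limit_arc[of "a + x" t v] d(2)[of x] that v t by auto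
    show "((\<lambda>x. p (tau_inv (\<tau> (a + x) + t))) \<longlongrightarrow> p w) (at_right 0)"
      using isCont_p tau_inv_tendsto[OF w(1,2) lim] by (rule isCont_tendsto_compose)
  qed (use d v t in auto)
qed

text \<open>Once the clock \<open>\<tau> u + t\<close> has passed \<open>\<beta>\<close>, all points
  of the arc follow one and the same curve \<open>Z\<close> in the disc, parametrised by this clock.
  Its continuity yields the angular limits at the ends.\<close>

lemma interior_trajectory:
  assumes beta: "tau_sup \<beta>"
    and int: "\<And>u t. a < u \<Longrightarrow> u < b \<Longrightarrow> t \<ge> 0 \<Longrightarrow> \<beta> < \<tau> u + t \<Longrightarrow> interior_limit u t"
  obtains Z where "\<And>r. \<beta> < r \<Longrightarrow> Z r \<in> disc" "\<And>r. \<beta> < r \<Longrightarrow> isCont Z r"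
    "\<And>u t. a < u \<Longrightarrow> u < b \<Longrightarrow> t \<ge> 0 \<Longrightarrow> \<beta> < \<tau> u + t \<Longrightarrow> (\<phi> t \<longlongrightarrow> Z (\<tau> u + t)) (at (p u) within disc)"
proof -
  obtain u0 where u0: "a < u0" "u0 < b" using beta unfolding tau_sup_def by (meson lt_ex)
  have tb: "\<tau> u < \<beta>" if "a < u" "u < b" for u using beta that by (simp add: tau_sup_def)
  \<comment> \<open>\<open>u0\<close> serves as base point; the limits at other points of the arc
    agree with these by transport along the arc.\<close>
  define Z where "Z = (\<lambda>r. Lim (at (p u0) within disc) (\<phi> (r - \<tau> u0)))"
  have Z: "(\<phi> (r - \<tau> u0) \<longlongrightarrow> Z r) (at (p u0) within disc) \<and> Z r \<in> disc" if r: "\<beta> < r" for r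
  proof -
    obtain \<zeta> where z: "\<zeta> \<in> disc" "(\<phi> (r - \<tau> u0) \<longlongrightarrow> \<zeta>) (at (p u0) within disc)"
      using int[of u0 "r - \<tau> u0"] u0 r tb[OF u0] by (auto simp: interior_limit_def)
    then show ?thesis using tendsto_Lim[OF disc_filter_nontrivial z(2)] by (simp add: Z_def)
  qed
  have Z_flow: "Z r' = \<phi> (r' - r) (Z r)" if r: "\<beta> < r" "r \<le> r'" for r r'
  proof -
    have "(\<phi> ((r' - r) + (r - \<tau> u0)) \<longlongrightarrow> \<phi> (r' - r) (Z r)) (at (p u0) within disc)"
      by (rule tendsto_flow_later) (use Z[OF r(1)] r tb[OF u0] in auto)
    moreover have "(\<phi> (r' - \<tau> u0) \<longlongrightarrow> Z r') (at (p u0) within disc)" using Z[of r'] r by simp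
    ultimately show ?thesis using tendsto_unique[OF disc_filter_nontrivial] by simp
  qed
  show thesis
  proof (rule that[of Z])
    show "Z r \<in> disc" if "\<beta> < r" for r using Z[OF that] by blast
    show "isCont Z r" if r: "\<beta> < r" for r
    proof -
      \<comment> \<open>\<open>Z\<close> is the forward orbit of \<open>Z r1\<close>; starting
        before \<open>r\<close> makes it continuous at \<open>r\<close> from both sides.\<close>
      define r1 where "r1 = (\<beta> + r) / 2"
      have r1: "\<beta> < r1" "r1 < r" using r by (auto simp: r1_def)
      have "continuous_on {r1<..} (\<lambda>r. \<phi> (r - r1) (Z r1))"
        by (rule continuous_on_compose2[OF continuous_on_flow_time[of "Z r1"]])
           (use Z[OF r1(1)] in \<open>auto intro!: continuous_intros\<close>)
      moreover have "\<phi> (r - r1) (Z r1) = Z r" if "r \<in> {r1<..}" for r using Z_flow[of r1 r] r1 that by simp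
      ultimately have "continuous_on {r1<..} Z"
        using continuous_on_cong[of "{r1<..}" "{r1<..}" Z "\<lambda>r. \<phi> (r - r1) (Z r1)"] by metis
      then have "\<forall>r\<in>{r1<..}. isCont Z r"
        using continuous_on_eq_continuous_at[OF open_greaterThan] by blast
      then show ?thesis using r1(2) by simp
    qed
    fix u t assume u: "a < u" "u < b" and t: "t \<ge> 0" "\<beta> < \<tau> u + t"
    show "(\<phi> t \<longlongrightarrow> Z (\<tau> u + t)) (at (p u) within disc)"
    proof (cases "u0 \<le> u")
      case True
      obtain \<zeta> where z: "\<zeta> \<in> disc" "(\<phi> t \<longlongrightarrow> \<zeta>) (at (p u) within disc)"
        using int[OF u t] by (auto simp: interior_limit_def)
      have "(\<phi> (t + (\<tau> u - \<tau> u0)) \<longlongrightarrow> \<zeta>) (at (p u0) within disc)"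
        by (rule tendsto_flow_add[OF _ flow_along_arc t(1) z(2)]) (use True u0 u tau_le in auto)
      moreover have "t + (\<tau> u - \<tau> u0) = \<tau> u + t - \<tau> u0" by simp
      ultimately have "\<zeta> = Z (\<tau> u + t)" using Z[OF t(2)] tendsto_unique[OF disc_filter_nontrivial] by metis
      then show ?thesis using z by simp
    next
      case False
      have lt: "\<tau> u0 < \<tau> u + t" using tb[OF u0] t by simp
      have "(\<phi> ((\<tau> u + t - \<tau> u0) + (\<tau> u0 - \<tau> u)) \<longlongrightarrow> Z (\<tau> u + t)) (at (p u) within disc)"
        by (rule tendsto_flow_add[OF _ flow_along_arc]) (use False u0 u tau_le Z[OF t(2)] lt in auto)
      then show ?thesis by simp
    qed
  qed
qed

text \<open>As \<open>x\<close> tends to \<open>0\<close>, the clock of \<open>p (b - x)\<close> at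
  time \<open>t\<close> tends to \<open>\<beta> + t\<close>, which for \<open>t > 0\<close> is a
  point of the curve inside the disc.\<close>

lemma nontangential_limit_end_interior:
  assumes beta: "tau_sup \<beta>"
    and int: "\<And>u t. a < u \<Longrightarrow> u < b \<Longrightarrow> t \<ge> 0 \<Longrightarrow> \<beta> < \<tau> u + t \<Longrightarrow> interior_limit u t"
    and t: "t > 0"
  obtains \<zeta> where "\<zeta> \<in> disc" "has_nontangential_limit (\<phi> t) (p b) \<zeta>"
proof -
  obtain Z where Z: "\<And>r. \<beta> < r \<Longrightarrow> Z r \<in> disc" "\<And>r. \<beta> < r \<Longrightarrow> isCont Z r"
    "\<And>u t. a < u \<Longrightarrow> u < b \<Longrightarrow> t \<ge> 0 \<Longrightarrow> \<beta> < \<tau> u + t \<Longrightarrow> (\<phi> t \<longlongrightarrow> Z (\<tau> u + t)) (at (p u) within disc)"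
    by (rule interior_trajectory[OF beta int]) auto
  have lim: "((\<lambda>x. \<tau> (b - x) + t) \<longlongrightarrow> \<beta> + t) (at_right 0)"
    by (intro tendsto_intros tau_tendsto_sup beta)
  then have "\<forall>\<^sub>F x in at_right 0. \<beta> < \<tau> (b - x) + t" using t by (intro order_tendstoD(1)) auto
  then obtain d where d: "d > 0" "\<And>x. 0 < x \<Longrightarrow> x < d \<Longrightarrow> \<beta> < \<tau> (b - x) + t"
    unfolding eventually_at_right_field by auto
  obtain u where u: "a < u" "u < b" using beta unfolding tau_sup_def by (meson lt_ex)
  have "has_nontangential_limit (\<phi> t) (p b) (Z (\<beta> + t))"
  proof (rule nontangential_limit_end[where d = "min d (b - u)" and l = "\<lambda>x. Z (\<tau> (b - x) + t)"])
    show "(\<phi> t \<longlongrightarrow> Z (\<tau> (b - x) + t)) (at (p (b - x)) within disc)" if "0 < x" "x < min d (b - u)" for x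
      using that d(2)[of x] u t by (intro Z(3)) auto
    show "((\<lambda>x. Z (\<tau> (b - x) + t)) \<longlongrightarrow> Z (\<beta> + t)) (at_right 0)"
      using Z(2)[of "\<beta> + t"] lim t by (intro isCont_tendsto_compose[of _ Z]) auto
  qed (use d u t in auto)
  then show thesis using that Z(1)[of "\<beta> + t"] t by simp
qed

lemma nontangential_limit_start_interior:
  assumes beta: "tau_sup \<beta>" and alpha: "tau_inf \<alpha>"
    and int: "\<And>u t. a < u \<Longrightarrow> u < b \<Longrightarrow> t \<ge> 0 \<Longrightarrow> \<beta> < \<tau> u + t \<Longrightarrow> interior_limit u t"
    and t: "t \<ge> 0" "\<beta> < \<alpha> + t"
  obtains \<zeta> where "\<zeta> \<in> disc" "has_nontangential_limit (\<phi> t) (p a) \<zeta>"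
proof -
  obtain Z where Z: "\<And>r. \<beta> < r \<Longrightarrow> Z r \<in> disc" "\<And>r. \<beta> < r \<Longrightarrow> isCont Z r"
    "\<And>u t. a < u \<Longrightarrow> u < b \<Longrightarrow> t \<ge> 0 \<Longrightarrow> \<beta> < \<tau> u + t \<Longrightarrow> (\<phi> t \<longlongrightarrow> Z (\<tau> u + t)) (at (p u) within disc)"
    by (rule interior_trajectory[OF beta int]) auto
  have lim: "((\<lambda>x. \<tau> (a + x) + t) \<longlongrightarrow> \<alpha> + t) (at_right 0)"
    by (intro tendsto_intros tau_tendsto_inf alpha)
  then have "\<forall>\<^sub>F x in at_right 0. \<beta> < \<tau> (a + x) + t" using t by (intro order_tendstoD(1)) auto
  then obtain d where d: "d > 0" "\<And>x. 0 < x \<Longrightarrow> x < d \<Longrightarrow> \<beta> < \<tau> (a + x) + t"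
    unfolding eventually_at_right_field by auto
  obtain u where u: "a < u" "u < b" using beta unfolding tau_sup_def by (meson lt_ex)
  have "has_nontangential_limit (\<phi> t) (p a) (Z (\<alpha> + t))"
  proof (rule nontangential_limit_start[where d = "min d (u - a)" and l = "\<lambda>x. Z (\<tau> (a + x) + t)"])
    show "(\<phi> t \<longlongrightarrow> Z (\<tau> (a + x) + t)) (at (p (a + x)) within disc)" if "0 < x" "x < min d (u - a)" for x
      using that d(2)[of x] u t by (intro Z(3)) auto
    show "((\<lambda>x. Z (\<tau> (a + x) + t)) \<longlongrightarrow> Z (\<alpha> + t)) (at_right 0)"
      using Z(2)[of "\<alpha> + t"] lim t by (intro isCont_tendsto_compose[of _ Z]) auto
  qed (use d u t in auto)
  then show thesis using that Z(1)[of "\<alpha> + t"] t by simp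
qed

end

section \<open>Maximality and natural parametrisations\<close>

lemma circle_point_angle:
  assumes "norm \<sigma> = 1" "s = 1 \<or> s = (- 1 :: real)"
  obtains u where "c \<le> u" "u < c + 2 * pi" "\<sigma> = cis (s * u)"
proof -
  have base: "\<exists>u. c \<le> u \<and> u < c + 2 * pi \<and> z = cis u" if z: "norm z = 1" for z
  proof -
    define w where "w = z * cis (- c)"
    have "norm w = 1" using z by (simp add: w_def norm_mult)
    then have "(Re w)\<^sup>2 + (Im w)\<^sup>2 = 1" using cmod_power2[of w] by simp
    then obtain t where t: "0 \<le> t" "t < 2 * pi" "Re w = cos t" "Im w = sin t"
      using sincos_total_2pi by metis
    then have "w = cis t" by (simp add: complex_eq_iff)
    moreover have "z = w * cis c" by (simp add: w_def mult.assoc cis_mult)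
    ultimately have "z = cis (c + t)" by (simp add: cis_mult add.commute)
    then show ?thesis using t by (intro exI[of _ "c + t"]) auto
  qed
  from assms(2) show thesis
  proof
    assume "s = 1"
    then show thesis using base[OF assms(1)] that by auto
  next
    assume s: "s = - 1"
    obtain u where u: "c \<le> u" "u < c + 2 * pi" "cnj \<sigma> = cis u" using base[of "cnj \<sigma>"] assms(1) by auto
    have "\<sigma> = cnj (cis u)" using u(3) by (metis complex_cnj_cnj)
    then have "\<sigma> = cis (s * u)" by (simp add: s cis_cnj)
    then show thesis using that u by blast
  qed
qed

context generated_semigroup
begin

lemma generator_unique:
  assumes "infinitesimal_generator \<phi> G'" "z \<in> disc"
  shows "G' z = G z"
proof -
  have 1: "((\<lambda>s. \<phi> s z) has_vector_derivative G' (\<phi> 0 z)) (at 0 within {0..})"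
    using assms unfolding infinitesimal_generator_def by blast
  have 2: "((\<lambda>s. \<phi> s z) has_vector_derivative G (\<phi> 0 z)) (at 0 within {0..})"
    using flow_has_vector_derivative[OF order_refl assms(2)] .
  have "at (0::real) within {0..} \<noteq> bot" by (simp add: at_within_Ici_at_right)
  then show ?thesis using vector_derivative_unique_within[OF _ 1 2] flow_0[OF assms(2)] by simp
qed

text \<open>Tangency makes \<open>F\<close> equal to \<open>\<i> * z * h\<close> on the arc with
  \<open>h\<close> real. As \<open>h\<close> has no zero and the arc is connected, its sign is
  constant and becomes the orientation \<open>s\<close>; for \<open>s = - 1\<close> the parameter
  interval is reflected, so that the flow always runs in the direction of increasing
  parameter.\<close>

lemma contact_flow_ex:
  assumes U: "open U" "F holomorphic_on U" "\<And>z. z \<in> disc \<Longrightarrow> z \<in> U \<Longrightarrow> F z = G z" and ab: "a < b"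
    and arc: "\<And>x. a < x \<Longrightarrow> x < b \<Longrightarrow> cis x \<in> U \<and> Re (cnj (cis x) * F (cis x)) = 0 \<and> F (cis x) \<noteq> 0"
  obtains s m \<tau> where "contact_flow \<phi> G F U s m \<tau> (if s = 1 then a else - b) (if s = 1 then b else - a)"
proof -
  define h where "h = (\<lambda>x. Im (cnj (cis x) * F (cis x)))"
  have Fh: "F (cis x) = \<i> * cis x * of_real (h x)" if x: "a < x" "x < b" for x
  proof -
    have "cnj (cis x) * F (cis x) = \<i> * of_real (h x)"
      using arc[OF x] by (simp add: h_def complex_eq_iff)
    moreover have "cis x * cnj (cis x) = 1" by (simp add: cis_cnj cis_mult)
    then have "F (cis x) = cis x * (cnj (cis x) * F (cis x))" by (simp only: mult.assoc[symmetric] mult_1_left)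
    ultimately show ?thesis by simp
  qed
  have h0: "h x \<noteq> 0" if "a < x" "x < b" for x using Fh[OF that] arc[OF that] by auto
  have hc: "continuous_on {a<..<b} h"
  proof -
    have "continuous_on {a<..<b} (\<lambda>x. F (cis x))"
      by (rule continuous_on_compose2[OF holomorphic_on_imp_continuous_on[OF U(2)]])
         (use arc in \<open>auto intro!: continuous_intros\<close>)
    then show ?thesis unfolding h_def by (intro continuous_intros)
  qed
  have conn: "connected (h ` {a<..<b})" by (rule connected_continuous_image[OF hc]) simp
  define c where "c = (a + b) / 2"
  have c: "a < c" "c < b" using ab by (auto simp: c_def)
  define s :: real where "s = sgn (h c)"
  have s: "s = 1 \<or> s = - 1" using h0[OF c] by (auto simp: s_def sgn_if)
  have pos: "s * h x > 0" if x: "a < x" "x < b" for x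
  proof (rule ccontr)
    assume n: "\<not> s * h x > 0"
    have "s * h c > 0" using h0[OF c] by (simp add: s_def sgn_if)
    then have "(h x \<le> 0 \<and> 0 \<le> h c) \<or> (h c \<le> 0 \<and> 0 \<le> h x)" using n s by auto
    then have "0 \<in> h ` {a<..<b}"
      using connectedD_interval[OF conn, of "h x" "h c" 0] connectedD_interval[OF conn, of "h c" "h x" 0] c x
      by auto
    then show False using h0 by auto
  qed
  define a' where "a' = (if s = 1 then a else - b)"
  define b' where "b' = (if s = 1 then b else - a)"
  have ab': "a' < b'" using ab by (simp add: a'_def b'_def)
  have su: "a < s * u" "s * u < b" if "a' < u" "u < b'" for u
    using that s by (auto simp: a'_def b'_def split: if_splits)
  define m where "m = (\<lambda>u. s * h (s * u))"
  have m_pos: "m u > 0" if "a' < u" "u < b'" for u using pos su[OF that] by (simp add: m_def)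
  have m_cont: "continuous_on {a'<..<b'} m"
    unfolding m_def
    by (intro continuous_intros continuous_on_compose2[OF hc]) (use su in auto)
  \<comment> \<open>The primitive is taken on the open interval, since \<open>1 / m\<close> may blow
    up at its ends.\<close>
  have "\<exists>\<tau>. \<forall>u. ereal a' < ereal u \<longrightarrow> ereal u < ereal b' \<longrightarrow> (\<tau> has_vector_derivative 1 / m u) (at u)"
  proof (rule einterval_antiderivative)
    fix u assume "ereal a' < ereal u" "ereal u < ereal b'"
    then have u: "a' < u" "u < b'" by auto
    then have "isCont m u" using m_cont continuous_on_eq_continuous_at[of "{a'<..<b'}" m] by auto
    then show "isCont (\<lambda>u. 1 / m u) u" using m_pos[OF u] by (intro continuous_intros) auto
  qed (use ab' in simp)
  then obtain \<tau> where tau: "\<And>u. a' < u \<Longrightarrow> u < b' \<Longrightarrow> (\<tau> has_real_derivative 1 / m u) (at u)"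
    by (auto simp: has_real_derivative_iff_has_vector_derivative)
  have "contact_flow \<phi> G F U s m \<tau> a' b'"
  proof unfold_locales
    fix u assume u: "a' < u" "u < b'"
    show "cis (s * u) \<in> U" using arc su[OF u] by blast
    have "of_real s * of_real (m u) = complex_of_real (h (s * u))"
      using s by (auto simp: m_def)
    then show "F (cis (s * u)) = \<i> * of_real s * cis (s * u) * of_real (m u)"
      using Fh[OF su[OF u]] by (metis (no_types, lifting) mult.assoc mult.commute)
  qed (use s U m_pos m_cont tau in auto)
  then show thesis using that unfolding a'_def b'_def by blast
qed

end

context contact_flow
begin

lemma p_eq_iff: "p x = p y \<longleftrightarrow> (\<exists>n::int. x = y + 2 * pi * of_int n)"
proof -
  have "p x = p y \<longleftrightarrow> sin (s * x) = sin (s * y) \<and> cos (s * x) = cos (s * y)"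
    by (auto simp: p_def complex_eq_iff)
  also have "\<dots> \<longleftrightarrow> sin x = sin y \<and> cos x = cos y" using s by auto
  finally show ?thesis by (simp add: sin_cos_eq_iff)
qed

lemma p_inj:
  assumes "p x = p y" "\<bar>x - y\<bar> < 2 * pi"
  shows "x = y"
proof -
  obtain n :: int where n: "x = y + 2 * pi * of_int n" using assms(1) p_eq_iff by auto
  then have "2 * pi * \<bar>of_int n\<bar> < 2 * pi * (1::real)" using assms(2) by (simp add: abs_mult)
  then have "\<bar>of_int n\<bar> < (1::real)" by (subst (asm) mult_less_cancel_left_pos) auto
  then have "n = 0" by simp
  then show ?thesis using n by simp
qed

lemma contact_point_arc:
  assumes "a < u" "u < b"
  shows "contact_point G (p u)"
proof (rule contact_points_of_extension[OF open_U holomorphic_F])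
  show "F z = G z" if "z \<in> disc \<inter> U" for z using F_eq_G that by blast
  have "cnj (p u) * p u = 1" using complex_norm_square[of "p u"] by (simp add: mult.commute)
  then have "cnj (p u) * F (p u) = \<i> * of_real (s * m u)"
    using F_p[OF assms] by (simp add: algebra_simps)
  then show "Re (cnj (p u) * F (p u)) = 0" by simp
  show "F (p u) \<noteq> 0" using F_p[OF assms] m_pos[OF assms] s norm_p[of u] by (auto simp del: norm_p)
qed (use p_in_U assms in auto)

end

text \<open>The boundary flow runs around the circle, and one turn takes the same time
  \<open>Q\<close> from every starting point. So the boundary values of \<open>\<phi> Q\<close> are
  those of the identity, and the maximum principle makes \<open>Q\<close> a period.\<close>

lemma (in generated_semigroup) elliptic_group_if_circle_contact:
  assumes cp: "\<And>\<sigma>. norm \<sigma> = 1 \<Longrightarrow> contact_point G \<sigma>"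
  shows "elliptic_group \<phi>"
proof -
  obtain F U where U: "open U" "sphere 0 1 \<subseteq> U" "F holomorphic_on disc \<union> U"
    and FG: "\<And>z. z \<in> disc \<Longrightarrow> F z = G z"
    and tang: "\<And>\<sigma>. \<sigma> \<in> sphere 0 1 \<Longrightarrow> Re (cnj \<sigma> * F \<sigma>) = 0 \<and> F \<sigma> \<noteq> 0"
    by (rule contact_points_extension[OF generator_holomorphic order_refl]) (use cp in auto)
  have "F holomorphic_on U" using U(3) by (rule holomorphic_on_subset) auto
  \<comment> \<open>Four turns of the circle: the comparison of \<open>\<tau> (u + 2 * pi)\<close>
    with \<open>\<tau> u\<close> on an interval of length \<open>4 * pi\<close> then stays inside
    the parameter interval.\<close>
  then obtain s m \<tau> where cf: "contact_flow \<phi> G F U s m \<tau> (if s = 1 then 0 else - (8 * pi)) (if s = 1 then 8 * pi else - 0)"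
    by (rule contact_flow_ex[where a = 0 and b = "8 * pi", OF U(1)]) (use FG U(2) tang in \<open>auto simp: subset_iff simp del: complex_cnj_mult times_complex.sel\<close>)
  define a where "a = (if s = 1 then 0 else - (8 * pi))"
  define b where "b = a + 8 * pi"
  have "b = (if s = 1 then 8 * pi else - 0)" by (simp add: a_def b_def)
  then interpret contact_flow \<phi> G F U s m \<tau> a b using cf by (simp add: a_def)
  have per: "p (u + 2 * pi) = p u" for u using p_eq_iff[of "u + 2 * pi" u] by (auto intro: exI[of _ 1])
  have mper: "m (u + 2 * pi) = m u" if u: "a < u" "u < a + 4 * pi" for u
  proof -
    have "\<i> * of_real s * p u * of_real (m (u + 2 * pi)) = \<i> * of_real s * p u * complex_of_real (m u)"
    proof -
      have "a < u + 2 * pi" "u + 2 * pi < b" "u < b" using u pi_gt_zero by (auto simp: b_def)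
      then show ?thesis using F_p[of "u + 2 * pi"] F_p[of u] u(1) unfolding per by metis
    qed
    moreover have "p u \<noteq> 0" using norm_p[of u] by (auto simp del: norm_p)
    ultimately show ?thesis using s by auto
  qed
  define Q where "Q = \<tau> (a + pi + 2 * pi) - \<tau> (a + pi)"
  have Qc: "\<tau> (u + 2 * pi) - \<tau> u = Q" if u: "a < u" "u < a + 4 * pi" for u
    unfolding Q_def
  proof (rule DERIV_isconst3[of a "a + 4 * pi" u "a + pi" "\<lambda>u. \<tau> (u + 2 * pi) - \<tau> u"])
    fix v assume "v \<in> {a<..<a + 4 * pi}"
    then have v: "a < v" "v < a + 4 * pi" by auto
    have "((\<lambda>u. \<tau> (u + 2 * pi)) has_real_derivative 1 / m (v + 2 * pi) * 1) (at v)"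
      by (rule DERIV_chain2[where f = \<tau> and g = "\<lambda>u. u + 2 * pi", OF tau_deriv])
         (use v pi_gt_zero in \<open>auto simp: b_def intro!: derivative_eq_intros\<close>)
    moreover have "(\<tau> has_real_derivative 1 / m v) (at v)" using tau_deriv v by (simp add: b_def)
    ultimately have "((\<lambda>u. \<tau> (u + 2 * pi) - \<tau> u) has_real_derivative 1 / m (v + 2 * pi) * 1 - 1 / m v) (at v)"
      by (rule DERIV_diff)
    then show "((\<lambda>u. \<tau> (u + 2 * pi) - \<tau> u) has_real_derivative 0) (at v)" using mper[OF v] by simp
  qed (use u pi_gt_zero in auto)
  have Qpos: "Q > 0" using tau_less[of "a + pi" "a + pi + 2 * pi"] pi_gt_zero by (simp add: Q_def b_def)
  have lim: "(\<phi> Q \<longlongrightarrow> \<sigma>) (at \<sigma> within disc)" if sig: "norm \<sigma> = 1" for \<sigma>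
  proof -
    obtain u where u: "a + pi \<le> u" "u < a + pi + 2 * pi" "\<sigma> = cis (s * u)"
      using circle_point_angle[OF sig s] by blast
    have "(\<phi> (\<tau> (u + 2 * pi) - \<tau> u) \<longlongrightarrow> p (u + 2 * pi)) (at (p u) within disc)"
      using u pi_gt_zero by (intro flow_along_arc) (auto simp: b_def)
    then show ?thesis using Qc[of u] u pi_gt_zero per[of u] by (simp add: p_def)
  qed
  have "\<phi> Q z = z" if z: "z \<in> disc" for z
  proof -
    have "norm (\<phi> Q z - z) \<le> 0"
    proof (rule maximum_modulus_limsup[of "\<lambda>z. \<phi> Q z - z" disc 0, OF _ _ _ _ z])
      show "(\<lambda>z. \<phi> Q z - z) holomorphic_on disc"
        using flow_holomorphic[of Q] Qpos by (intro holomorphic_intros) auto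
      fix \<zeta> :: complex and \<epsilon> :: real assume "\<zeta> \<in> frontier disc" and e: "\<epsilon> > 0"
      then have "norm \<zeta> = 1" by simp
      then have "((\<lambda>z. norm (\<phi> Q z - z)) \<longlongrightarrow> norm (\<zeta> - \<zeta>)) (at \<zeta> within disc)"
        by (intro tendsto_intros lim)
      then show "\<forall>\<^sub>F z in at \<zeta> within disc. norm (\<phi> Q z - z) < 0 + \<epsilon>"
        using e by (intro order_tendstoD(2)) auto
    qed auto
    then show ?thesis by simp
  qed
  then show ?thesis using elliptic_group_if_period[OF Qpos] by blast
qed

context contact_flow
begin

lemma p_image:
  "p ` {c<..<d} = cis ` {(if s = 1 then c else - d)<..<(if s = 1 then d else - c)}"
proof (cases "s = 1")
  case False
  have "(\<lambda>u. cis (- u)) ` {c<..<d} = cis ` (uminus ` {c<..<d})" by (simp only: image_image)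
  moreover have "s * u = - u" for u using False s by auto
  then have "p = (\<lambda>u. cis (- u))" by (simp add: p_def fun_eq_iff)
  ultimately show ?thesis using False by simp
next
  case True
  then have "p u = cis u" for u unfolding p_def by simp
  then have "p = cis" by (simp add: fun_eq_iff)
  then show ?thesis using True by simp
qed

lemma open_arc_p:
  assumes "c < d" "d \<le> c + 2 * pi"
  shows "open_arc (p ` {c<..<d})"
  unfolding open_arc_def p_image
proof (intro exI conjI)
  let ?c = "if s = 1 then c else - d" and ?d = "if s = 1 then d else - c"
  show "?c < ?d" "?d \<le> ?c + 2 * pi" using assms by auto
qed (rule refl)

lemma interior_limit_after:
  assumes ab: "b \<le> a + 2 * pi" and maximal: "maximal_contact_arc \<phi> (p ` {a<..<b})" and ne: "\<not> elliptic_group \<phi>"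
    and beta: "tau_sup \<beta>" and u: "a < u" "u < b" and t: "t \<ge> 0" "\<beta> < \<tau> u + t"
  shows "interior_limit u t"
proof (rule ccontr)
  assume n: "\<not> interior_limit u t"
  have "\<beta> < t + \<tau> u" using t(2) by simp
  then obtain r where r: "r > 0" "\<And>z. z \<in> ball (p b) r \<Longrightarrow> norm z = 1 \<Longrightarrow> contact_point G z"
    using contact_points_near_end[OF beta u t(1) n] by blast
  show False
  proof (cases "b = a + 2 * pi")
    \<comment> \<open>The arc misses only the point \<open>p a = p b\<close>, which the
      neighbourhood of the end covers.\<close>
    case True
    have "contact_point G \<sigma>" if sig: "norm \<sigma> = 1" for \<sigma>
    proof -
      obtain v where v: "a \<le> v" "v < a + 2 * pi" "\<sigma> = p v"
        using circle_point_angle[OF sig s] unfolding p_def by blast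
      show ?thesis
      proof (cases "v = a")
        case True
        have "p v = p b" using p_eq_iff[of b v] \<open>b = a + 2 * pi\<close> True by (auto intro!: exI[of _ 1])
        then show ?thesis using r(2)[of \<sigma>] r(1) sig v(3) by simp
      next
        case False
        then show ?thesis using contact_point_arc[of v] v \<open>b = a + 2 * pi\<close> by simp
      qed
    qed
    then show False using elliptic_group_if_circle_contact ne by blast
  next
    case False
    have "p \<midarrow>b\<rightarrow> p b" using isCont_p by (simp add: isCont_def)
    then have "\<forall>\<^sub>F v in at b. dist (p v) (p b) < r" using r(1) by (rule tendstoD)
    then obtain d where d: "d > 0" "\<And>v. v \<noteq> b \<Longrightarrow> dist v b < d \<Longrightarrow> dist (p v) (p b) < r"
      unfolding eventually_at by auto
    \<comment> \<open>The prolonged arc must not be longer than \<open>2 * pi\<close>, as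
      \<open>open_arc\<close> demands.\<close>
    define e where "e = min d (a + 2 * pi - b)"
    have e: "e > 0" "e \<le> d" "b + e \<le> a + 2 * pi" using d(1) ab False by (auto simp: e_def)
    define B where "B = p ` {a<..<b + e}"
    have cpB: "contact_point G \<sigma>" if "\<sigma> \<in> B" for \<sigma>
    proof -
      obtain v where v: "a < v" "v < b + e" "\<sigma> = p v" using \<open>\<sigma> \<in> B\<close> by (auto simp: B_def)
      show ?thesis
      proof (cases "v < b")
        case True
        then show ?thesis using contact_point_arc v by blast
      next
        case False
        then have "dist (p v) (p b) < r" using d(2)[of v] v e r(1) by (cases "v = b") (auto simp: dist_real_def)
        then show ?thesis using r(2)[of \<sigma>] v(3) by (simp add: dist_commute)
      qed
    qed
    have "B \<subseteq> sphere 0 1" by (auto simp: B_def)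
    then obtain F' U' where F': "open U'" "B \<subseteq> U'" "F' holomorphic_on disc \<union> U'" "\<And>z. z \<in> disc \<Longrightarrow> F' z = G z"
      "\<And>\<sigma>. \<sigma> \<in> B \<Longrightarrow> Re (cnj \<sigma> * F' \<sigma>) = 0 \<and> F' \<sigma> \<noteq> 0"
      by (rule contact_points_extension[OF generator_holomorphic _ cpB]) auto
    have "generator_extension \<phi> B F'"
      unfolding generator_extension_def using F' generator by blast
    moreover have "open_arc B" unfolding B_def using u e by (intro open_arc_p) auto
    ultimately have "contact_arc \<phi> B" unfolding contact_arc_def using F'(5) by blast
    moreover have "p ` {a<..<b} \<subset> B"
    proof -
      have "p ` {a<..<b} \<subseteq> B" unfolding B_def using e by (intro image_mono) auto
      moreover have "p b \<in> B" unfolding B_def using u e by (intro imageI) auto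
      moreover have "p b \<notin> p ` {a<..<b}"
      proof
        assume "p b \<in> p ` {a<..<b}"
        then obtain v where "a < v" "v < b" "p b = p v" by auto
        then show False using p_inj[of b v] ab by auto
      qed
      ultimately show ?thesis by blast
    qed
    ultimately show False using maximal unfolding maximal_contact_arc_def by blast
  qed
qed

section \<open>Independence of the chosen extension and parametrisation\<close>

text \<open>Both extensions are continuous at \<open>p u\<close>, and their values there are limits
  of the generator from inside the disc.\<close>

lemma generator_extension_unique:
  assumes "generator_extension \<phi> (p ` {a<..<b}) F'" and u: "a < u" "u < b"
  shows "F' (p u) = F (p u)"
proof -
  obtain G' U' where G': "infinitesimal_generator \<phi> G'" "open U'" "p ` {a<..<b} \<subseteq> U'"
    "F' holomorphic_on disc \<union> U'" "\<And>z. z \<in> disc \<Longrightarrow> F' z = G' z"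
    using assms(1) unfolding generator_extension_def by blast
  have "p u \<in> U'" using G'(3) u by auto
  then have "isCont F' (p u)"
    using holomorphic_on_imp_continuous_on[OF holomorphic_on_subset[OF G'(4), of U']] G'(2)
      continuous_on_eq_continuous_at[OF G'(2)] by auto
  then have 1: "(F' \<longlongrightarrow> F' (p u)) (at (p u) within disc)"
    using continuous_at_imp_continuous_at_within continuous_within by blast
  have "isCont F (p u)"
    using holomorphic_on_imp_continuous_on[OF holomorphic_F] p_in_U[OF u] continuous_on_eq_continuous_at[OF open_U] by blast
  then have 2: "(F \<longlongrightarrow> F (p u)) (at (p u) within disc)"
    using continuous_at_imp_continuous_at_within continuous_within by blast
  have "\<forall>\<^sub>F z in at (p u). z \<in> U" using p_in_U[OF u] open_U by (metis eventually_at_in_open')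
  then have "\<forall>\<^sub>F z in at (p u) within disc. F z = F' z"
    unfolding eventually_at_filter
    by eventually_elim (use F_eq_G G'(5) generator_unique[OF G'(1)] in auto)
  then have "(F' \<longlongrightarrow> F (p u)) (at (p u) within disc)" by (rule Lim_transform_eventually[OF 2])
  then show ?thesis using 1 tendsto_unique[OF disc_filter_nontrivial] by blast
qed

lemma natural_parametrisation_p:
  assumes ab: "a < b" "b \<le> a + 2 * pi" and ext: "generator_extension \<phi> (p ` {a<..<b}) F"
  shows "natural_parametrisation \<phi> (p ` {a<..<b}) p a b"
  unfolding natural_parametrisation_def
proof (intro conjI exI[of _ F] ballI)
  show "continuous_on {a..b} p" using isCont_p continuous_at_imp_continuous_on by blast
  have "inj_on p {a<..<b}"
  proof (rule inj_onI)
    fix x y assume "x \<in> {a<..<b}" "y \<in> {a<..<b}" "p x = p y"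
    then show "x = y" using ab by (intro p_inj) auto
  qed
  then show "bij_betw p {a<..<b} (p ` {a<..<b})" by (simp add: bij_betw_def)
  fix u assume "u \<in> {a<..<b}"
  then have u: "a < u" "u < b" by auto
  have "F (p u) / of_real (norm (F (p u))) = \<i> * of_real s * p u"
    using F_p[OF u] m_pos[OF u] s by (auto simp: norm_mult)
  then show "(p has_vector_derivative F (p u) / of_real (norm (F (p u)))) (at u)"
    using p_has_vector_derivative[of u UNIV] by simp
qed (use ab ext in auto)

text \<open>On the arc \<open>G / \<bar>G\<bar>\<close> is the field \<open>\<i> s z\<close>, whose integral curves are the translates of \<open>p\<close>.\<close>

lemma natural_parametrisation_unique:
  assumes ab: "a < b" "b \<le> a + 2 * pi" and np: "natural_parametrisation \<phi> (p ` {a<..<b}) q a' b'"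
  obtains c where "a' + c = a" "b' + c = b" "\<And>u. a' \<le> u \<Longrightarrow> u \<le> b' \<Longrightarrow> q u = p (u + c)"
proof -
  obtain F' where ab': "a' < b'" and qc: "continuous_on {a'..b'} q" and bij: "bij_betw q {a'<..<b'} (p ` {a<..<b})"
    and ext: "generator_extension \<phi> (p ` {a<..<b}) F'"
    and qd: "\<And>u. u \<in> {a'<..<b'} \<Longrightarrow> (q has_vector_derivative F' (q u) / of_real (norm (F' (q u)))) (at u)"
    using np unfolding natural_parametrisation_def by blast
  have img: "q ` {a'<..<b'} = p ` {a<..<b}" using bij by (simp add: bij_betw_def)
  have qd': "(q has_vector_derivative \<i> * of_real s * q u) (at u)" if u: "u \<in> {a'<..<b'}" for u
  proof -
    have "q u \<in> p ` {a<..<b}" using img u by blast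
    then obtain v where v: "a < v" "v < b" "q u = p v" by auto
    have "F' (q u) / of_real (norm (F' (q u))) = \<i> * of_real s * q u"
      using generator_extension_unique[OF ext v(1,2)] F_p[OF v(1,2)] m_pos[OF v(1,2)] s v(3) by (auto simp: norm_mult)
    then show ?thesis using qd[OF u] by simp
  qed
  define u1 where "u1 = (a' + b') / 2"
  have u1: "u1 \<in> {a'<..<b'}" using ab' by (auto simp: u1_def)
  have "q u1 \<in> p ` {a<..<b}" using img u1 by blast
  then obtain x where x: "a < x" "x < b" "q u1 = p x" by auto
  define c where "c = x - u1"
  have pneg: "((\<lambda>u. p (- u)) has_vector_derivative - (\<i> * of_real s * p (- u))) (at u)" for u
  proof -
    have "((\<lambda>u. p (- u)) has_vector_derivative (- 1) *\<^sub>R (\<i> * of_real s * p (- u))) (at u)"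
      by (rule vector_diff_chain_within[unfolded o_def, of "\<lambda>u. - u" "- 1" u UNIV p])
         (auto intro!: derivative_eq_intros p_has_vector_derivative)
    then show ?thesis by simp
  qed
  \<comment> \<open>\<open>p (- u)\<close> is the reciprocal of \<open>p u\<close>, so a constant
    product says that \<open>q\<close> is a rotation, hence a translate, of
    \<open>p\<close>.\<close>
  have "\<exists>C. \<forall>u\<in>{a'<..<b'}. q u * p (- u) = C"
  proof (rule has_vector_derivative_zero_constant)
    fix u assume u: "u \<in> {a'<..<b'}"
    have "((\<lambda>u. q u * p (- u)) has_vector_derivative q u * - (\<i> * of_real s * p (- u)) + \<i> * of_real s * q u * p (- u)) (at u)"
      by (rule has_vector_derivative_mult[OF qd'[OF u] pneg])
    moreover have "q u * - (\<i> * of_real s * p (- u)) + \<i> * of_real s * q u * p (- u) = 0" by (simp add: algebra_simps)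
    ultimately show "((\<lambda>u. q u * p (- u)) has_vector_derivative 0) (at u within {a'<..<b'})"
      by (metis has_vector_derivative_at_within)
  qed auto
  then obtain C where C: "\<And>u. u \<in> {a'<..<b'} \<Longrightarrow> q u * p (- u) = C" by blast
  have pp: "p y * p z = p (y + z)" for y z by (simp add: p_def cis_mult algebra_simps)
  have p0: "p 0 = 1" by (simp add: p_def)
  have Cc: "C = p c" using C[OF u1] x(3) pp[of x "- u1"] by (simp add: c_def)
  have q_open: "q u = p (u + c)" if "u \<in> {a'<..<b'}" for u
  proof -
    have "q u = q u * p (- u) * p u" using pp[of "- u" u] p0 by (simp add: mult.assoc)
    also have "\<dots> = p (u + c)" using C[OF that] Cc pp[of c u] by (simp add: add.commute)
    finally show ?thesis .
  qed
  have q_closed: "q u = p (u + c)" if u: "a' \<le> u" "u \<le> b'" for u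
  proof -
    have pc: "continuous_on {a'..b'} (\<lambda>u. p (u + c))"
      unfolding p_def by (intro continuous_intros)
    have "q u - p (u + c) = 0"
      by (rule continuous_constant_on_closure[of "{a'<..<b'}" "\<lambda>u. q u - p (u + c)"])
         (use ab' u q_open continuous_on_diff[OF qc pc] in auto)
    then show ?thesis by simp
  qed
  define a1 where "a1 = a' + c"
  define b1 where "b1 = b' + c"
  have x1: "a1 < x" "x < b1" using u1 by (auto simp: a1_def b1_def c_def)
  have img1: "p v \<in> p ` {a<..<b}" if "a1 < v" "v < b1" for v
  proof -
    have "v - c \<in> {a'<..<b'}" using that by (auto simp: a1_def b1_def)
    then have "q (v - c) \<in> p ` {a<..<b}" "q (v - c) = p (v - c + c)" using img q_open by blast+
    then show ?thesis by simp
  qed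
  have img2: "\<exists>v. a1 < v \<and> v < b1 \<and> p y = p v" if "a < y" "y < b" for y
  proof -
    have "p y \<in> q ` {a'<..<b'}" unfolding img using that by auto
    then obtain u where "u \<in> {a'<..<b'}" "p y = q u" by auto
    then show ?thesis using q_open[of u] by (intro exI[of _ "u + c"]) (auto simp: a1_def b1_def)
  qed
  \<comment> \<open>An end point of one interval in the interior of the other would be mapped into
    the common image, hence to the same point as a different parameter less than
    \<open>2 * pi\<close> away.\<close>
  have "a \<le> a1"
  proof (rule ccontr)
    assume "\<not> a \<le> a1"
    then obtain v where "a < v" "v < b" "p a = p v" using img1[of a] x x1 by auto
    then show False using p_inj[of a v] ab by auto
  qed
  moreover have "b1 \<le> b"
  proof (rule ccontr)
    assume "\<not> b1 \<le> b"
    then obtain v where "a < v" "v < b" "p b = p v" using img1[of b] x x1 by auto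
    then show False using p_inj[of b v] ab by auto
  qed
  moreover have "a1 \<le> a"
  proof (rule ccontr)
    assume "\<not> a1 \<le> a"
    then obtain v where "a1 < v" "v < b1" "p a1 = p v" using img2[of a1] x x1 by auto
    then show False using p_inj[of a1 v] ab \<open>a \<le> a1\<close> \<open>b1 \<le> b\<close> by auto
  qed
  moreover have "b \<le> b1"
  proof (rule ccontr)
    assume "\<not> b \<le> b1"
    then obtain v where "a1 < v" "v < b1" "p b1 = p v" using img2[of b1] x x1 by auto
    then show False using p_inj[of b1 v] ab \<open>a \<le> a1\<close> \<open>b1 \<le> b\<close> by auto
  qed
  ultimately show thesis using that[of c] q_closed by (simp add: a1_def b1_def)
qed

lemma initial_point_p:
  assumes "a < b" "b \<le> a + 2 * pi" "generator_extension \<phi> (p ` {a<..<b}) F"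
  shows "initial_point \<phi> (p ` {a<..<b}) = p a"
  unfolding initial_point_def
proof (rule the_equality)
  show "\<exists>q a' b'. natural_parametrisation \<phi> (p ` {a<..<b}) q a' b' \<and> p a = q a'"
    using natural_parametrisation_p[OF assms] by blast
  fix x assume "\<exists>q a' b'. natural_parametrisation \<phi> (p ` {a<..<b}) q a' b' \<and> x = q a'"
  then obtain q a' b' where q: "natural_parametrisation \<phi> (p ` {a<..<b}) q a' b'" "x = q a'" by blast
  obtain c where "a' + c = a" "b' + c = b" "\<And>u. a' \<le> u \<Longrightarrow> u \<le> b' \<Longrightarrow> q u = p (u + c)"
    using natural_parametrisation_unique[OF assms(1,2) q(1)] by blast
  then show "x = p a" using q(2) assms(1) by auto
qed

lemma final_point_p:
  assumes "a < b" "b \<le> a + 2 * pi" "generator_extension \<phi> (p ` {a<..<b}) F"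
  shows "final_point \<phi> (p ` {a<..<b}) = p b"
  unfolding final_point_def
proof (rule the_equality)
  show "\<exists>q a' b'. natural_parametrisation \<phi> (p ` {a<..<b}) q a' b' \<and> p b = q b'"
    using natural_parametrisation_p[OF assms] by blast
  fix x assume "\<exists>q a' b'. natural_parametrisation \<phi> (p ` {a<..<b}) q a' b' \<and> x = q b'"
  then obtain q a' b' where q: "natural_parametrisation \<phi> (p ` {a<..<b}) q a' b'" "x = q b'" by blast
  obtain c where "a' + c = a" "b' + c = b" "\<And>u. a' \<le> u \<Longrightarrow> u \<le> b' \<Longrightarrow> q u = p (u + c)"
    using natural_parametrisation_unique[OF assms(1,2) q(1)] by blast
  then show "x = p b" using q(2) assms(1) by auto
qed

lemma arc_precedesD:
  assumes ab: "a < b" "b \<le> a + 2 * pi" and "arc_precedes \<phi> (p ` {a<..<b}) x y"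
  obtains u v where "a \<le> u" "u < v" "v \<le> b" "x = p u" "y = p v"
proof -
  obtain q a' b' u v where q: "natural_parametrisation \<phi> (p ` {a<..<b}) q a' b'"
    and uv: "a' \<le> u" "u < v" "v \<le> b'" "x = q u" "y = q v"
    using assms(3) unfolding arc_precedes_def by blast
  obtain c where "a' + c = a" "b' + c = b" "\<And>u. a' \<le> u \<Longrightarrow> u \<le> b' \<Longrightarrow> q u = p (u + c)"
    using natural_parametrisation_unique[OF ab q] by blast
  then show thesis using uv by (intro that[of "u + c" "v + c"]) auto
qed

lemma closure_arc:
  assumes "a < b"
  shows "closure (p ` {a<..<b}) = p ` {a..b}"
proof
  have pc: "continuous_on X p" for X using isCont_p continuous_at_imp_continuous_on by blast
  have "compact (p ` {a..b})" by (rule compact_continuous_image[OF pc]) simp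
  then show "closure (p ` {a<..<b}) \<subseteq> p ` {a..b}"
    by (intro closure_minimal image_mono compact_imp_closed) auto
  have "p ` closure {a<..<b} \<subseteq> closure (p ` {a<..<b})"
    by (rule image_closure_subset[OF pc]) (auto simp: closure_subset)
  then show "p ` {a..b} \<subseteq> closure (p ` {a<..<b})" using assms by simp
qed

section \<open>Life-times\<close>

lemma nontangential_limit_arc:
  assumes "a < u" "t \<ge> 0" "u \<le> v" "v < b" "\<tau> u + t \<le> \<tau> v"
  shows "nontangential_limit (\<phi> t) (p u) \<in> sphere 0 1"
  using nontangential_limit_eqI[OF norm_p has_nontangential_limitI[OF flow_limit_arc[OF assms]]] by simp

lemma nontangential_limit_flow_0_p: "nontangential_limit (\<phi> 0) (p u) \<in> sphere 0 1"
  using nontangential_limit_flow_0[of "p u"] by simp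

text \<open>The initial point is the delicate one: if \<open>\<tau>\<close> is unbounded below, it
  is fixed; otherwise every positive time sends it, as an angular limit, to a point of the open
  arc.\<close>

lemma life_time_tau_unbounded:
  assumes ab: "a < b" and unb: "\<And>r. \<exists>u. a < u \<and> u < b \<and> r < \<tau> u" and u: "a \<le> u" "u \<le> b"
  shows "life_time \<phi> (p u) = \<infinity>"
proof (rule life_time_eqI)
  fix t :: real assume t: "t \<ge> 0"
  show "nontangential_limit (\<phi> t) (p u) \<in> sphere 0 1"
  proof (cases "u = b")
    case True
    then show ?thesis
      using nontangential_limit_eqI[OF norm_p nontangential_limit_end_unbounded[OF ab unb t]] by simp
  next
    case ub: False
    show ?thesis
    proof (cases "u = a")
      case False
      obtain v where v: "a < v" "v < b" "\<tau> u + t < \<tau> v" using unb by blast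
      then have "u \<le> v" using tau_less_iff[of u v] u ub False t by auto
      then show ?thesis using nontangential_limit_arc[of u t v] v u False t by simp
    next
      case ua: True
      show ?thesis
      proof (cases "\<forall>r. \<exists>u. a < u \<and> u < b \<and> \<tau> u < r")
        case True
        then show ?thesis
          using nontangential_limit_eqI[OF norm_p nontangential_limit_start_unbounded[OF ab _ t]] ua by simp
      next
        case False
        then obtain B where "\<And>u. a < u \<Longrightarrow> u < b \<Longrightarrow> B \<le> \<tau> u" by (meson not_less)
        then obtain \<alpha> where alpha: "tau_inf \<alpha>" using tau_inf_ex[OF ab] by blast
        show ?thesis
        proof (cases "t = 0")
          case True
          then show ?thesis using nontangential_limit_flow_0_p by simp
        next
          case False
          then have "\<alpha> < \<alpha> + t" using t by simp
          then obtain x where x: "a < x" "x < b" "\<tau> x < \<alpha> + t" using alpha unfolding tau_inf_def by blast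
          obtain y where y: "a < y" "y < b" "\<alpha> + t < \<tau> y" using unb by blast
          have "x \<le> y" using tau_less_iff[of x y] x y by auto
          then obtain w where "x \<le> w" "w \<le> y" "\<tau> w = \<alpha> + t" using tau_IVT[of x y "\<alpha> + t"] x y by auto
          then have "has_nontangential_limit (\<phi> t) (p a) (p w)"
            using nontangential_limit_start_arc[OF alpha t, of w] x y by simp
          then show ?thesis using nontangential_limit_eqI[OF norm_p] ua by simp
        qed
      qed
    qed
  qed
qed (use nontangential_limit_flow_0_p in auto)

end

text \<open>Arcs that are run through in finite remaining time. The second assumption is supplied by
  \<open>interior_limit_after\<close> for maximal arcs of semigroups that are not elliptic
  groups.\<close>

locale contact_flow_bounded = contact_flow +
  fixes \<beta> :: real
  assumes beta: "tau_sup \<beta>"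
    and interior_after: "\<And>u t. a < u \<Longrightarrow> u < b \<Longrightarrow> t \<ge> 0 \<Longrightarrow> \<beta> < \<tau> u + t \<Longrightarrow> interior_limit u t"
begin

lemma tau_less_beta: "a < u \<Longrightarrow> u < b \<Longrightarrow> \<tau> u < \<beta>"
  using beta by (simp add: tau_sup_def)

lemma not_sphere_if_disc:
  assumes "\<zeta> \<in> disc" "has_nontangential_limit f (p u) \<zeta>"
  shows "nontangential_limit f (p u) \<notin> sphere 0 1"
  using nontangential_limit_eqI[OF norm_p assms(2)] assms(1) by simp

lemma life_time_arc:
  assumes u: "a < u" "u < b"
  shows "life_time \<phi> (p u) = ereal (\<beta> - \<tau> u)"
proof (rule life_time_eqI)
  show "0 \<le> ereal (\<beta> - \<tau> u)" using tau_less_beta[OF u] by simp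
  fix t :: real assume t: "t \<ge> 0"
  show "nontangential_limit (\<phi> t) (p u) \<in> sphere 0 1" if "ereal t < ereal (\<beta> - \<tau> u)"
  proof -
    have "\<tau> u + t < \<beta>" using that by simp
    then obtain v where v: "a < v" "v < b" "\<tau> u + t < \<tau> v" using beta by (auto simp: tau_sup_def)
    then have "u \<le> v" using tau_less_iff[of u v] u t by auto
    then show ?thesis using nontangential_limit_arc[of u t v] v u t by simp
  qed
  show "nontangential_limit (\<phi> t) (p u) \<notin> sphere 0 1" if "ereal (\<beta> - \<tau> u) < ereal t"
  proof -
    have "\<beta> < \<tau> u + t" using that by simp
    then obtain \<zeta> where "\<zeta> \<in> disc" "(\<phi> t \<longlongrightarrow> \<zeta>) (at (p u) within disc)"
      using interior_after[OF u t] by (auto simp: interior_limit_def)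
    then show ?thesis using not_sphere_if_disc has_nontangential_limitI by blast
  qed
qed (rule nontangential_limit_flow_0_p)

lemma life_time_end: "life_time \<phi> (p b) = 0"
proof (rule life_time_eqI)
  show "nontangential_limit (\<phi> t) (p b) \<notin> sphere 0 1" if t: "0 < ereal t" for t
  proof -
    have "t > 0" using t by simp
    then obtain \<zeta> where "\<zeta> \<in> disc" "has_nontangential_limit (\<phi> t) (p b) \<zeta>"
      using nontangential_limit_end_interior[OF beta interior_after] by blast
    then show ?thesis by (rule not_sphere_if_disc)
  qed
qed (use nontangential_limit_flow_0_p in auto)

text \<open>At a Denjoy-Wolff point on the circle the angular limit of \<open>\<phi> 1\<close> is
  the point itself, whereas at \<open>p b\<close> it lies in the disc.\<close>

lemma not_denjoy_wolff_end: "\<not> is_denjoy_wolff_point \<phi> (p b)"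
proof
  assume dw: "is_denjoy_wolff_point \<phi> (p b)"
  obtain \<zeta> where z: "\<zeta> \<in> disc" "has_nontangential_limit (\<phi> 1) (p b) \<zeta>"
    using nontangential_limit_end_interior[OF beta interior_after zero_less_one] by blast
  have "\<zeta> = p b" using nontangential_limit_at_denjoy_wolff[OF dw norm_p _ z(2)] by simp
  then show False using z(1) by simp
qed

lemma start_arc_time:
  assumes alpha: "tau_inf \<alpha>" and t: "0 < t" "t < \<beta> - \<alpha>"
  obtains w where "a < w" "w < b" "has_nontangential_limit (\<phi> t) (p a) (p w)"
proof -
  obtain x where x: "a < x" "x < b" "\<tau> x < \<alpha> + t" using alpha t(1) unfolding tau_inf_def by (meson less_add_same_cancel1)
  have "\<alpha> + t < \<beta>" using t(2) by simp
  then obtain y where y: "a < y" "y < b" "\<alpha> + t < \<tau> y" using beta unfolding tau_sup_def by blast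
  have "x \<le> y" using tau_less_iff[of x y] x y by auto
  then obtain w where "x \<le> w" "w \<le> y" "\<tau> w = \<alpha> + t" using tau_IVT[of x y "\<alpha> + t"] x y by auto
  then show thesis using that[of w] nontangential_limit_start_arc[OF alpha _, of t w] x y t by simp
qed

lemma tau_inf_less_beta:
  assumes "tau_inf \<alpha>"
  shows "\<alpha> < \<beta>"
proof -
  obtain u where u: "a < u" "u < b" using beta unfolding tau_sup_def by (meson lt_ex)
  then have "\<alpha> < \<tau> u" using assms by (simp add: tau_inf_def)
  then show ?thesis using tau_less_beta[OF u] by simp
qed

lemma life_time_start:
  assumes alpha: "tau_inf \<alpha>"
  shows "life_time \<phi> (p a) = ereal (\<beta> - \<alpha>)"
proof (rule life_time_eqI)
  show "0 \<le> ereal (\<beta> - \<alpha>)" using tau_inf_less_beta[OF alpha] by simp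
  fix t :: real assume t: "t \<ge> 0"
  show "nontangential_limit (\<phi> t) (p a) \<in> sphere 0 1" if "ereal t < ereal (\<beta> - \<alpha>)"
  proof (cases "t = 0")
    case True
    then show ?thesis using nontangential_limit_flow_0_p by simp
  next
    case False
    then obtain w where "has_nontangential_limit (\<phi> t) (p a) (p w)"
      using start_arc_time[OF alpha, of t] t \<open>ereal t < _\<close> by auto
    then show ?thesis using nontangential_limit_eqI[OF norm_p] by simp
  qed
  show "nontangential_limit (\<phi> t) (p a) \<notin> sphere 0 1" if "ereal (\<beta> - \<alpha>) < ereal t"
  proof -
    have "\<beta> < \<alpha> + t" using that by simp
    then obtain \<zeta> where "\<zeta> \<in> disc" "has_nontangential_limit (\<phi> t) (p a) \<zeta>"
      using nontangential_limit_start_interior[OF beta alpha interior_after t] by blast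
    then show ?thesis by (rule not_sphere_if_disc)
  qed
qed (rule nontangential_limit_flow_0_p)

lemma a_less_b: "a < b"
proof -
  obtain u where "a < u" "u < b" using beta unfolding tau_sup_def by (meson lt_ex)
  then show ?thesis by simp
qed

lemma fixed_start:
  assumes "\<And>r. \<exists>u. a < u \<and> u < b \<and> \<tau> u < r"
  shows "boundary_fixed_point \<phi> (p a)" "life_time \<phi> (p a) = \<infinity>"
proof -
  have lim: "nontangential_limit (\<phi> t) (p a) = p a" if "t \<ge> 0" for t
    using nontangential_limit_eqI[OF norm_p nontangential_limit_start_unbounded[OF a_less_b assms that]] .
  then show "boundary_fixed_point \<phi> (p a)" by (simp add: boundary_fixed_point_def)
  show "life_time \<phi> (p a) = \<infinity>" by (rule life_time_eqI) (use lim in auto)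
qed

lemma tau_inf_or_unbounded:
  obtains \<alpha> where "tau_inf \<alpha>" | "\<And>r. \<exists>u. a < u \<and> u < b \<and> \<tau> u < r"
proof (cases "\<forall>r. \<exists>u. a < u \<and> u < b \<and> \<tau> u < r")
  case False
  then obtain B where "\<And>u. a < u \<Longrightarrow> u < b \<Longrightarrow> B \<le> \<tau> u" by (meson not_less)
  then show thesis using tau_inf_ex[OF a_less_b] that(1) by blast
qed (use that in blast)

lemma life_time_start_gt:
  assumes u: "a < u" "u < b"
  shows "life_time \<phi> (p u) < life_time \<phi> (p a)"
proof (rule tau_inf_or_unbounded)
  fix \<alpha> assume alpha: "tau_inf \<alpha>"
  then have "\<alpha> < \<tau> u" using u by (simp add: tau_inf_def)
  then show ?thesis using life_time_start[OF alpha] life_time_arc[OF u] by simp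
next
  assume "\<And>r. \<exists>u. a < u \<and> u < b \<and> \<tau> u < r"
  then show ?thesis using fixed_start(2) life_time_arc[OF u] by simp
qed

lemma life_time_decreasing:
  assumes uv: "a \<le> u" "u < v" "v \<le> b"
  shows "life_time \<phi> (p v) < life_time \<phi> (p u)"
proof -
  have 1: "life_time \<phi> (p v) < life_time \<phi> (p u)" if "a < u" "u < v" "v \<le> b" for u v
  proof (cases "v = b")
    case True
    then show ?thesis using life_time_end life_time_arc[of u] tau_less_beta[of u] that by simp
  next
    case False
    then show ?thesis using life_time_arc[of u] life_time_arc[of v] tau_less[of u v] that by simp
  qed
  show ?thesis
  proof (cases "u = a")
    case True
    \<comment> \<open>At \<open>a\<close> only comparisons with the open arc are available, while
      \<open>v\<close> may be \<open>b\<close>; so an intermediate parameter is inserted.\<close>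
    define w where "w = (u + v) / 2"
    have "a < w" "w < v" "w < b" using uv True by (auto simp: w_def)
    then show ?thesis using 1[of w v] life_time_start_gt[of w] uv True by auto
  qed (use 1 uv in auto)
qed

text \<open>Coinciding end points would have two different life-times. Hence \<open>p\<close> is
  injective on the closed parameter interval of length at most \<open>2 * pi\<close>, and continuity
  can be transferred to the circle.\<close>

lemma arc_length_less: "b \<noteq> a + 2 * pi"
proof
  assume b: "b = a + 2 * pi"
  then have "p b = p a" using p_eq_iff[of b a] by (auto intro: exI[of _ 1])
  then show False using life_time_decreasing[of a b] a_less_b by simp
qed

text \<open>In the interior the life-time is \<open>\<beta> - \<tau> u\<close>. At the two ends
  monotonicity gives one inequality at once and reduces the other to finding a single parameter
  whose life-time is close enough to the end value.\<close>

lemma continuous_on_life_time_p: "continuous_on {a..b} (\<lambda>u. life_time \<phi> (p u))"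
  unfolding continuous_on_def
proof
  fix u assume u: "u \<in> {a..b}"
  let ?M = "\<lambda>u. life_time \<phi> (p u)"
  consider "u = a" | "u = b" | "a < u" "u < b" using u by force
  then show "(?M \<longlongrightarrow> ?M u) (at u within {a..b})"
  proof cases
    case 1
    have ge: "\<exists>w. a < w \<and> w < b \<and> l < ?M w" if l: "l < ?M a" for l
    proof (rule tau_inf_or_unbounded)
      fix \<alpha> assume alpha: "tau_inf \<alpha>"
      have "l < ereal (\<beta> - \<alpha>)" using l life_time_start[OF alpha] by simp
      then obtain r where r: "l < ereal r" "r < \<beta> - \<alpha>" using ereal_dense2 by force
      then have "\<alpha> < \<beta> - r" by simp
      then obtain w where "a < w" "w < b" "\<tau> w < \<beta> - r" using alpha unfolding tau_inf_def by blast
      then show ?thesis using r(1) life_time_arc[of w] by (intro exI[of _ w]) (auto intro: less_trans)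
    next
      assume unb: "\<And>r. \<exists>u. a < u \<and> u < b \<and> \<tau> u < r"
      have "l < \<infinity>" using l by (simp add: fixed_start(2)[OF unb])
      then obtain r where r: "l < ereal r" using less_PInf_Ex_of_nat by auto
      obtain w where "a < w" "w < b" "\<tau> w < \<beta> - r" using unb by blast
      then show ?thesis using r life_time_arc[of w] by (intro exI[of _ w]) (auto intro: less_trans)
    qed
    show ?thesis unfolding 1
    proof (rule order_tendstoI)
      fix l assume "l < ?M a"
      then obtain w where w: "a < w" "w < b" "l < ?M w" using ge by blast
      have "l < ?M v" if "v \<in> {a..b}" "dist v a < w - a" for v
        using life_time_decreasing[of v w] w that by (auto simp: dist_real_def intro: less_trans)
      then show "\<forall>\<^sub>F v in at a within {a..b}. l < ?M v"
        unfolding eventually_at using w(1) by (intro exI[of _ "w - a"]) auto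
    next
      fix l assume l: "?M a < l"
      have "?M v < l" if "v \<in> {a..b}" "v \<noteq> a" for v
        using life_time_decreasing[of a v] that l by (auto intro: less_trans)
      then show "\<forall>\<^sub>F v in at a within {a..b}. ?M v < l"
        unfolding eventually_at_filter by auto
    qed
  next
    case 2
    show ?thesis unfolding 2
    proof (rule order_tendstoI)
      fix l assume l: "?M b < l"
      then obtain r where r: "0 < r" "ereal r < l" using ereal_dense2[of 0 l] life_time_end by auto
      have "\<beta> - r < \<beta>" using r by simp
      then obtain w where w: "a < w" "w < b" "\<beta> - r < \<tau> w" using beta unfolding tau_sup_def by blast
      have Mw: "?M w < l" using life_time_arc[OF w(1,2)] w(3) r(2) by (auto intro: less_trans[OF _ r(2)])
      have "?M v < l" if "v \<in> {a..b}" "dist v b < b - w" for v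
        using life_time_decreasing[of w v] w that Mw by (auto simp: dist_real_def intro: less_trans)
      then show "\<forall>\<^sub>F v in at b within {a..b}. ?M v < l"
        unfolding eventually_at using w(2) by (intro exI[of _ "b - w"]) auto
    next
      fix l assume l: "l < ?M b"
      have "l < ?M v" if "v \<in> {a..b}" "v \<noteq> b" for v
        using life_time_decreasing[of v b] that l by (auto intro: less_trans)
      then show "\<forall>\<^sub>F v in at b within {a..b}. l < ?M v"
        unfolding eventually_at_filter by auto
    qed
  next
    case 3
    have "(\<tau> \<longlongrightarrow> \<tau> u) (at u within {a..b})"
      using isCont_tau[OF 3] continuous_at_imp_continuous_at_within continuous_within by blast
    then have "((\<lambda>v. ereal (\<beta> - \<tau> v)) \<longlongrightarrow> ereal (\<beta> - \<tau> u)) (at u within {a..b})"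
      by (intro tendsto_ereal tendsto_diff tendsto_const)
    moreover have "\<forall>\<^sub>F v in at u. v \<in> {a<..<b}" using 3 by (intro eventually_at_in_open') auto
    then have "\<forall>\<^sub>F v in at u within {a..b}. ereal (\<beta> - \<tau> v) = ?M v"
      unfolding eventually_at_filter by eventually_elim (use life_time_arc in auto)
    ultimately have "(?M \<longlongrightarrow> ereal (\<beta> - \<tau> u)) (at u within {a..b})" by (rule Lim_transform_eventually)
    then show ?thesis using life_time_arc[OF 3] by simp
  qed
qed

lemma continuous_on_life_time:
  assumes "b \<le> a + 2 * pi"
  shows "continuous_on (p ` {a..b}) (life_time \<phi>)"
proof -
  have inj: "inj_on p {a..b}"
  proof (rule inj_onI)
    fix x y assume "x \<in> {a..b}" "y \<in> {a..b}" "p x = p y"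
    then show "x = y" using assms arc_length_less by (intro p_inj) auto
  qed
  define g where "g = the_inv_into {a..b} p"
  have gp: "g (p u) = u" if "u \<in> {a..b}" for u
    unfolding g_def by (rule the_inv_into_f_f[OF inj that])
  have "continuous_on (p ` {a..b}) g"
  proof (rule continuous_on_inv)
    show "continuous_on {a..b} p" using isCont_p by (intro continuous_at_imp_continuous_on) blast
  qed (use gp in auto)
  then have "continuous_on (p ` {a..b}) (\<lambda>x. life_time \<phi> (p (g x)))"
    by (rule continuous_on_compose2[OF continuous_on_life_time_p]) (use gp in auto)
  moreover have "life_time \<phi> (p (g x)) = life_time \<phi> x" if "x \<in> p ` {a..b}" for x
    using that gp by auto
  ultimately show ?thesis using continuous_on_cong[of "p ` {a..b}" _ _ "life_time \<phi>"] by (metis (no_types, lifting))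
qed

text \<open>By monotonicity the life-time is largest at \<open>p a\<close>. It is finite exactly
  when \<open>\<tau>\<close> is bounded below; then some \<open>\<phi> t\<close> moves
  \<open>p a\<close> to another point of the arc, and otherwise \<open>p a\<close> is fixed.\<close>

lemma bounded_life_time_iff:
  assumes "b \<le> a + 2 * pi"
  shows "(\<exists>c::real. \<forall>x\<in>p ` {a..b}. life_time \<phi> x \<le> ereal c) \<longleftrightarrow> \<not> boundary_fixed_point \<phi> (p a)"
proof (rule tau_inf_or_unbounded)
  fix \<alpha> assume alpha: "tau_inf \<alpha>"
  have "life_time \<phi> x \<le> ereal (\<beta> - \<alpha>)" if x: "x \<in> p ` {a..b}" for x
  proof -
    obtain u where u: "u \<in> {a..b}" "x = p u" using x by blast
    then show ?thesis using life_time_decreasing[of a u] life_time_start[OF alpha] by (cases "u = a") auto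
  qed
  moreover have "\<not> boundary_fixed_point \<phi> (p a)"
  proof
    assume fixed: "boundary_fixed_point \<phi> (p a)"
    \<comment> \<open>Half the life-time of \<open>p a\<close>: at this time its image lies on the
      open arc.\<close>
    define t where "t = (\<beta> - \<alpha>) / 2"
    have t: "0 < t" "t < \<beta> - \<alpha>" using tau_inf_less_beta[OF alpha] by (auto simp: t_def)
    obtain w where w: "a < w" "w < b" "has_nontangential_limit (\<phi> t) (p a) (p w)"
      by (rule start_arc_time[OF alpha t])
    have "p w = p a" using nontangential_limit_eqI[OF norm_p w(3)] fixed t(1) by (simp add: boundary_fixed_point_def)
    then show False using p_inj[of w a] w assms by simp
  qed
  ultimately show ?thesis by blast
next
  assume unb: "\<And>r. \<exists>u. a < u \<and> u < b \<and> \<tau> u < r"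
  have "p a \<in> p ` {a..b}" using a_less_b by simp
  then show ?thesis using fixed_start[OF unb] by force
qed

end

theorem proposition4p7:
  fixes \<phi> :: "real \<Rightarrow> complex \<Rightarrow> complex" and A :: "complex set"
  assumes "holomorphic_semigroup \<phi>"
    and "\<not> elliptic_group \<phi>"
    and "maximal_contact_arc \<phi> A"
  shows "(exceptional \<phi> A \<longrightarrow> (\<forall>x\<in>closure A. life_time \<phi> x = \<infinity>)) \<and>
    (\<not> exceptional \<phi> A \<longrightarrow>
       continuous_on (closure A) (life_time \<phi>) \<and>
       monotone_on (closure A) (arc_precedes \<phi> A) (>) (life_time \<phi>) \<and>
       ((\<exists>c::real. \<forall>x\<in>closure A. life_time \<phi> x \<le> ereal c) \<longleftrightarrow>
          \<not> boundary_fixed_point \<phi> (initial_point \<phi> A)))"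
proof -
  have "contact_arc \<phi> A" using assms(3) by (simp add: maximal_contact_arc_def)
  then obtain a0 b0 F where ab0: "a0 < b0" "b0 \<le> a0 + 2 * pi" and A: "A = cis ` {a0<..<b0}"
    and ext: "generator_extension \<phi> A F" and tang: "\<And>z. z \<in> A \<Longrightarrow> Re (cnj z * F z) = 0 \<and> F z \<noteq> 0"
    unfolding contact_arc_def open_arc_def by blast
  obtain G U where G: "infinitesimal_generator \<phi> G" and U: "open U" "A \<subseteq> U" "F holomorphic_on disc \<union> U"
    and FG: "\<And>z. z \<in> disc \<Longrightarrow> F z = G z"
    using ext unfolding generator_extension_def by blast
  interpret generated_semigroup \<phi> G using assms(1) G by unfold_locales
  have hol: "F holomorphic_on U" using U(3) by (rule holomorphic_on_subset) auto
  have FGU: "F z = G z" if "z \<in> disc" "z \<in> U" for z using FG that(1) .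
  have arc: "cis x \<in> U \<and> Re (cnj (cis x) * F (cis x)) = 0 \<and> F (cis x) \<noteq> 0" if "a0 < x" "x < b0" for x
  proof -
    have "cis x \<in> A" unfolding A using that by simp
    then show ?thesis using tang[of "cis x"] U(2) by blast
  qed
  have "\<exists>s m \<tau>. contact_flow \<phi> G F U s m \<tau> (if s = 1 then a0 else - b0) (if s = 1 then b0 else - a0)"
    by (rule contact_flow_ex[OF U(1) hol FGU ab0(1) arc]) blast+
  then obtain s m \<tau> where cf: "contact_flow \<phi> G F U s m \<tau> (if s = 1 then a0 else - b0) (if s = 1 then b0 else - a0)"
    by blast
  \<comment> \<open>The angle interval of the arc, reflected when the flow runs clockwise.\<close>
  define a where "a = (if s = 1 then a0 else - b0)"
  define b where "b = (if s = 1 then b0 else - a0)"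
  interpret contact_flow \<phi> G F U s m \<tau> a b using cf by (simp add: a_def b_def)
  have ab: "a < b" "b \<le> a + 2 * pi" using ab0 by (auto simp: a_def b_def)
  have Ap: "A = p ` {a<..<b}" unfolding p_image A by (simp add: a_def b_def)
  have closA: "closure A = p ` {a..b}" unfolding Ap by (rule closure_arc[OF ab(1)])
  have exc: "exceptional \<phi> A \<longleftrightarrow> is_denjoy_wolff_point \<phi> (p b)"
    using assms(3) final_point_p[OF ab] ext unfolding exceptional_def Ap by simp
  have ini: "initial_point \<phi> A = p a" using initial_point_p[OF ab] ext unfolding Ap by simp
  show ?thesis
  \<comment> \<open>The distinction is made on the remaining time, and each case proves or refutes
    \<open>exceptional \<phi> A\<close>, so that exactly one of the two parts of the statement is
    left.\<close>
  proof (cases "\<forall>r. \<exists>u. a < u \<and> u < b \<and> r < \<tau> u")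
    case True
    then have "exceptional \<phi> A" using exc denjoy_wolff_if_tau_unbounded[OF ab(1)] by blast
    moreover have "\<forall>x\<in>closure A. life_time \<phi> x = \<infinity>"
      unfolding closA using life_time_tau_unbounded[OF ab(1)] True by auto
    ultimately show ?thesis by blast
  next
    case False
    then obtain B where "\<And>u. a < u \<Longrightarrow> u < b \<Longrightarrow> \<tau> u \<le> B" by (meson not_less)
    then obtain \<beta> where beta: "tau_sup \<beta>" using tau_sup_ex[OF ab(1)] by blast
    interpret contact_flow_bounded \<phi> G F U s m \<tau> a b \<beta>
      by unfold_locales (use beta interior_limit_after[OF ab(2) _ assms(2) beta] assms(3) Ap in auto)
    have "continuous_on (closure A) (life_time \<phi>)"
      unfolding closA by (rule continuous_on_life_time[OF ab(2)])
    moreover have "monotone_on (closure A) (arc_precedes \<phi> A) (>) (life_time \<phi>)"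
    proof (rule monotone_onI)
      fix x y assume "arc_precedes \<phi> A x y"
      then obtain u v where "a \<le> u" "u < v" "v \<le> b" "x = p u" "y = p v"
        unfolding Ap by (rule arc_precedesD[OF ab])
      then show "life_time \<phi> x > life_time \<phi> y" using life_time_decreasing by simp
    qed
    moreover have "(\<exists>c::real. \<forall>x\<in>closure A. life_time \<phi> x \<le> ereal c) \<longleftrightarrow>
        \<not> boundary_fixed_point \<phi> (initial_point \<phi> A)"
      unfolding closA ini by (rule bounded_life_time_iff[OF ab(2)])
    moreover have "\<not> exceptional \<phi> A" using exc not_denjoy_wolff_end by simp
    ultimately show ?thesis by blast
  qed
qed

end
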